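(* For any $n\ge1$ and any lattice $\mathcal L\subset\mathbb R^n$, $$\frac1{\sqrt{2\pi e}}\cdot\mu_{\det}(\mathcal L)\le\mu(\mathcal L)\le5\sqrt{\log n+1}\cdot L_n\cdot\mu_{\det}(\mathcal L).$$
   Context: A lattice $\mathcal L\subset\mathbb R^n$ is the set of all integer linear combinations of $n$ linearly independent vectors of $\mathbb R^n$. For a (possibly lower-rank) lattice with $\mathbb Z$-basis given by the columns of $B$, $\det:=\sqrt{\det(B^TB)}$. The covering radius is $\mu(\mathcal L):=\max_{x\in\mathbb R^n}\min_{y\in\mathcal L}\|x-y\|$ (Euclidean norm). A lattice subspace of $\mathcal L$ is a subspace $W\subset\mathbb R^n$ spanned by $k$ linearly independent vectors of $\mathcal L$ for some $0\le k<n$ (so $W=\{0\}$ is allowed, $W=\mathbb R^n$ is not). For such $W$, the orthogonal projection $\pi_{W^\perp}(\mathcal L)$ of $\mathcal L$ onto the orthogonal complement $W^\perp$ is a lattice of rank $\dim(W^\perp)$. Define $$\mu_{\det}(\mathcal L):=\max_W\sqrt{\dim(W^\perp)}\cdot\det(\pi_{W^\perp}(\mathcal L))^{1/\dim(W^\perp)},$$ the maximum being over lattice subspaces $W$ of $\mathcal L$. A convex body is a convex compact set with non-empty interior; it is symmetric if $-K=K$; a symmetric convex body $K\subset\mathbb R^d$ is isotropic if $\int_Kxx^T\,dx=\alpha I_d$ for some scalar $\alpha>0$. The (symmetric) isotropic constant $L_n>0$ is defined by $$L_n^2:=\max_{d\le n}\frac1d\sup_K\int_K\|x\|^2\,dx,$$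 where $1\le d\le n$ and the supremum is over all isotropic symmetric convex bodies $K\subset\mathbb R^d$ of volume one. $\log$ is the natural logarithm. *)

theory Defs
  imports "HOL-Analysis.Analysis" "Jordan_Normal_Form.Determinant"
begin

definition lattice_basis :: "'a::euclidean_space list \<Rightarrow> 'a set \<Rightarrow> bool" where
  "lattice_basis bs L \<longleftrightarrow> distinct bs \<and> independent (set bs) \<and>
     L = {\<Sum>i<length bs. of_int (c i) *\<^sub>R bs ! i | c :: nat \<Rightarrow> int. True}"

definition full_lattice :: "'a::euclidean_space set \<Rightarrow> bool" where
  "full_lattice L \<longleftrightarrow> (\<exists>bs. lattice_basis bs L \<and> length bs = DIM('a))"

text \<open>For \<open>B\<close> the matrix whose columns are \<open>bs\<close>, this is \<open>B\<^sup>T B\<close>.\<close>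

definition gram_matrix :: "'a::real_inner list \<Rightarrow> real mat" where
  "gram_matrix bs = mat (length bs) (length bs) (\<lambda>(i, j). inner (bs ! i) (bs ! j))"

text \<open>The value does not depend on the basis chosen, since two bases of the same lattice differ
  by a unimodular matrix.\<close>

definition lattice_det :: "'a::euclidean_space set \<Rightarrow> real" where
  "lattice_det L = sqrt (Determinant.det (gram_matrix (SOME bs. lattice_basis bs L)))"

text \<open>The maximum over \<open>x\<close> is written as a supremum; it is attained for a full-rank lattice.\<close>

definition covering_radius :: "'a::euclidean_space set \<Rightarrow> real" where
  "covering_radius L = (SUP x. infdist x L)"

definition lattice_subspace :: "'a::euclidean_space set \<Rightarrow> 'a set \<Rightarrow> bool" where
  "lattice_subspace L W \<longleftrightarrow>
     (\<exists>S. S \<subseteq> L \<and> independent S \<and> card S < DIM('a) \<and> W = span S)"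

definition orthogonal_projection :: "'a::euclidean_space set \<Rightarrow> 'a \<Rightarrow> 'a" where
  "orthogonal_projection V x = (THE y. y \<in> V \<and> x - y \<in> orthogonal_comp V)"

text \<open>The maximum over \<open>W\<close> is again written as a supremum; it is attained because, the projected
  lattice has determinant \<open>det L / det (L \<inter> W)\<close> and, for every bound, only finitely many sublattices
  \<open>L \<inter> W\<close> have determinant below it.\<close>

definition mu_det :: "'a::euclidean_space set \<Rightarrow> real" where
  "mu_det L = (SUP W \<in> {W. lattice_subspace L W}.
     sqrt (real (dim (orthogonal_comp W))) *
     lattice_det (orthogonal_projection (orthogonal_comp W) ` L)
       powr (1 / real (dim (orthogonal_comp W))))"

text \<open>Since the dimension \<open>d\<close> varies inside the definition of \<open>L\<^sub>n\<close>, the space \<open>\<real>\<^sup>d\<close> is represented by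
  the functions \<open>nat \<Rightarrow> real\<close> that are extensional on \<open>{..<d}\<close>, with the product topology and the
  product Lebesgue measure.\<close>

abbreviation Rd_top :: "nat \<Rightarrow> (nat \<Rightarrow> real) topology" where
  "Rd_top d \<equiv> product_topology (\<lambda>_. euclideanreal) {..<d}"

abbreviation Rd_lborel :: "nat \<Rightarrow> (nat \<Rightarrow> real) measure" where
  "Rd_lborel d \<equiv> Pi\<^sub>M {..<d} (\<lambda>_. lborel)"

definition convex_body :: "nat \<Rightarrow> (nat \<Rightarrow> real) set \<Rightarrow> bool" where
  "convex_body d K \<longleftrightarrow>
     compactin (Rd_top d) K \<and> Rd_top d interior_of K \<noteq> {} \<and>
     (\<forall>x\<in>K. \<forall>y\<in>K. \<forall>t\<in>{0..1}. (\<lambda>i\<in>{..<d}. (1 - t) * x i + t * y i) \<in> K)"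

definition symmetric_body :: "nat \<Rightarrow> (nat \<Rightarrow> real) set \<Rightarrow> bool" where
  "symmetric_body d K \<longleftrightarrow> (\<lambda>x. \<lambda>i\<in>{..<d}. - x i) ` K = K"

definition isotropic_body :: "nat \<Rightarrow> (nat \<Rightarrow> real) set \<Rightarrow> bool" where
  "isotropic_body d K \<longleftrightarrow> convex_body d K \<and> symmetric_body d K \<and>
     (\<exists>\<alpha>>0. \<forall>i<d. \<forall>j<d.
        (LINT x:K|Rd_lborel d. x i * x j) = (if i = j then \<alpha> else 0))"

text \<open>The inner supremum is a supremum of a nonempty set of reals (it contains the value of the
  unit cube) that is bounded above.\<close>

definition isotropic_constant :: "nat \<Rightarrow> real" where
  "isotropic_constant n = sqrt (MAX d\<in>{1..n}. 1 / real d *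
     (SUP K \<in> {K. isotropic_body d K \<and> measure (Rd_lborel d) K = 1}.
        (LINT x:K|Rd_lborel d. (L2_set x {..<d})\<^sup>2)))"

end

theory Submission
  imports Defs
begin

text \<open>
  Lower bound: the projection of \<open>L\<close> along \<open>W\<close> has covering radius at most \<open>\<mu>(L)\<close>, so the volume
  of a ball of this radius is at least its determinant.

  Upper bound: for a lattice \<open>N\<close> and a linear map \<open>T\<close>, let \<open>F(T)\<close> be the mean squared distance of \<open>T x\<close>
  to \<open>T N\<close>, where \<open>x\<close> is uniform modulo \<open>N\<close>; then \<open>\<mu>(N)\<^sup>2 \<le> 4 F(id)\<close>. At a maximizer \<open>T\<close> of \<open>F\<close> among the
  maps of Hilbert-Schmidt norm one, stationarity says that the Voronoi cell
  \<open>{x. \<forall>z\<in>N. |T x| \<le> |T (x - z)|}\<close> is isotropic, and this bounds \<open>F\<close> by the isotropic constant. If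
  there is no injective maximizer, some \<open>T v\<close> with \<open>v \<in> N\<close> nonzero is arbitrarily short, and one passes to the
  projection of \<open>N\<close> along \<open>v\<close>. Hence \<open>\<mu>(N)\<^sup>2 \<le> 4 k L\<^sub>n\<^sup>2 s\<^sup>2\<close> if \<open>N\<close> has rank \<open>k\<close> and every projection of \<open>N\<close> has normalized
  determinant at most \<open>s\<close>. In general, split off the projection of largest normalized determinant
  and iterate; if the successive ranks are \<open>c\<^sub>1, c\<^sub>2, \<dots>\<close>, this costs the factor
  \<open>\<Sum>\<^sub>i c\<^sub>i / (c\<^sub>1 + \<dots> + c\<^sub>i) \<le> ln n + 1\<close>.
\<close>

section \<open>Orthogonal projections\<close>

text \<open>The Voronoi cell of \<open>N\<close> need not be isotropic, and replacing
  \<open>N\<close> by another lattice would change the quantity to be bounded. So only the norm is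
  deformed: distances are measured after \<open>T\<close>, while the cell stays in the coordinates
  of \<open>N\<close>, where its volume is the determinant of \<open>N\<close> for every
  \<open>T\<close> injective on the span. At a maximizer, the derivative of F in direction
  \<open>H\<close> is twice the mean of the inner product of T x and H x over the cell, and the
  constraint makes it 2 F(T) times the Hilbert-Schmidt product of \<open>T\<close> and
  \<open>H\<close>. Maps \<open>H\<close> of rank one then reveal every second moment of the cell.
  The obstacle is that injective maps of norm one do not form a compact set. Singular limits lead to
  projected lattices, so the determinant hypothesis has to concern all projections of
  \<open>N\<close>; in this form it survives the induction on the rank. A second obstacle is that
  the suprema over projections are not shown to be attained: almost maximal ones are split off, at
  the price of factors 1 + \<eta> that vanish in the limit.\<close>

definition qproj :: "'a::euclidean_space set \<Rightarrow> 'a \<Rightarrow> 'a" where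
  "qproj W = orthogonal_projection (orthogonal_comp W)"

lemma orthogonal_compD: "x \<in> orthogonal_comp W \<Longrightarrow> y \<in> W \<Longrightarrow> inner x y = 0"
  by (auto simp: orthogonal_comp_def real_inner_class.orthogonal_def inner_commute)

lemma qproj_unique:
  fixes W :: "'a::euclidean_space set"
  assumes W: "subspace W" and y: "y \<in> orthogonal_comp W" "x - y \<in> W"
  shows "qproj W x = y"
proof -
  have ex: "x - y \<in> orthogonal_comp (orthogonal_comp W)"
    using y W by (simp add: orthogonal_comp_self)
  have "z = y" if z: "z \<in> orthogonal_comp W" "x - z \<in> orthogonal_comp (orthogonal_comp W)" for z
  proof -
    have zW: "x - z \<in> W" using z W by (simp add: orthogonal_comp_self)
    have "z - y \<in> W" using subspace_diff[OF W y(2) zW] by simp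
    moreover have "z - y \<in> orthogonal_comp W"
      using subspace_diff[OF subspace_orthogonal_comp z(1) y(1)] .
    ultimately have "inner (z - y) (z - y) = 0" by (rule orthogonal_compD[rotated])
    thus ?thesis by simp
  qed
  thus ?thesis unfolding qproj_def orthogonal_projection_def using y ex
    by (intro the_equality) blast+
qed

lemma
  fixes W :: "'a::euclidean_space set"
  assumes W: "subspace W"
  shows qproj_mem: "qproj W x \<in> orthogonal_comp W"
    and qproj_diff: "x - qproj W x \<in> W"
proof -
  have "x \<in> W + orthogonal_comp W" using subspace_sum_orthogonal_comp[OF W] by simp
  then obtain u v where uv: "x = u + v" "u \<in> W" "v \<in> orthogonal_comp W"
    by (auto elim: set_plus_elim)
  have "qproj W x = v" by (rule qproj_unique) (use W uv in auto)
  thus "qproj W x \<in> orthogonal_comp W" "x - qproj W x \<in> W" using uv by auto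
qed

lemma linear_qproj:
  fixes W :: "'a::euclidean_space set"
  assumes W: "subspace W"
  shows "linear (qproj W)"
proof (rule linearI)
  fix x y :: 'a and c :: real
  show "qproj W (x + y) = qproj W x + qproj W y"
    using subspace_add[OF W qproj_diff[OF W, of x] qproj_diff[OF W, of y]] qproj_mem[OF W]
    by (intro qproj_unique W subspace_add subspace_orthogonal_comp) (auto simp: algebra_simps)
  show "qproj W (c *\<^sub>R x) = c *\<^sub>R qproj W x"
    using subspace_scale[OF W qproj_diff[OF W, of x], of c] qproj_mem[OF W]
    by (intro qproj_unique W subspace_scale subspace_orthogonal_comp) (auto simp: algebra_simps)
qed

lemma inner_qproj:
  assumes "subspace W" "w \<in> W" shows "inner (qproj W x) w = 0"
  using orthogonal_compD[OF qproj_mem[OF assms(1)] assms(2)] .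

lemma qproj_eq_0: "subspace W \<Longrightarrow> x \<in> W \<Longrightarrow> qproj W x = 0"
  by (rule qproj_unique) (auto simp: subspace_orthogonal_comp subspace_0)

lemma qproj_eq_0_iff: "subspace W \<Longrightarrow> qproj W x = 0 \<longleftrightarrow> x \<in> W"
  using qproj_eq_0 qproj_diff[of W x] by auto

lemma qproj_zero_space [simp]: "qproj {0} x = x"
  by (rule qproj_unique) auto

lemma norm_qproj_Pythagoras:
  assumes W: "subspace W"
  shows "(norm x)\<^sup>2 = (norm (qproj W x))\<^sup>2 + (norm (x - qproj W x))\<^sup>2"
proof -
  have "inner (qproj W x) (x - qproj W x) = 0"
    using inner_qproj[OF W qproj_diff[OF W]] .
  hence "(norm (qproj W x + (x - qproj W x)))\<^sup>2 = (norm (qproj W x))\<^sup>2 + (norm (x - qproj W x))\<^sup>2"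
    by (subst norm_add_Pythagorean) (auto simp: real_inner_class.orthogonal_def)
  thus ?thesis by simp
qed

lemma norm_qproj_le: assumes "subspace W" shows "norm (qproj W x) \<le> norm x"
proof (rule power2_le_imp_le)
  show "(norm (qproj W x))\<^sup>2 \<le> (norm x)\<^sup>2"
    unfolding norm_qproj_Pythagoras[OF assms, of x] by simp
qed simp

text \<open>Projecting in stages. The image \<open>U\<close> of \<open>X\<close> lies inside
  \<open>X\<close>, so both residuals stay in \<open>X\<close>; orthogonality to a vector
  \<open>\<xi>\<close> of \<open>X\<close> splits into its part in \<open>W\<close> and its
  projection in \<open>U\<close>.\<close>

lemma qproj_comp:
  assumes W: "subspace W" and X: "subspace X" and WX: "W \<subseteq> X"
  shows "qproj (qproj W ` X) (qproj W x) = qproj X x"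
proof (rule qproj_unique[OF X, symmetric])
  define U where "U = qproj W ` X"
  have U: "subspace U" unfolding U_def
    using linear_subspace_image[OF linear_qproj[OF W] X] .
  have UX: "U \<subseteq> X"
  proof
    fix u assume "u \<in> U"
    then obtain \<xi> where "\<xi> \<in> X" "u = qproj W \<xi>" by (auto simp: U_def)
    thus "u \<in> X" using subspace_diff[OF X, of \<xi> "\<xi> - qproj W \<xi>"] qproj_diff[OF W] WX by auto
  qed
  define y where "y = qproj U (qproj W x)"
  have 1: "x - qproj W x \<in> X" using qproj_diff[OF W] WX by auto
  have 2: "qproj W x - y \<in> X" using qproj_diff[OF U] UX by (auto simp: y_def)
  show "x - qproj (qproj W ` X) (qproj W x) \<in> X"
    using subspace_add[OF X 1 2] by (simp add: y_def U_def)
  show "qproj (qproj W ` X) (qproj W x) \<in> orthogonal_comp X"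
  proof (subst orthogonal_comp_def, clarsimp simp: real_inner_class.orthogonal_def, fold U_def, fold y_def)
    fix \<xi> assume "\<xi> \<in> X"
    have "qproj W x - y \<in> U" using qproj_diff[OF U] by (simp add: y_def)
    \<comment> \<open>Both \<open>qproj W x\<close> and \<open>qproj W x - y\<close>, the projection
      of some \<open>\<eta>\<close>, are orthogonal to the part of \<open>\<xi>\<close> in
      \<open>W\<close>; hence so is \<open>y\<close>.\<close>
    then obtain \<eta> where \<eta>: "qproj W x - y = qproj W \<eta>" by (auto simp: U_def)
    have a: "inner (\<xi> - qproj W \<xi>) (qproj W x - y) = 0" unfolding \<eta>
      using inner_qproj[OF W qproj_diff[OF W]] by (simp add: inner_commute)
    have b: "inner (\<xi> - qproj W \<xi>) (qproj W x) = 0"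
      using inner_qproj[OF W qproj_diff[OF W]] by (simp add: inner_commute)
    have c: "inner (qproj W \<xi>) y = 0" unfolding y_def
      using inner_qproj[OF U, of "qproj W \<xi>"] \<open>\<xi> \<in> X\<close> by (simp add: inner_commute U_def)
    show "inner \<xi> y = 0" using a b c by (simp add: inner_diff_left inner_diff_right)
  qed
qed

section \<open>Lattice bases and discrete subgroups\<close>

text \<open>Families instead of sets: coefficients become functions of the index, and the order is
  available to Gram-Schmidt. \<open>indep_family_iff\<close> translates to the lists of
  \<open>lattice_basis\<close>.\<close>

definition indep_family :: "nat \<Rightarrow> (nat \<Rightarrow> 'a::real_vector) \<Rightarrow> bool" where
  "indep_family k b \<longleftrightarrow> (\<forall>c. (\<Sum>i<k. c i *\<^sub>R b i) = 0 \<longrightarrow> (\<forall>i<k. c i = 0))"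

lemma indep_familyD: "indep_family k b \<Longrightarrow> (\<Sum>i<k. c i *\<^sub>R b i) = 0 \<Longrightarrow> i < k \<Longrightarrow> c i = 0"
  by (auto simp: indep_family_def)

lemma indep_family_inj: assumes "indep_family k b" shows "inj_on b {..<k}"
proof (rule inj_onI)
  fix i j assume ij: "i \<in> {..<k}" "j \<in> {..<k}" "b i = b j"
  show "i = j"
  proof (rule ccontr)
    assume ne: "i \<noteq> j"
    define c :: "nat \<Rightarrow> real" where "c = (\<lambda>l. if l = i then 1 else if l = j then -1 else 0)"
    have "(\<Sum>l<k. c l *\<^sub>R b l) = (\<Sum>l\<in>{i,j}. c l *\<^sub>R b l)"
      using ij by (intro sum.mono_neutral_right) (auto simp: c_def)
    also have "\<dots> = 0" using ne ij by (simp add: c_def)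
    finally show False using indep_familyD[OF assms, of c i] ij by (simp add: c_def)
  qed
qed

lemma indep_family_iff:
  "distinct bs \<and> independent (set bs) \<longleftrightarrow> indep_family (length bs) ((!) bs)"
proof
  assume A: "distinct bs \<and> independent (set bs)"
  have inj: "inj_on ((!) bs) {..<length bs}" using A by (auto simp: inj_on_def nth_eq_iff_index_eq)
  have im: "(!) bs ` {..<length bs} = set bs" by (auto simp: set_conv_nth)
  show "indep_family (length bs) ((!) bs)"
    unfolding indep_family_def
  proof (intro allI impI)
    fix c :: "nat \<Rightarrow> real" and i
    assume s: "(\<Sum>i<length bs. c i *\<^sub>R bs ! i) = 0" and i: "i < length bs"
    define u where "u = (\<lambda>v. c (the_inv_into {..<length bs} ((!) bs) v))"
    have ui: "u (bs ! i) = c i" if "i < length bs" for i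
      unfolding u_def using the_inv_into_f_f[OF inj, of i] that by simp
    have "(\<Sum>v\<in>set bs. u v *\<^sub>R v) = (\<Sum>i<length bs. u (bs ! i) *\<^sub>R bs ! i)"
      unfolding im[symmetric] by (subst sum.reindex[OF inj]) simp
    also have "\<dots> = 0" using s ui by simp
    finally have "u (bs ! i) = 0" using A i independentD[of "set bs" "set bs" u "bs ! i"] by auto
    thus "c i = 0" using ui i by simp
  qed
next
  assume A: "indep_family (length bs) ((!) bs)"
  have inj: "inj_on ((!) bs) {..<length bs}" using indep_family_inj[OF A] .
  have im: "(!) bs ` {..<length bs} = set bs" by (auto simp: set_conv_nth)
  have "distinct bs" using inj by (auto simp: distinct_conv_nth inj_on_def)
  moreover have "independent (set bs)"
  proof (rule independent_if_scalars_zero)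
    fix u :: "'a \<Rightarrow> real" and x assume s: "(\<Sum>v\<in>set bs. u v *\<^sub>R v) = 0" and x: "x \<in> set bs"
    have "(\<Sum>i<length bs. u (bs ! i) *\<^sub>R bs ! i) = 0"
      using s unfolding im[symmetric] by (subst (asm) sum.reindex[OF inj]) simp
    moreover obtain i where "i < length bs" "x = bs ! i" using x by (auto simp: set_conv_nth)
    ultimately show "u x = 0" using indep_familyD[OF A, of "\<lambda>i. u (bs ! i)" i] by simp
  qed simp
  ultimately show "distinct bs \<and> independent (set bs)" by simp
qed

section \<open>Integer spans, discrete subgroups and their projections\<close>

definition zspan :: "nat \<Rightarrow> (nat \<Rightarrow> 'a::real_vector) \<Rightarrow> 'a set" where
  "zspan k b = {\<Sum>i<k. of_int (c i) *\<^sub>R b i | c :: nat \<Rightarrow> int. True}"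

lemma lattice_basis_iff:
  "lattice_basis bs N \<longleftrightarrow> indep_family (length bs) ((!) bs) \<and> N = zspan (length bs) ((!) bs)"
  unfolding lattice_basis_def zspan_def using indep_family_iff[of bs] by auto

text \<open>Lattices of any rank without a chosen basis. This form passes directly to intersections
  with subspaces and to projections along lattice vectors; \<open>lattice_basis_exists\<close>
  brings a basis back.\<close>

definition discrete_subgroup :: "'a::euclidean_space set \<Rightarrow> bool" where
  "discrete_subgroup N \<longleftrightarrow> 0 \<in> N \<and> (\<forall>x\<in>N. \<forall>y\<in>N. x - y \<in> N) \<and> (\<forall>r. finite (N \<inter> cball 0 r))"

lemma discrete_subgroupD:
  assumes "discrete_subgroup N"
  shows "0 \<in> N" "\<And>x y. x \<in> N \<Longrightarrow> y \<in> N \<Longrightarrow> x - y \<in> N" "\<And>r. finite (N \<inter> cball 0 r)"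
    "\<And>x. x \<in> N \<Longrightarrow> - x \<in> N" "\<And>x y. x \<in> N \<Longrightarrow> y \<in> N \<Longrightarrow> x + y \<in> N"
proof -
  show *: "0 \<in> N" "\<And>x y. x \<in> N \<Longrightarrow> y \<in> N \<Longrightarrow> x - y \<in> N" "\<And>r. finite (N \<inter> cball 0 r)"
    using assms by (auto simp: discrete_subgroup_def)
  show m: "- x \<in> N" if "x \<in> N" for x using *(2)[OF *(1) that] by simp
  show "x + y \<in> N" if "x \<in> N" "y \<in> N" for x y using *(2)[OF that(1) m[OF that(2)]] by simp
qed

lemma subgroup_int_scale:
  assumes "0 \<in> N" "\<And>x y. x \<in> N \<Longrightarrow> y \<in> N \<Longrightarrow> x - y \<in> (N :: 'a::real_vector set)" "x \<in> N"
  shows "of_int m *\<^sub>R x \<in> N"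
proof (induction m rule: int_induct[where k = 0])
  case base thus ?case using assms by simp
next
  case (step1 i)
  have "0 - x \<in> N" using assms by blast
  thus ?case using assms(2)[OF step1(2), of "0 - x"] by (simp add: algebra_simps)
next
  case (step2 i) thus ?case using assms(2)[OF step2(2) assms(3)] by (simp add: algebra_simps)
qed

lemma subgroup_sum:
  assumes "0 \<in> N" "\<And>x y. x \<in> N \<Longrightarrow> y \<in> N \<Longrightarrow> x - y \<in> (N :: 'a::real_vector set)"
    "\<And>i. i \<in> I \<Longrightarrow> f i \<in> N"
  shows "sum f I \<in> N"
  using assms(3)
proof (induction I rule: infinite_finite_induct)
  case (insert i I)
  have "0 - sum f I \<in> N" using insert assms(1,2) by (metis insertCI)
  hence "f i - (0 - sum f I) \<in> N" using insert assms(2) by blast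
  thus ?case using insert by simp
qed (use assms in auto)

lemma zspan_subset:
  assumes "0 \<in> N" "\<And>x y. x \<in> N \<Longrightarrow> y \<in> N \<Longrightarrow> x - y \<in> (N :: 'a::real_vector set)"
    "\<And>i. i < k \<Longrightarrow> b i \<in> N"
  shows "zspan k b \<subseteq> N"
  unfolding zspan_def by (auto intro!: subgroup_sum subgroup_int_scale assms)

lemma zspanI: "(\<Sum>i<k. of_int (c i) *\<^sub>R b i) \<in> zspan k b"
  by (auto simp: zspan_def)

lemma zspanE:
  assumes "x \<in> zspan k b" obtains c where "x = (\<Sum>i<k. of_int (c i) *\<^sub>R b i)"
  using assms by (auto simp: zspan_def)

lemma zspan_base: "i < k \<Longrightarrow> b i \<in> zspan k b"
proof -
  assume "i < k"
  hence "(\<Sum>j<k. of_int (if j = i then 1 else 0) *\<^sub>R b j) = b i"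
    by (subst sum.mono_neutral_cong_right[of _ "{i}"]) auto
  thus ?thesis using zspanI[of "\<lambda>j. if j = i then 1 else 0" b k] by simp
qed

lemma span_family_iff: "x \<in> span (b ` {..<k}) \<longleftrightarrow> (\<exists>c. x = (\<Sum>i<k. c i *\<^sub>R b i))" for k :: nat
proof
  show "x \<in> span (b ` {..<k})" if "\<exists>c. x = (\<Sum>i<k. c i *\<^sub>R b i)"
    using that by (auto intro!: span_sum span_scale intro: span_base)
  assume "x \<in> span (b ` {..<k})"
  thus "\<exists>c. x = (\<Sum>i<k. c i *\<^sub>R b i)"
  proof (induction rule: span_induct_alt)
    case base show ?case by (rule exI[of _ "\<lambda>_. 0"]) simp
  next
    case (step a x y)
    then obtain i c where "i < k" "x = b i" "y = (\<Sum>i<k. c i *\<^sub>R b i)" by auto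
    moreover have "(\<Sum>j<k. (if j = i then a else 0) *\<^sub>R b j) = a *\<^sub>R b i" if "i < k"
      using that by (subst sum.mono_neutral_cong_right[of _ "{i}"]) auto
    ultimately show ?case
      by (intro exI[of _ "\<lambda>j. (if j = i then a else 0) + c j"])
        (simp add: scaleR_left_distrib sum.distrib)
  qed
qed

lemma span_zspan: "span (zspan k b) = span (b ` {..<k})"
proof
  show "span (zspan k b) \<subseteq> span (b ` {..<k})"
    by (intro span_minimal) (auto simp: zspan_def intro!: span_sum span_scale intro: span_base)
  show "span (b ` {..<k}) \<subseteq> span (zspan k b)"
    by (intro span_mono) (auto intro: zspan_base)
qed

lemma lattice_basis_span: "lattice_basis bs N \<Longrightarrow> span N = span (set bs)"
  using span_zspan[of "length bs" "(!) bs"] lattice_basis_iff[of bs N]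
  by (metis lessThan_atLeast0 list.set_map map_nth set_upt)

lemma lattice_basis_length: "lattice_basis bs N \<Longrightarrow> length bs = dim (span N)"
  using lattice_basis_span[of bs N] dim_eq_card_independent[of "set bs"] distinct_card[of bs]
  by (auto simp: lattice_basis_def)

lemma indep_family_dual:
  assumes "indep_family k (b :: nat \<Rightarrow> 'a::real_vector)"
  shows "\<exists>f. \<forall>i<k. linear (f i) \<and> (\<forall>j<k. f i (b j) = (if i = j then 1 else (0::real)))"
proof -
  have B: "distinct (map b [0..<k]) \<and> independent (set (map b [0..<k]))"
  proof (subst indep_family_iff)
    show "indep_family (length (map b [0..<k])) ((!) (map b [0..<k]))"
      using assms unfolding indep_family_def by simp
  qed
  hence ind: "independent (b ` {..<k})" by (simp add: atLeast0LessThan)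
  have inj: "inj_on b {..<k}" by (rule indep_family_inj[OF assms])
  have "\<exists>g. linear g \<and> (\<forall>j<k. g (b j) = (if i = j then 1 else (0::real)))" if "i < k" for i
  proof -
    obtain g where g: "linear g" "\<forall>x\<in>b ` {..<k}. g x = (if x = b i then 1 else (0::real))"
      using linear_independent_extend[OF ind, of "\<lambda>x. if x = b i then 1 else (0::real)"] by auto
    have "g (b j) = (if i = j then 1 else 0)" if "j < k" for j
      using g(2) that \<open>i < k\<close> inj by (auto simp: inj_on_def)
    thus ?thesis using g(1) by blast
  qed
  hence "\<forall>i. \<exists>g. i < k \<longrightarrow> linear g \<and> (\<forall>j<k. g (b j) = (if i = j then 1 else (0::real)))" by blast
  from choice[OF this] show ?thesis by blast
qed

text \<open>Coefficients are read off by dual functionals. These are bounded, so a ball bounds every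
  integer coefficient and leaves finitely many coefficient vectors.\<close>

lemma discrete_zspan:
  fixes b :: "nat \<Rightarrow> 'a::euclidean_space"
  assumes "indep_family k b"
  shows "discrete_subgroup (zspan k b)"
proof -
  have 0: "0 \<in> zspan k b" unfolding zspan_def by (auto intro!: exI[of _ "\<lambda>_. 0"])
  have d: "x - y \<in> zspan k b" if xy: "x \<in> zspan k b" "y \<in> zspan k b" for x y
  proof -
    obtain c where "x = (\<Sum>i<k. of_int (c i) *\<^sub>R b i)" by (rule zspanE[OF xy(1)])
    moreover obtain c' where "y = (\<Sum>i<k. of_int (c' i) *\<^sub>R b i)" by (rule zspanE[OF xy(2)])
    ultimately have "x - y = (\<Sum>i<k. of_int (c i - c' i) *\<^sub>R b i)"
      by (simp add: sum_subtractf scaleR_left_diff_distrib)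
    thus ?thesis using zspanI by metis
  qed
  obtain f where f: "\<And>i. i < k \<Longrightarrow> linear (f i)"
    "\<And>i j. i < k \<Longrightarrow> j < k \<Longrightarrow> f i (b j) = (if i = j then 1 else (0::real))"
    using indep_family_dual[OF assms] by blast
  have fin: "finite (zspan k b \<inter> cball 0 r)" for r
  proof -
    have "\<exists>B. \<forall>x. norm (f i x) \<le> B * norm x" if "i < k" for i
      using linear_bounded[OF f(1)[OF that]] .
    hence "\<forall>i. \<exists>B. i < k \<longrightarrow> (\<forall>x. \<bar>f i x\<bar> \<le> B * norm x)" by auto
    then obtain B where "\<forall>i. i < k \<longrightarrow> (\<forall>x. \<bar>f i x\<bar> \<le> B i * norm x)"
      by (rule choice[THEN exE])
    hence B: "\<And>i x. i < k \<Longrightarrow> \<bar>f i x\<bar> \<le> B i * norm x" by blast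
    define C where "C = (\<lambda>i. \<lceil>\<bar>B i\<bar> * \<bar>r\<bar>\<rceil>)"
    have "zspan k b \<inter> cball 0 r \<subseteq>
        (\<lambda>c. \<Sum>i<k. of_int (c i) *\<^sub>R b i) ` (PiE {..<k} (\<lambda>i. {- C i..C i}))"
    proof
      fix x assume x: "x \<in> zspan k b \<inter> cball 0 r"
      then obtain c where c: "x = (\<Sum>i<k. of_int (c i) *\<^sub>R b i)" by (auto simp: zspan_def)
      have "c i \<in> {- C i..C i}" if i: "i < k" for i
      proof -
        have "f i x = (\<Sum>j<k. of_int (c j) * f i (b j))"
          unfolding c using f(1)[OF i] by (simp add: linear_sum linear_scale)
        also have "\<dots> = (\<Sum>j<k. if j = i then of_int (c j) else 0)"
          using f(2) i by (intro sum.cong) auto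
        also have "\<dots> = of_int (c i)" using i by simp
        finally have "\<bar>of_int (c i)\<bar> \<le> B i * norm x" using B[OF i, of x] by simp
        also have "\<dots> \<le> \<bar>B i\<bar> * \<bar>r\<bar>" using x by (intro mult_mono) auto
        also have "\<dots> \<le> of_int (C i)" by (simp add: C_def)
        finally show ?thesis by (simp add: abs_le_iff)
      qed
      hence "restrict c {..<k} \<in> PiE {..<k} (\<lambda>i. {- C i..C i})" by auto
      moreover have "x = (\<Sum>i<k. of_int (restrict c {..<k} i) *\<^sub>R b i)" unfolding c by simp
      ultimately show "x \<in> (\<lambda>c. \<Sum>i<k. of_int (c i) *\<^sub>R b i) ` (PiE {..<k} (\<lambda>i. {- C i..C i}))"
        by blast
    qed
    moreover have "finite (PiE {..<k} (\<lambda>i. {- C i..C i}))" by (intro finite_PiE) auto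
    ultimately show ?thesis using finite_surj by blast
  qed
  show ?thesis unfolding discrete_subgroup_def using 0 d fin by blast
qed

lemma lattice_basis_discrete: "lattice_basis bs N \<Longrightarrow> discrete_subgroup N"
  by (metis discrete_zspan lattice_basis_iff)

lemma qproj_subgroup:
  assumes "discrete_subgroup N" "subspace W"
  shows "0 \<in> qproj W ` N" "x \<in> qproj W ` N \<Longrightarrow> y \<in> qproj W ` N \<Longrightarrow> x - y \<in> qproj W ` N"
proof -
  show "0 \<in> qproj W ` N"
    using discrete_subgroupD(1)[OF assms(1)] linear_0[OF linear_qproj[OF assms(2)]] by force
  assume "x \<in> qproj W ` N" "y \<in> qproj W ` N"
  then obtain a b where "a \<in> N" "b \<in> N" "x = qproj W a" "y = qproj W b" by auto
  thus "x - y \<in> qproj W ` N"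
    using linear_diff[OF linear_qproj[OF assms(2)], of a b] discrete_subgroupD(2)[OF assms(1), of a b]
    by (metis image_eqI)
qed

text \<open>A projected point in a ball has a lift in a slightly larger ball: shift any lift by the
  integer multiple of \<open>v\<close> that rounds away its component along \<open>v\<close>. This
  needs \<open>v\<close> in \<open>N\<close>; along other directions the image need not be
  discrete.\<close>

lemma discrete_qproj_singleton:
  assumes N: "discrete_subgroup N" and v: "v \<in> N"
  shows "discrete_subgroup (qproj (span {v}) ` N)"
proof -
  let ?P = "qproj (span {v})"
  have fin: "finite (?P ` N \<inter> cball 0 r)" for r
  proof -
    have "?P ` N \<inter> cball 0 r \<subseteq> ?P ` (N \<inter> cball 0 (r + norm v))"
    proof
      fix p assume "p \<in> ?P ` N \<inter> cball 0 r"
      then obtain z where z: "z \<in> N" "p = ?P z" "norm p \<le> r" by auto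
      have "z - p \<in> span {v}" using qproj_diff[OF subspace_span] z by auto
      then obtain a where a: "z - p = a *\<^sub>R v" by (auto simp: span_singleton)
      define z' where "z' = z - of_int (round a) *\<^sub>R v"
      have 1: "z' \<in> N" unfolding z'_def
        using discrete_subgroupD(2)[OF N z(1)] subgroup_int_scale[OF discrete_subgroupD(1,2)[OF N] v] by blast
      have "of_int (round a) *\<^sub>R v \<in> span {v}" by (intro span_scale span_base) auto
      hence 2: "?P z' = p" unfolding z'_def z(2)
        using linear_diff[OF linear_qproj[OF subspace_span], of "{v}" z] qproj_eq_0[OF subspace_span]
        by simp
      have "z' = p + (a - of_int (round a)) *\<^sub>R v" unfolding z'_def using a by (simp add: algebra_simps)
      hence "norm z' \<le> norm p + \<bar>a - of_int (round a)\<bar> * norm v"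
        using norm_triangle_ineq[of p "(a - of_int (round a)) *\<^sub>R v"] by simp
      also have "\<bar>a - of_int (round a)\<bar> * norm v \<le> 1 * norm v"
        using of_int_round_abs_le[of a] by (intro mult_right_mono) (auto simp: abs_minus_commute)
      finally have "norm z' \<le> r + norm v" using z by simp
      thus "p \<in> ?P ` (N \<inter> cball 0 (r + norm v))" using 1 2 by force
    qed
    thus ?thesis using discrete_subgroupD(3)[OF N] finite_surj by blast
  qed
  show ?thesis unfolding discrete_subgroup_def
    using qproj_subgroup[OF N subspace_span] fin by blast
qed

text \<open>Removing the span of \<open>insert v S\<close> means removing the span of
  \<open>S\<close> and then the line through what remains of \<open>v\<close>. This reduces
  projections along finite sets to single vectors.\<close>

lemma qproj_span_insert:
  "qproj (span {qproj (span S) v}) (qproj (span S) x) = qproj (span (insert v S)) x"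
proof -
  have lin: "linear (qproj (span S))" by (rule linear_qproj) simp
  have "qproj (span S) ` span (insert v S) = span (qproj (span S) ` insert v S)"
    by (rule linear_span_image[OF lin, symmetric])
  also have "qproj (span S) ` insert v S = insert (qproj (span S) v) (qproj (span S) ` S)" by simp
  also have "span \<dots> = span {qproj (span S) v}"
  proof -
    have "qproj (span S) ` S \<subseteq> {0}" using qproj_eq_0[OF subspace_span] span_base by blast
    hence "insert (qproj (span S) v) (qproj (span S) ` S) \<subseteq> span {qproj (span S) v}"
      using span_base span_0 by fastforce
    thus ?thesis by (intro antisym span_minimal span_mono) auto
  qed
  finally have "qproj (span S) ` span (insert v S) = span {qproj (span S) v}" .
  thus ?thesis using qproj_comp[of "span S" "span (insert v S)" x]
    by (simp add: span_mono subset_insertI)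
qed

lemma discrete_qproj_finite:
  assumes N: "discrete_subgroup N" and S: "finite S" "S \<subseteq> N"
  shows "discrete_subgroup (qproj (span S) ` N)"
  using S
proof (induction S)
  case empty
  have "qproj (span {}) ` N = N" by (simp add: span_empty)
  thus ?case using N by simp
next
  case (insert v S)
  have "qproj (span (insert v S)) ` N = qproj (span {qproj (span S) v}) ` (qproj (span S) ` N)"
    by (simp only: image_image qproj_span_insert)
  moreover have "discrete_subgroup (qproj (span {qproj (span S) v}) ` (qproj (span S) ` N))"
    by (rule discrete_qproj_singleton) (use insert in auto)
  ultimately show ?case by (simp only:)
qed

lemma finite_spanning_subset:
  fixes S :: "'a::euclidean_space set"
  obtains S' where "S' \<subseteq> S" "finite S'" "independent S'" "span S' = span S"
proof -
  obtain B where "B \<subseteq> S" "independent B" "S \<subseteq> span B" using maximal_independent_subset[of S] by blast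
  thus ?thesis using that[of B] finiteI_independent[of B] span_minimal[of S "span B"] span_mono[of B S]
    by auto
qed

lemma discrete_qproj:
  assumes N: "discrete_subgroup N" and S: "S \<subseteq> N"
  shows "discrete_subgroup (qproj (span S) ` N)"
proof -
  obtain S' where "S' \<subseteq> S" "finite S'" "span S' = span S" using finite_spanning_subset[of S] by metis
  thus ?thesis using discrete_qproj_finite[OF N, of S'] S by auto
qed

lemma discrete_Int: "discrete_subgroup N \<Longrightarrow> subspace W \<Longrightarrow> discrete_subgroup (N \<inter> W)"
  unfolding discrete_subgroup_def using subspace_0[of W] subspace_diff[of W]
  by (auto intro: finite_subset[of "N \<inter> W \<inter> _"])

section \<open>Bases adapted to a sublattice\<close>

lemma sum_lessThan_add: "sum f {..<m + n} = sum f {..<m} + (\<Sum>i<n. f (m + i))"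
  for f :: "nat \<Rightarrow> 'a::comm_monoid_add" and m n :: nat
  by (induction n) (auto simp: add.assoc)

lemma prod_lessThan_add: "prod f {..<m + n} = prod f {..<m} * (\<Prod>i<n. f (m + i))"
  for f :: "nat \<Rightarrow> 'a::comm_monoid_mult" and m n :: nat
  by (induction n) (auto simp: mult.assoc)

text \<open>The image of a vector of \<open>N\<close> is an integer combination of the projected
  basis; subtracting the lifted combination leaves a vector killed by the projection, that is, a
  vector of \<open>N \<inter> W\<close>.\<close>

lemma lattice_basis_append:
  assumes N: "discrete_subgroup N" and as: "lattice_basis as (N \<inter> W)" and W: "subspace W"
    and cs: "lattice_basis (map (qproj W) cs) (qproj W ` N)" "set cs \<subseteq> N"
  shows "lattice_basis (as @ cs) N"
proof -
  let ?r = "length as" and ?s = "length cs" and ?P = "qproj W"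
  have lin: "linear ?P" by (rule linear_qproj[OF W])
  have asN: "as ! i \<in> N \<inter> W" if "i < ?r" for i
    using zspan_base[OF that] as unfolding lattice_basis_iff by blast
  have csN: "cs ! i \<in> N" if "i < ?s" for i using cs(2) that by auto
  have split: "(\<Sum>i<length (as @ cs). f i *\<^sub>R (as @ cs) ! i) =
      (\<Sum>i<?r. f i *\<^sub>R as ! i) + (\<Sum>i<?s. f (?r + i) *\<^sub>R cs ! i)" for f :: "nat \<Rightarrow> real"
    unfolding length_append sum_lessThan_add by (simp add: nth_append)
  have Pcs: "?P (\<Sum>i<?s. f i *\<^sub>R cs ! i) = (\<Sum>i<?s. f i *\<^sub>R map ?P cs ! i)" for f :: "nat \<Rightarrow> real"
    using lin by (simp add: linear_sum linear_scale)
  have Was: "(\<Sum>i<?r. f i *\<^sub>R as ! i) \<in> W" for f :: "nat \<Rightarrow> real"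
    using asN W by (intro subspace_sum subspace_scale) auto
  have ind: "indep_family (length (as @ cs)) ((!) (as @ cs))"
    unfolding indep_family_def
  proof (rule allI, rule impI)
    fix f :: "nat \<Rightarrow> real"
    assume z: "(\<Sum>i<length (as @ cs). f i *\<^sub>R (as @ cs) ! i) = 0"
    have "?P ((\<Sum>i<?r. f i *\<^sub>R as ! i) + (\<Sum>i<?s. f (?r + i) *\<^sub>R cs ! i)) = 0"
      using z linear_0[OF lin] unfolding split by simp
    hence "(\<Sum>i<?s. f (?r + i) *\<^sub>R map ?P cs ! i) = 0"
      unfolding linear_add[OF lin] Pcs qproj_eq_0[OF W Was] by simp
    hence f2: "f (?r + i) = 0" if "i < ?s" for i
      using cs(1) that indep_familyD[of ?s "(!) (map ?P cs)" "\<lambda>i. f (?r + i)" i] unfolding lattice_basis_iff by simp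
    hence "(\<Sum>i<?r. f i *\<^sub>R as ! i) = 0" using z unfolding split by simp
    hence f1: "f i = 0" if "i < ?r" for i
      using as that indep_familyD[of ?r "(!) as" f i] unfolding lattice_basis_iff by simp
    show "\<forall>i<length (as @ cs). f i = 0"
    proof (intro allI impI)
      fix i assume "i < length (as @ cs)"
      thus "f i = 0" using f1[of i] f2[of "i - ?r"] by (cases "i < ?r") auto
    qed
  qed
  have "N \<subseteq> zspan (length (as @ cs)) ((!) (as @ cs))"
  proof
    fix x assume x: "x \<in> N"
    hence "?P x \<in> zspan ?s ((!) (map ?P cs))" using cs(1) unfolding lattice_basis_iff by auto
    then obtain c where c: "?P x = (\<Sum>i<?s. of_int (c i) *\<^sub>R map ?P cs ! i)" by (rule zspanE)
    define y where "y = x - (\<Sum>i<?s. of_int (c i) *\<^sub>R cs ! i)"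
    have "y \<in> N" unfolding y_def
      by (intro discrete_subgroupD(2)[OF N] x subgroup_sum subgroup_int_scale discrete_subgroupD(1)[OF N] csN) auto
    moreover have "?P y = 0" unfolding y_def linear_diff[OF lin] Pcs using c by simp
    ultimately have "y \<in> N \<inter> W" using qproj_eq_0_iff[OF W] by auto
    hence "y \<in> zspan ?r ((!) as)" using as unfolding lattice_basis_iff by auto
    then obtain d where d: "y = (\<Sum>i<?r. of_int (d i) *\<^sub>R as ! i)" by (rule zspanE)
    have "x = (\<Sum>i<length (as @ cs). of_int (if i < ?r then d i else c (i - ?r)) *\<^sub>R (as @ cs) ! i)"
      unfolding split using d by (simp add: y_def algebra_simps)
    thus "x \<in> zspan (length (as @ cs)) ((!) (as @ cs))" using zspanI by metis
  qed
  moreover have "zspan (length (as @ cs)) ((!) (as @ cs)) \<subseteq> N"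
  proof (rule zspan_subset)
    fix i assume "i < length (as @ cs)"
    hence "(as @ cs) ! i \<in> set (as @ cs)" by (rule nth_mem)
    moreover have "set as \<subseteq> N" using asN by (auto simp: set_conv_nth)
    ultimately show "(as @ cs) ! i \<in> N" using cs(2) by auto
  qed (use discrete_subgroupD[OF N] in auto)
  ultimately show ?thesis unfolding lattice_basis_iff using ind by auto
qed

lemma lattice_basis_lift:
  assumes "lattice_basis bs (qproj W ` N)"
  obtains cs where "bs = map (qproj W) cs" "set cs \<subseteq> N"
proof -
  have "set bs \<subseteq> qproj W ` N"
  proof
    fix x assume "x \<in> set bs"
    then obtain i where "i < length bs" "x = bs ! i" by (auto simp: set_conv_nth)
    thus "x \<in> qproj W ` N" using zspan_base assms unfolding lattice_basis_iff by blast
  qed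
  hence "\<forall>x\<in>set bs. \<exists>z. z \<in> N \<and> x = qproj W z" by blast
  from bchoice[OF this] obtain g where g: "\<forall>x\<in>set bs. g x \<in> N \<and> x = qproj W (g x)" by blast
  show ?thesis
  proof (rule that[of "map g bs"])
    show "bs = map (qproj W) (map g bs)" using g by (intro nth_equalityI) auto
    show "set (map g bs) \<subseteq> N" using g by auto
  qed
qed

text \<open>Induction on the rank: a shortest nonzero \<open>v\<close> generates all lattice points
  on its line, and the projection along \<open>v\<close> has smaller rank.\<close>

lemma lattice_basis_exists:
  assumes "discrete_subgroup (N :: 'a::euclidean_space set)"
  shows "\<exists>bs. lattice_basis bs N"
  using assms
proof (induction "dim (span N)" arbitrary: N rule: less_induct)
  case (less N)
  note N = less.prems
  show ?case
  proof (cases "N = {0}")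
    case True
    have "lattice_basis [] N" unfolding lattice_basis_iff True
      by (auto simp: indep_family_def zspan_def)
    thus ?thesis by blast
  next
    case False
    then obtain w where w: "w \<in> N" "w \<noteq> 0" using discrete_subgroupD(1)[OF N] by auto
    \<comment> \<open>Cutting off at the norm of an arbitrary nonzero \<open>w\<close> leaves a
      finite nonempty set, in which a shortest vector exists.\<close>
    define F where "F = (N \<inter> cball 0 (norm w)) - {0}"
    have F: "finite F" "F \<noteq> {}" using discrete_subgroupD(3)[OF N] w by (auto simp: F_def)
    define v where "v = arg_min_on norm F"
    have vF: "v \<in> F" unfolding v_def using arg_min_if_finite(1)[OF F] .
    have vmin: "norm v \<le> norm x" if "x \<in> F" for x
      unfolding v_def using arg_min_least[OF F that] .
    have v: "v \<in> N" "v \<noteq> 0" "norm v \<le> norm w" using vF by (auto simp: F_def)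
    have vmin': "norm v \<le> norm x" if "x \<in> N" "x \<noteq> 0" for x
    proof (cases "norm x \<le> norm w")
      case True thus ?thesis using that vmin by (auto simp: F_def)
    qed (use v in auto)
    define W where "W = span {v}"
    have W: "subspace W" by (simp add: W_def)
    let ?M = "qproj W ` N"
    have M: "discrete_subgroup ?M" unfolding W_def by (rule discrete_qproj_singleton[OF N v(1)])
    have spanM: "span ?M = qproj W ` span N" using linear_span_image[OF linear_qproj[OF W]] by simp
    have "span ?M \<subseteq> span N"
    proof (rule span_minimal)
      show "?M \<subseteq> span N"
      proof
        fix x assume "x \<in> ?M"
        then obtain z where z: "z \<in> N" "x = qproj W z" by auto
        have "z - x \<in> span {v}" using qproj_diff[OF W] z by (simp add: W_def)
        also have "span {v} \<subseteq> span N" using v by (intro span_mono) auto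
        finally have "z - (z - x) \<in> span N" by (rule span_diff[OF span_base[OF z(1)]])
        thus "x \<in> span N" by simp
      qed
    qed simp
    moreover have "v \<notin> span ?M"
    proof
      assume "v \<in> span ?M"
      then obtain y where "v = qproj W y" using spanM by auto
      hence "inner v v = 0" using inner_qproj[OF W, of v y] by (simp add: W_def span_base)
      thus False using v by simp
    qed
    moreover have "v \<in> span N" using v by (simp add: span_base)
    ultimately have "span ?M \<subset> span N" by blast
    hence "dim (span ?M) < dim (span N)"
      by (intro dim_psubset) (simp only: span_span)
    from less.hyps[OF this M] obtain bs where bs: "lattice_basis bs ?M" by blast
    obtain cs where cs: "bs = map (qproj W) cs" "set cs \<subseteq> N" using lattice_basis_lift[OF bs] .
    have "lattice_basis [v] (N \<inter> W)"
      unfolding lattice_basis_iff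
    proof
      show "indep_family (length [v]) ((!) [v])" using v by (simp add: indep_family_def)
      show "N \<inter> W = zspan (length [v]) ((!) [v])"
      proof
        show "N \<inter> W \<subseteq> zspan (length [v]) ((!) [v])"
        proof
          fix x assume x: "x \<in> N \<inter> W"
          then obtain a where a: "x = a *\<^sub>R v" by (auto simp: W_def span_singleton)
          \<comment> \<open>Rounding leaves at most half of \<open>v\<close>, which contradicts
            minimality unless it vanishes.\<close>
          define y where "y = x - of_int (round a) *\<^sub>R v"
          have "y \<in> N" unfolding y_def using x v
            by (intro discrete_subgroupD(2)[OF N] subgroup_int_scale discrete_subgroupD(1)[OF N]) auto
          have y: "y = (a - of_int (round a)) *\<^sub>R v" by (simp add: y_def a scaleR_left_diff_distrib)
          have "norm y \<le> 1/2 * norm v" unfolding y norm_scaleR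
            using of_int_round_abs_le[of a] by (intro mult_right_mono) (auto simp: abs_minus_commute)
          moreover have "0 < norm v" using v by simp
          ultimately have "norm y < norm v" by linarith
          hence "y = 0" using vmin'[OF \<open>y \<in> N\<close>] by fastforce
          hence "x = (\<Sum>i<length [v]. of_int ((\<lambda>_. round a) i) *\<^sub>R [v] ! i)" by (simp add: y_def)
          thus "x \<in> zspan (length [v]) ((!) [v])" by (simp only: zspanI)
        qed
        show "zspan (length [v]) ((!) [v]) \<subseteq> N \<inter> W"
          using v discrete_subgroupD[OF discrete_Int[OF N W]]
          by (intro zspan_subset) (auto simp: W_def intro: span_base)
      qed
    qed
    hence "lattice_basis ([v] @ cs) N"
      by (rule lattice_basis_append[OF N _ W]) (use cs bs in auto)
    thus ?thesis by blast
  qed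
qed

lemma adapted_basis:
  assumes N: "discrete_subgroup N" and S: "S \<subseteq> N"
  obtains as cs where "lattice_basis as (N \<inter> span S)"
    "lattice_basis (map (qproj (span S)) cs) (qproj (span S) ` N)" "lattice_basis (as @ cs) N"
proof -
  obtain as where as: "lattice_basis as (N \<inter> span S)"
    using lattice_basis_exists[OF discrete_Int[OF N subspace_span]] by blast
  obtain bs where bs: "lattice_basis bs (qproj (span S) ` N)"
    using lattice_basis_exists[OF discrete_qproj[OF N S]] by blast
  obtain cs where cs: "bs = map (qproj (span S)) cs" "set cs \<subseteq> N" using lattice_basis_lift[OF bs] .
  show ?thesis using that[OF as] lattice_basis_append[OF N as subspace_span] cs bs by blast
qed

section \<open>Gram determinants\<close>

lemma span_image_mono: "x \<in> span (b ` A) \<Longrightarrow> A \<subseteq> B \<Longrightarrow> x \<in> span (b ` B)"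
  using span_mono[OF image_mono] by blast

lemma span_Un_span: "span A = span S \<Longrightarrow> span (A \<union> B) = span (span S \<union> B)"
  by (simp only: span_Un span_span)

lemma lessThan_add_Un: "{..<r + i} = {..<r} \<union> (+) r ` {..<i}" for r i :: nat
proof (rule Set.set_eqI, rule iffI)
  fix x assume "x \<in> {..<r + i}"
  thus "x \<in> {..<r} \<union> (+) r ` {..<i}"
    by (cases "x < r") (auto intro!: image_eqI[of _ _ "x - r"])
qed auto

definition gs :: "(nat \<Rightarrow> 'a::euclidean_space) \<Rightarrow> nat \<Rightarrow> 'a" where
  "gs b i = qproj (span (b ` {..<i})) (b i)"

text \<open>The volume of the parallelepiped spanned by the family, so the lattice determinant by
  \<open>lattice_det_eq\<close>. As a product over the basis it can be split factor by factor along
  a sublattice.\<close>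

definition gs_prod :: "nat \<Rightarrow> (nat \<Rightarrow> 'a::euclidean_space) \<Rightarrow> real" where
  "gs_prod k b = (\<Prod>i<k. norm (gs b i))"

definition gs_frame :: "(nat \<Rightarrow> 'a::euclidean_space) \<Rightarrow> nat \<Rightarrow> 'a" where
  "gs_frame b i = gs b i /\<^sub>R norm (gs b i)"

lemma gs_nonzero:
  assumes "indep_family k b" "i < k"
  shows "gs b i \<noteq> 0"
proof
  assume "gs b i = 0"
  hence "b i \<in> span (b ` {..<i})" unfolding gs_def using qproj_eq_0_iff[OF subspace_span] by blast
  then obtain c where c: "b i = (\<Sum>j<i. c j *\<^sub>R b j)" unfolding span_family_iff by blast
  define d where "d = (\<lambda>j. if j < i then c j else if j = i then -1 else 0)"
  have "(\<Sum>j<k. d j *\<^sub>R b j) = (\<Sum>j<Suc i. d j *\<^sub>R b j)"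
    using assms(2) by (intro sum.mono_neutral_right) (auto simp: d_def)
  also have "\<dots> = (\<Sum>j<i. c j *\<^sub>R b j) - b i" by (simp add: d_def)
  also have "\<dots> = 0" using c by simp
  finally have "d i = 0" using indep_familyD[OF assms(1)] assms(2) by blast
  thus False by (simp add: d_def)
qed

lemma gs_mem_span: "gs b i \<in> span (b ` {..i})"
proof -
  have "b i - gs b i \<in> span (b ` {..<i})" unfolding gs_def by (rule qproj_diff) simp
  also have "\<dots> \<subseteq> span (b ` {..i})" by (intro span_mono) auto
  finally have "b i - (b i - gs b i) \<in> span (b ` {..i})"
    by (rule span_diff[OF span_base, rotated]) simp
  thus ?thesis by simp
qed

lemma gs_orth_span: "x \<in> span (b ` {..<i}) \<Longrightarrow> inner (gs b i) x = 0"
  unfolding gs_def by (rule inner_qproj) auto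

lemma gs_frame_orth_span: "x \<in> span (b ` {..<i}) \<Longrightarrow> inner (gs_frame b i) x = 0"
  by (simp add: gs_frame_def gs_orth_span)

lemma gs_frame_orth_less:
  assumes "j < i" shows "inner (gs_frame b i) (b j) = 0" "inner (gs_frame b i) (gs_frame b j) = 0"
proof -
  show "inner (gs_frame b i) (b j) = 0" using assms by (intro gs_frame_orth_span span_base) auto
  have "gs b j \<in> span (b ` {..<i})" by (rule span_image_mono[OF gs_mem_span]) (use assms in auto)
  thus "inner (gs_frame b i) (gs_frame b j) = 0"
    by (simp add: gs_frame_def[of b j] gs_frame_orth_span)
qed

lemma gs_frame_orthonormal:
  assumes "indep_family k b" "i < k" "j < k"
  shows "inner (gs_frame b i) (gs_frame b j) = (if i = j then 1 else 0)"
proof (cases i j rule: linorder_cases)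
  case less thus ?thesis using gs_frame_orth_less(2)[of i j b] by (simp add: inner_commute)
next
  case equal
  have "inner (gs b i) (gs b i) = norm (gs b i) * norm (gs b i)"
    by (simp add: power2_norm_eq_inner[symmetric] power2_eq_square)
  thus ?thesis using equal gs_nonzero[OF assms(1,2)] by (simp add: gs_frame_def field_simps)
next
  case greater thus ?thesis using gs_frame_orth_less(2)[of j i b] by simp
qed

lemma gs_frame_diag:
  assumes "indep_family k b" "i < k"
  shows "inner (gs_frame b i) (b i) = norm (gs b i)"
proof -
  have "inner (gs b i) (b i - gs b i) = 0"
    by (rule gs_orth_span) (simp add: gs_def qproj_diff)
  hence "inner (gs b i) (b i) = norm (gs b i) * norm (gs b i)"
    by (simp add: inner_diff_right power2_norm_eq_inner[symmetric] power2_eq_square)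
  thus ?thesis using gs_nonzero[OF assms] by (simp add: gs_frame_def field_simps)
qed

text \<open>Induction on \<open>j\<close>: subtracting the component along the last frame vector
  also removes the last basis vector, because \<open>b j - gs b j\<close> lies in the span of the
  earlier ones.\<close>

lemma gs_frame_expand:
  assumes "indep_family k b" "j \<le> k" "x \<in> span (b ` {..<j})"
  shows "x = (\<Sum>i<j. inner (gs_frame b i) x *\<^sub>R gs_frame b i)"
  using assms(2,3)
proof (induction j arbitrary: x)
  case 0 thus ?case by simp
next
  case (Suc j)
  have ob: "inner (gs_frame b j) (b i) = 0" if "i < j" for i using gs_frame_orth_less(1)[OF that] .
  define y where "y = x - inner (gs_frame b j) x *\<^sub>R gs_frame b j"
  obtain c where c: "x = (\<Sum>i<Suc j. c i *\<^sub>R b i)" using Suc.prems(2) unfolding span_family_iff by blast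
  have nz: "norm (gs b j) \<noteq> 0" using gs_nonzero[OF assms(1)] Suc.prems by simp
  have "inner (gs_frame b j) x = c j * norm (gs b j)"
    unfolding c using ob gs_frame_diag[OF assms(1), of j] Suc.prems(1) by (simp add: inner_sum_right inner_add_right)
  hence "y = (\<Sum>i<j. c i *\<^sub>R b i) + c j *\<^sub>R (b j - gs b j)"
    unfolding y_def using nz by (subst c) (simp add: gs_frame_def algebra_simps)
  moreover have "b j - gs b j \<in> span (b ` {..<j})" by (simp add: gs_def qproj_diff)
  ultimately have y: "y \<in> span (b ` {..<j})"
    by (auto intro!: span_add span_sum span_scale intro: span_base)
  have eq: "inner (gs_frame b i) y = inner (gs_frame b i) x" if "i < j" for i
    using gs_frame_orthonormal[OF assms(1), of i j] that Suc.prems(1) by (simp add: y_def inner_diff_right)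
  have "y = (\<Sum>i<j. inner (gs_frame b i) y *\<^sub>R gs_frame b i)"
    using Suc.IH[OF _ y] Suc.prems by simp
  also have "\<dots> = (\<Sum>i<j. inner (gs_frame b i) x *\<^sub>R gs_frame b i)" using eq by simp
  finally show ?case by (simp add: y_def algebra_simps)
qed

lemma gs_frame_in_span: "i < k \<Longrightarrow> gs_frame b i \<in> span (b ` {..<k})"
  unfolding gs_frame_def by (intro span_scale span_image_mono[OF gs_mem_span]) auto

lemma gs_prod_pos: "indep_family k b \<Longrightarrow> gs_prod k b > 0"
  unfolding gs_prod_def using gs_nonzero by (intro prod_pos) auto

text \<open>The coordinates of the basis in its Gram-Schmidt frame form an upper triangular matrix
  \<open>R\<close> with diagonal \<open>norm (gs b i)\<close>, and the Gram matrix is the transpose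
  of \<open>R\<close> times \<open>R\<close>.\<close>

lemma det_gram_matrix:
  assumes ind: "indep_family (length bs) ((!) bs)"
  shows "Determinant.det (gram_matrix bs) = (gs_prod (length bs) ((!) bs))\<^sup>2"
proof -
  define k where "k = length bs"
  define b where "b = (!) bs"
  have ind: "indep_family k b" using ind by (simp add: k_def b_def)
  define R where "R = mat k k (\<lambda>(i,j). inner (gs_frame b i) (b j))"
  have R: "R \<in> carrier_mat k k" by (simp add: R_def)
  have "gram_matrix bs = transpose_mat R * R"
  proof (rule eq_matI)
    fix i j assume ij: "i < dim_row (transpose_mat R * R)" "j < dim_col (transpose_mat R * R)"
    hence ij: "i < k" "j < k" by (auto simp: R_def)
    have "b j = (\<Sum>l<k. inner (gs_frame b l) (b j) *\<^sub>R gs_frame b l)"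
      by (rule gs_frame_expand[OF ind]) (use ij in \<open>auto intro: span_base\<close>)
    hence "inner (b i) (b j) = inner (b i) (\<Sum>l<k. inner (gs_frame b l) (b j) *\<^sub>R gs_frame b l)" by simp
    also have "\<dots> = (\<Sum>l<k. inner (gs_frame b l) (b i) * inner (gs_frame b l) (b j))"
      by (simp add: inner_sum_right inner_commute mult.commute)
    finally show "gram_matrix bs $$ (i, j) = (transpose_mat R * R) $$ (i, j)"
      using ij by (simp add: gram_matrix_def k_def[symmetric] b_def[symmetric] R_def scalar_prod_def atLeast0LessThan)
  qed (auto simp: gram_matrix_def R_def k_def)
  hence "Determinant.det (gram_matrix bs) = Determinant.det R * Determinant.det R"
    using det_mult[of "transpose_mat R" k R] R det_transpose[OF R] by simp
  also have "Determinant.det R = prod_list (diag_mat R)"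
    by (rule det_upper_triangular[OF _ R]) (auto simp: R_def upper_triangular_def gs_frame_orth_less)
  also have "\<dots> = (\<Prod>i<k. inner (gs_frame b i) (b i))"
    unfolding prod_list_diag_prod by (simp add: R_def atLeast0LessThan)
  also have "\<dots> = gs_prod k b" unfolding gs_prod_def using gs_frame_diag[OF ind] by simp
  finally show ?thesis by (simp add: k_def b_def power2_eq_square)
qed

text \<open>The transition matrix is integral with nonzero determinant, so the square of that
  determinant is at least 1. Exchanging the two bases gives equality without inverting the
  matrix.\<close>

lemma det_gram_matrix_le:
  assumes bs: "lattice_basis bs N" and cs: "lattice_basis cs N"
  shows "Determinant.det (gram_matrix bs) \<le> Determinant.det (gram_matrix cs)"
proof -
  define k where "k = length bs"
  have kc: "length cs = k" using lattice_basis_length[OF bs] lattice_basis_length[OF cs] by (simp add: k_def)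
  have "\<forall>i. \<exists>c. i < k \<longrightarrow> cs ! i = (\<Sum>j<k. of_int (c j) *\<^sub>R bs ! j)"
  proof
    fix i
    have "cs ! i \<in> zspan k ((!) bs)" if "i < k"
      using zspan_base[of i "length cs" "(!) cs"] bs cs that kc unfolding lattice_basis_iff k_def by simp
    thus "\<exists>c. i < k \<longrightarrow> cs ! i = (\<Sum>j<k. of_int (c j) *\<^sub>R bs ! j)" by (auto simp: zspan_def)
  qed
  from choice[OF this] obtain c where
    c: "\<And>i. i < k \<Longrightarrow> cs ! i = (\<Sum>j<k. of_int (c i j) *\<^sub>R bs ! j)" by blast
  define U where "U = mat k k (\<lambda>(i,j). c i j)"
  define V :: "real mat" where "V = map_mat of_int U"
  have U: "U \<in> carrier_mat k k" and V: "V \<in> carrier_mat k k" by (auto simp: U_def V_def)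
  have G: "gram_matrix bs \<in> carrier_mat k k" by (simp add: gram_matrix_def k_def)
  have "gram_matrix cs = V * (gram_matrix bs * transpose_mat V)"
  proof (rule eq_matI)
    fix i j assume "i < dim_row (V * (gram_matrix bs * transpose_mat V))"
      "j < dim_col (V * (gram_matrix bs * transpose_mat V))"
    hence ij: "i < k" "j < k" using V by auto
    have "inner (cs ! i) (cs ! j) = (\<Sum>l<k. of_int (c i l) * (\<Sum>m<k. inner (bs ! l) (bs ! m) * of_int (c j m)))"
      unfolding c[OF ij(1)] c[OF ij(2)]
      by (simp add: inner_sum_left inner_sum_right sum_distrib_left mult_ac) (rule sum.swap)
    thus "gram_matrix cs $$ (i, j) = (V * (gram_matrix bs * transpose_mat V)) $$ (i, j)"
      using ij kc by (simp add: gram_matrix_def k_def[symmetric] V_def U_def scalar_prod_def atLeast0LessThan)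
  qed (use V kc in \<open>auto simp: gram_matrix_def\<close>)
  hence "Determinant.det (gram_matrix cs) = Determinant.det V * (Determinant.det (gram_matrix bs) * Determinant.det V)"
    using det_mult[OF V, of "gram_matrix bs * transpose_mat V"] det_mult[OF G, of "transpose_mat V"]
      V G det_transpose[OF V] by simp
  hence eq: "Determinant.det (gram_matrix cs) = (Determinant.det V)\<^sup>2 * Determinant.det (gram_matrix bs)"
    by (simp add: power2_eq_square)
  have pos: "Determinant.det (gram_matrix ds) > 0" if "lattice_basis ds N" for ds
    using that det_gram_matrix[of ds] gs_prod_pos[of "length ds" "(!) ds"] unfolding lattice_basis_iff by simp
  have V': "Determinant.det V = of_int (Determinant.det U)" unfolding V_def by simp
  have "Determinant.det U \<noteq> 0" using eq pos[OF cs] V' by auto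
  hence "(Determinant.det U)\<^sup>2 \<ge> 1" by (simp add: int_one_le_iff_zero_less)
  hence "(Determinant.det V)\<^sup>2 \<ge> 1" unfolding V' by (metis of_int_1_le_iff of_int_power)
  thus ?thesis unfolding eq using pos[OF bs] by simp
qed

lemma lattice_det_eq:
  assumes "lattice_basis bs N"
  shows "lattice_det N = gs_prod (length bs) ((!) bs)"
proof -
  have s: "lattice_basis (SOME bs. lattice_basis bs N) N" using someI[of "\<lambda>bs. lattice_basis bs N"] assms by blast
  have "Determinant.det (gram_matrix (SOME bs. lattice_basis bs N)) = Determinant.det (gram_matrix bs)"
    using det_gram_matrix_le[OF s assms] det_gram_matrix_le[OF assms s] by simp
  also have "\<dots> = (gs_prod (length bs) ((!) bs))\<^sup>2"
    using det_gram_matrix[of bs] assms unfolding lattice_basis_iff by blast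
  finally show ?thesis unfolding lattice_det_def
    using gs_prod_pos[of "length bs" "(!) bs"] assms unfolding lattice_basis_iff by simp
qed

lemma lattice_det_pos:
  assumes "discrete_subgroup N" shows "lattice_det N > 0"
proof -
  obtain bs where bs: "lattice_basis bs N" using lattice_basis_exists[OF assms] by blast
  show ?thesis using lattice_det_eq[OF bs] bs gs_prod_pos[of "length bs" "(!) bs"] unfolding lattice_basis_iff by simp
qed

text \<open>In an adapted basis the Gram-Schmidt vectors come in two blocks: the first are those of
  the sublattice, the others, by projection in stages, those of the projected basis.\<close>

lemma lattice_det_multiplicative:
  assumes N: "discrete_subgroup N" and S: "S \<subseteq> N"
  shows "lattice_det N = lattice_det (N \<inter> span S) * lattice_det (qproj (span S) ` N)"
proof -
  obtain as cs where as: "lattice_basis as (N \<inter> span S)"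
    and cs: "lattice_basis (map (qproj (span S)) cs) (qproj (span S) ` N)"
    and ac: "lattice_basis (as @ cs) N" using adapted_basis[OF N S] .
  let ?r = "length as" and ?P = "qproj (span S)"
  have spanas: "span ((!) as ` {..<?r}) = span S"
  proof -
    have "span ((!) as ` {..<?r}) = span (N \<inter> span S)"
      using as span_zspan[of ?r "(!) as"] unfolding lattice_basis_iff by simp
    also have "\<dots> = span S" using S by (intro antisym span_minimal span_mono) (auto intro: span_base)
    finally show ?thesis .
  qed
  have lin: "linear ?P" by (rule linear_qproj) simp
  have 1: "gs ((!) (as @ cs)) i = gs ((!) as) i" if "i < ?r" for i
  proof -
    have "(!) (as @ cs) ` {..<i} = (!) as ` {..<i}" using that by (intro image_cong) (auto simp: nth_append)
    thus ?thesis using that by (simp add: gs_def nth_append)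
  qed
  have 2: "gs ((!) (as @ cs)) (?r + i) = gs ((!) (map ?P cs)) i" if i: "i < length cs" for i
  proof -
    define X where "X = span ((!) (as @ cs) ` {..<?r + i})"
    have im: "(!) (as @ cs) ` {..<?r + i} = (!) as ` {..<?r} \<union> (!) cs ` {..<i}"
      unfolding lessThan_add_Un image_Un image_image by (simp add: nth_append)
    have X: "X = span (span S \<union> (!) cs ` {..<i})"
      unfolding X_def im by (rule span_Un_span[OF spanas])
    have WX: "span S \<subseteq> X" unfolding X using span_superset[of "span S \<union> (!) cs ` {..<i}"] by blast
    have PX: "?P ` X = span ((!) (map ?P cs) ` {..<i})"
    proof -
      have "?P ` X = span (?P ` (span S \<union> (!) cs ` {..<i}))"
        unfolding X by (rule linear_span_image[OF lin, symmetric])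
      also have "?P ` (span S \<union> (!) cs ` {..<i}) = {0} \<union> (!) (map ?P cs) ` {..<i}"
      proof -
        have "?P ` span S = {0}" using qproj_eq_0[OF subspace_span, of _ S] span_0[of S] by (auto simp: image_iff)
        moreover have "?P ` (!) cs ` {..<i} = (!) (map ?P cs) ` {..<i}"
          unfolding image_image using i by (intro image_cong) auto
        ultimately show ?thesis by (simp add: image_Un)
      qed
      finally show ?thesis by (simp add: span_insert_0)
    qed
    have "gs ((!) (as @ cs)) (?r + i) = qproj X (cs ! i)" by (simp add: gs_def X_def nth_append)
    also have "\<dots> = qproj (?P ` X) (?P (cs ! i))"
      by (rule qproj_comp[symmetric]) (use WX in \<open>auto simp: X_def\<close>)
    also have "\<dots> = gs ((!) (map ?P cs)) i" using i unfolding PX gs_def by simp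
    finally show ?thesis .
  qed
  show ?thesis
    unfolding lattice_det_eq[OF as] lattice_det_eq[OF cs] lattice_det_eq[OF ac] gs_prod_def
      length_append prod_lessThan_add using 1 2 by simp
qed

section \<open>Lebesgue measure on coordinate spaces\<close>

interpretation lborel_product: product_sigma_finite "\<lambda>_ :: nat. lborel :: real measure" ..

text \<open>Points of the coordinate space are extensional, so a translation must restrict its
  result; \<open>u\<close> itself is only read below \<open>k\<close>.\<close>

definition vadd :: "nat \<Rightarrow> (nat \<Rightarrow> real) \<Rightarrow> (nat \<Rightarrow> real) \<Rightarrow> nat \<Rightarrow> real" where
  "vadd k t u = (\<lambda>i\<in>{..<k}. t i + u i)"

text \<open>Half-open, so that the integer translates partition the space exactly, with no null set
  to discard.\<close>

definition unit_cube :: "nat \<Rightarrow> (nat \<Rightarrow> real) set" where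
  "unit_cube k = PiE {..<k} (\<lambda>_. {0..<1})"

text \<open>Extensional, hence countable, with exactly one representative of each integer
  translation.\<close>

definition int_vectors :: "nat \<Rightarrow> (nat \<Rightarrow> int) set" where
  "int_vectors k = PiE {..<k} (\<lambda>_. UNIV)"

lemma space_Rd: "space (Rd_lborel k) = extensional {..<k}"
  by (simp add: space_PiM PiE_def)

lemma measurable_coordinate: "i < k \<Longrightarrow> (\<lambda>x. x i) \<in> borel_measurable (Rd_lborel k)"
  using measurable_component_singleton[of i "{..<k}" "\<lambda>_. lborel"] by simp

lemma vadd_measurable [measurable]: "(\<lambda>t. vadd k t u) \<in> measurable (Rd_lborel k) (Rd_lborel k)"
  unfolding vadd_def by measurable

lemma unit_cube_sets [measurable]: "unit_cube k \<in> sets (Rd_lborel k)"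
  unfolding unit_cube_def by (intro sets_PiM_I_finite) auto

lemma emeasure_unit_cube [simp]: "emeasure (Rd_lborel k) (unit_cube k) = 1"
  unfolding unit_cube_def by (subst lborel_product.emeasure_PiM) auto

lemma countable_int_vectors: "countable (int_vectors k)"
  unfolding int_vectors_def by (intro countable_PiE) auto

lemma distr_vadd: "distr (Rd_lborel k) (Rd_lborel k) (\<lambda>t. vadd k t u) = Rd_lborel k"
proof (rule lborel_product.PiM_eqI)
  fix A :: "nat \<Rightarrow> real set" assume "\<And>i. i \<in> {..<k} \<Longrightarrow> A i \<in> sets lborel"
  hence A: "\<And>i. i < k \<Longrightarrow> A i \<in> sets borel" by simp
  have B: "(\<lambda>x. x + u i) -` A i \<in> sets borel" if "i < k" for i
    using measurable_sets[of "\<lambda>x. x + u i" borel borel "A i"] A[OF that] by simp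
  have eq: "(\<lambda>t. vadd k t u) -` PiE {..<k} A \<inter> space (Rd_lborel k) = PiE {..<k} (\<lambda>i. (\<lambda>x. x + u i) -` A i)"
    (is "?l = ?r")
  proof (rule Set.set_eqI)
    fix t show "t \<in> ?l \<longleftrightarrow> t \<in> ?r"
      unfolding space_Rd vadd_def by (simp add: PiE_iff conj_commute)
  qed
  have "emeasure (distr (Rd_lborel k) (Rd_lborel k) (\<lambda>t. vadd k t u)) (PiE {..<k} A) =
      emeasure (Rd_lborel k) ((\<lambda>t. vadd k t u) -` PiE {..<k} A \<inter> space (Rd_lborel k))"
    using A by (intro emeasure_distr vadd_measurable sets_PiM_I_finite) auto
  also have "\<dots> = (\<Prod>i<k. emeasure lborel ((\<lambda>x. x + u i) -` A i))"
    unfolding eq using B by (intro lborel_product.emeasure_PiM) auto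
  also have "\<dots> = (\<Prod>i<k. emeasure lborel (A i))"
  proof (rule prod.cong)
    fix i assume "i \<in> {..<k}"
    hence A: "A i \<in> sets borel" using A by simp
    have "emeasure lborel (A i) = emeasure (distr lborel borel ((+) (u i))) (A i)"
      by (simp add: lborel_distr_plus)
    also have "\<dots> = emeasure lborel ((+) (u i) -` A i)" using A by (subst emeasure_distr) auto
    also have "(+) (u i) = (\<lambda>x. x + u i)" by (auto simp: add.commute)
    finally show "emeasure lborel ((\<lambda>x. x + u i) -` A i) = emeasure lborel (A i)" by simp
  qed simp
  finally show "emeasure (distr (Rd_lborel k) (Rd_lborel k) (\<lambda>t. vadd k t u)) (PiE {..<k} A) =
      (\<Prod>i<k. emeasure lborel (A i))" .
qed auto

lemma nn_integral_vadd:
  assumes [measurable]: "f \<in> borel_measurable (Rd_lborel k)"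
  shows "(\<integral>\<^sup>+t. f (vadd k t u) \<partial>Rd_lborel k) = (\<integral>\<^sup>+t. f t \<partial>Rd_lborel k)"
proof -
  have "(\<integral>\<^sup>+t. f (vadd k t u) \<partial>Rd_lborel k) = (\<integral>\<^sup>+t. f t \<partial>distr (Rd_lborel k) (Rd_lborel k) (\<lambda>t. vadd k t u))"
    by (subst nn_integral_distr) auto
  thus ?thesis unfolding distr_vadd .
qed

lemma nn_integral_count_single:
  fixes g :: "'z \<Rightarrow> ennreal"
  assumes "z0 \<in> Z" "\<And>z. z \<in> Z \<Longrightarrow> z \<noteq> z0 \<Longrightarrow> g z = 0"
  shows "(\<integral>\<^sup>+z. g z \<partial>count_space Z) = g z0"
proof -
  have "(\<integral>\<^sup>+z. g z \<partial>count_space Z) = (\<integral>\<^sup>+z. g z0 * indicator {z0} z \<partial>count_space Z)"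
    using assms by (intro nn_integral_cong) (auto split: split_indicator)
  also have "\<dots> = g z0" using assms by (subst nn_integral_cmult_indicator) (auto simp: emeasure_count_space)
  finally show ?thesis .
qed

lemma unit_cube_floor:
  assumes "z \<in> int_vectors k"
  shows "vadd k t (\<lambda>i. - of_int (z i)) \<in> unit_cube k \<longleftrightarrow> z = (\<lambda>i\<in>{..<k}. \<lfloor>t i\<rfloor>)"
proof
  assume "vadd k t (\<lambda>i. - of_int (z i)) \<in> unit_cube k"
  hence "\<forall>i<k. 0 \<le> t i - of_int (z i) \<and> t i - of_int (z i) < 1"
    by (auto simp: vadd_def unit_cube_def PiE_iff)
  hence "\<forall>i<k. \<lfloor>t i\<rfloor> = z i" by (auto simp: floor_eq_iff algebra_simps)
  thus "z = (\<lambda>i\<in>{..<k}. \<lfloor>t i\<rfloor>)" using assms by (auto simp: int_vectors_def PiE_iff extensional_def)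
next
  assume "z = (\<lambda>i\<in>{..<k}. \<lfloor>t i\<rfloor>)"
  hence "\<forall>i<k. 0 \<le> t i - of_int (z i) \<and> t i - of_int (z i) < 1" by simp linarith
  thus "vadd k t (\<lambda>i. - of_int (z i)) \<in> unit_cube k" by (auto simp: vadd_def unit_cube_def PiE_iff)
qed

lemma vadd_inverse:
  "t \<in> space (Rd_lborel k) \<Longrightarrow> vadd k (vadd k t u) (\<lambda>i. - u i) = t"
  unfolding space_Rd vadd_def by (auto simp: extensional_def)

text \<open>The integer translates of the cube form a partition of unity. Insert it, exchange sum
  and integral, and translate each term back. The sum is an integral over
  \<open>count_space\<close>, so no summability condition arises.\<close>

lemma nn_integral_tiling:
  assumes f [measurable]: "f \<in> borel_measurable (Rd_lborel k)"
  shows "(\<integral>\<^sup>+t. f t \<partial>Rd_lborel k) =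
    (\<integral>\<^sup>+t. (\<integral>\<^sup>+z. f (vadd k t (\<lambda>i. of_int (z i))) \<partial>count_space (int_vectors k)) * indicator (unit_cube k) t \<partial>Rd_lborel k)"
proof -
  let ?Z = "int_vectors k"
  have "(\<integral>\<^sup>+t. f t \<partial>Rd_lborel k) =
      (\<integral>\<^sup>+t. (\<integral>\<^sup>+z. f t * indicator (unit_cube k) (vadd k t (\<lambda>i. - of_int (z i))) \<partial>count_space ?Z) \<partial>Rd_lborel k)"
  proof (rule nn_integral_cong)
    fix t assume "t \<in> space (Rd_lborel k)"
    let ?z = "\<lambda>i\<in>{..<k}. \<lfloor>t i\<rfloor>"
    have z: "?z \<in> ?Z" by (auto simp: int_vectors_def)
    have "(\<integral>\<^sup>+z. f t * indicator (unit_cube k) (vadd k t (\<lambda>i. - of_int (z i))) \<partial>count_space ?Z) =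
      f t * indicator (unit_cube k) (vadd k t (\<lambda>i. - of_int (?z i)))"
      using unit_cube_floor[of _ k t] by (intro nn_integral_count_single z) (auto split: split_indicator)
    also have "\<dots> = f t" using unit_cube_floor[OF z, of t] by simp
    finally show "f t = (\<integral>\<^sup>+z. f t * indicator (unit_cube k) (vadd k t (\<lambda>i. - of_int (z i))) \<partial>count_space ?Z)" by simp
  qed
  also have "\<dots> = (\<integral>\<^sup>+z. (\<integral>\<^sup>+t. f t * indicator (unit_cube k) (vadd k t (\<lambda>i. - of_int (z i))) \<partial>Rd_lborel k) \<partial>count_space ?Z)"
    by (rule nn_integral_count_space_nn_integral[OF countable_int_vectors]) measurable
  also have "\<dots> = (\<integral>\<^sup>+z. (\<integral>\<^sup>+t. f (vadd k t (\<lambda>i. of_int (z i))) * indicator (unit_cube k) t \<partial>Rd_lborel k) \<partial>count_space ?Z)"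
  proof (rule nn_integral_cong)
    fix z :: "nat \<Rightarrow> int"
    have "(\<integral>\<^sup>+t. f t * indicator (unit_cube k) (vadd k t (\<lambda>i. - of_int (z i))) \<partial>Rd_lborel k) =
      (\<integral>\<^sup>+t. f (vadd k t (\<lambda>i. of_int (z i))) * indicator (unit_cube k) (vadd k (vadd k t (\<lambda>i. of_int (z i))) (\<lambda>i. - of_int (z i))) \<partial>Rd_lborel k)"
      by (rule nn_integral_vadd[symmetric]) measurable
    also have "\<dots> = (\<integral>\<^sup>+t. f (vadd k t (\<lambda>i. of_int (z i))) * indicator (unit_cube k) t \<partial>Rd_lborel k)"
      by (intro nn_integral_cong) (simp add: vadd_inverse)
    finally show "(\<integral>\<^sup>+t. f t * indicator (unit_cube k) (vadd k t (\<lambda>i. - of_int (z i))) \<partial>Rd_lborel k) =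
      (\<integral>\<^sup>+t. f (vadd k t (\<lambda>i. of_int (z i))) * indicator (unit_cube k) t \<partial>Rd_lborel k)" .
  qed
  also have "\<dots> = (\<integral>\<^sup>+t. (\<integral>\<^sup>+z. f (vadd k t (\<lambda>i. of_int (z i))) * indicator (unit_cube k) t \<partial>count_space ?Z) \<partial>Rd_lborel k)"
    by (rule nn_integral_count_space_nn_integral[OF countable_int_vectors, symmetric]) measurable
  also have "\<dots> = (\<integral>\<^sup>+t. (\<integral>\<^sup>+z. f (vadd k t (\<lambda>i. of_int (z i))) \<partial>count_space ?Z) * indicator (unit_cube k) t \<partial>Rd_lborel k)"
    by (intro nn_integral_cong nn_integral_multc) simp
  finally show ?thesis .
qed

text \<open>Shifting the argument shifts the cube, and a shifted cube still contains exactly one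
  integer translate of each point; by periodicity the folded integrand is \<open>h\<close>
  again.\<close>

lemma nn_integral_unit_cube_shift:
  assumes h [measurable]: "h \<in> borel_measurable (Rd_lborel k)"
    and per: "\<And>t z. t \<in> space (Rd_lborel k) \<Longrightarrow> h (vadd k t (\<lambda>i. of_int (z i :: int))) = h t"
  shows "(\<integral>\<^sup>+t. h (vadd k t u) * indicator (unit_cube k) t \<partial>Rd_lborel k) =
    (\<integral>\<^sup>+t. h t * indicator (unit_cube k) t \<partial>Rd_lborel k)"
proof -
  have "(\<integral>\<^sup>+t. h (vadd k t u) * indicator (unit_cube k) t \<partial>Rd_lborel k) =
     (\<integral>\<^sup>+t. h (vadd k t u) * indicator (unit_cube k) (vadd k (vadd k t u) (\<lambda>i. - u i)) \<partial>Rd_lborel k)"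
    by (intro nn_integral_cong) (simp add: vadd_inverse)
  also have "\<dots> = (\<integral>\<^sup>+t. h t * indicator (unit_cube k) (vadd k t (\<lambda>i. - u i)) \<partial>Rd_lborel k)"
    by (rule nn_integral_vadd[where f = "\<lambda>t. h t * indicator (unit_cube k) (vadd k t (\<lambda>i. - u i))"]) measurable
  also have "\<dots> = (\<integral>\<^sup>+t. (\<integral>\<^sup>+z. h (vadd k t (\<lambda>i. of_int (z i))) *
      indicator (unit_cube k) (vadd k (vadd k t (\<lambda>i. of_int (z i))) (\<lambda>i. - u i)) \<partial>count_space (int_vectors k))
      * indicator (unit_cube k) t \<partial>Rd_lborel k)"
    by (rule nn_integral_tiling) measurable
  also have "\<dots> = (\<integral>\<^sup>+t. h t * indicator (unit_cube k) t \<partial>Rd_lborel k)"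
  proof (intro nn_integral_cong arg_cong2[where f = "(*)"] refl)
    fix t assume t: "t \<in> space (Rd_lborel k)"
    define s where "s = vadd k t (\<lambda>i. - u i)"
    \<comment> \<open>The integer vector that brings \<open>s\<close>, the point \<open>t\<close>
      shifted by \<open>- u\<close>, into the unit cube.\<close>
    let ?z = "\<lambda>i\<in>{..<k}. - \<lfloor>s i\<rfloor>"
    have eq: "vadd k (vadd k t (\<lambda>i. of_int (z i))) (\<lambda>i. - u i) = vadd k s (\<lambda>i. - of_int ((\<lambda>i\<in>{..<k}. - z i) i))" for z
      by (auto simp: vadd_def s_def)
    have iff: "vadd k (vadd k t (\<lambda>i. of_int (z i))) (\<lambda>i. - u i) \<in> unit_cube k \<longleftrightarrow> z = ?z" if "z \<in> int_vectors k" for z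
    proof -
      have "(\<lambda>i\<in>{..<k}. - z i) \<in> int_vectors k" by (auto simp: int_vectors_def)
      moreover have "(\<lambda>i\<in>{..<k}. - z i) = (\<lambda>i\<in>{..<k}. \<lfloor>s i\<rfloor>) \<longleftrightarrow> z = ?z"
      proof
        assume e: "(\<lambda>i\<in>{..<k}. - z i) = (\<lambda>i\<in>{..<k}. \<lfloor>s i\<rfloor>)"
        have "- z i = \<lfloor>s i\<rfloor>" if "i < k" for i using fun_cong[OF e, of i] that by simp
        hence "z i = - \<lfloor>s i\<rfloor>" if "i < k" for i using that by fastforce
        thus "z = ?z" using \<open>z \<in> int_vectors k\<close>
          by (intro ext) (simp add: int_vectors_def PiE_iff extensional_def)
      qed auto
      ultimately show ?thesis unfolding eq using unit_cube_floor by blast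
    qed
    have z: "?z \<in> int_vectors k" by (auto simp: int_vectors_def)
    have "(\<integral>\<^sup>+z. h (vadd k t (\<lambda>i. of_int (z i))) *
      indicator (unit_cube k) (vadd k (vadd k t (\<lambda>i. of_int (z i))) (\<lambda>i. - u i)) \<partial>count_space (int_vectors k)) =
       h (vadd k t (\<lambda>i. of_int (?z i))) *
      indicator (unit_cube k) (vadd k (vadd k t (\<lambda>i. of_int (?z i))) (\<lambda>i. - u i))"
      using iff by (intro nn_integral_count_single z) (auto split: split_indicator)
    also have "\<dots> = h t" unfolding per[OF t] using iff[OF z] by simp
    finally show "(\<integral>\<^sup>+z. h (vadd k t (\<lambda>i. of_int (z i))) *
      indicator (unit_cube k) (vadd k (vadd k t (\<lambda>i. of_int (z i))) (\<lambda>i. - u i)) \<partial>count_space (int_vectors k)) = h t" .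
  qed
  finally show ?thesis .
qed

text \<open>Triangular substitutions suffice, since a basis is triangular in its own Gram-Schmidt
  frame. Induction on \<open>k\<close>: with the last coordinate fixed, the others undergo the
  smaller triangular map and a translation, while the last one is scaled.\<close>

lemma nn_integral_triangular:
  fixes a :: "nat \<Rightarrow> nat \<Rightarrow> real"
  assumes "f \<in> borel_measurable (Rd_lborel k)"
    and "\<And>i. i < k \<Longrightarrow> a i i > 0" "\<And>i j. j < i \<Longrightarrow> i < k \<Longrightarrow> a i j = 0"
  shows "ennreal (\<Prod>i<k. a i i) * (\<integral>\<^sup>+t. f (\<lambda>i\<in>{..<k}. \<Sum>j<k. a i j * t j) \<partial>Rd_lborel k) = (\<integral>\<^sup>+t. f t \<partial>Rd_lborel k)"
  using assms
proof (induction k arbitrary: f)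
  case 0
  show ?case by (simp add: PiM_empty nn_integral_count_space_finite)
next
  case (Suc k)
  note [measurable] = Suc.prems(1)
  let ?A = "\<lambda>k t. \<lambda>i\<in>{..<k}. \<Sum>j<k. a i j * t j"
  have upd [measurable]: "(\<lambda>x. x(k := y)) \<in> measurable (Rd_lborel k) (Rd_lborel (Suc k))" for y
    unfolding lessThan_Suc by (rule measurable_fun_upd[where J="{..<k}"]) auto
  have Am [measurable]: "?A m \<in> measurable (Rd_lborel m) (Rd_lborel m)" for m by measurable
  have split: "(\<integral>\<^sup>+t. g t \<partial>Rd_lborel (Suc k)) = (\<integral>\<^sup>+y. (\<integral>\<^sup>+x. g (x(k := y)) \<partial>Rd_lborel k) \<partial>lborel)"
    if "g \<in> borel_measurable (Rd_lborel (Suc k))" for g :: "(nat \<Rightarrow> real) \<Rightarrow> ennreal"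
    using that unfolding lessThan_Suc by (intro lborel_product.product_nn_integral_insert_rev) auto
  have m2: "(\<lambda>p. (snd p)(k := fst p)) \<in> measurable (lborel \<Otimes>\<^sub>M Rd_lborel k) (Rd_lborel (Suc k))"
    unfolding lessThan_Suc by (rule measurable_fun_upd[where J="{..<k}"]) auto
  have gm [measurable]: "(\<lambda>y. \<integral>\<^sup>+x. f (x(k := y)) \<partial>Rd_lborel k) \<in> borel_measurable lborel"
  proof -
    interpret sigma_finite_measure "Rd_lborel k" by (rule lborel_product.sigma_finite) simp
    have "(\<lambda>p. f ((snd p)(k := fst p))) \<in> borel_measurable (lborel \<Otimes>\<^sub>M Rd_lborel k)"
      by (rule measurable_compose[OF m2 Suc.prems(1)])
    thus ?thesis by (intro borel_measurable_nn_integral) (simp add: split_beta)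
  qed
  have akk: "a k k > 0" using Suc.prems(2) by simp
  have inner: "ennreal (\<Prod>i<k. a i i) * (\<integral>\<^sup>+x. f (?A (Suc k) (x(k := y))) \<partial>Rd_lborel k) =
      (\<integral>\<^sup>+x. f (x(k := a k k * y)) \<partial>Rd_lborel k)" for y
  proof -
    \<comment> \<open>The last column moves the other coordinates by a translation that depends on
      \<open>y\<close> alone.\<close>
    let ?u = "\<lambda>i. a i k * y"
    have eq: "?A (Suc k) (x(k := y)) = (vadd k (?A k x) ?u)(k := a k k * y)" for x
    proof
      fix i show "?A (Suc k) (x(k := y)) i = ((vadd k (?A k x) ?u)(k := a k k * y)) i"
        using Suc.prems(3)[of _ k] by (auto simp: vadd_def)
    qed
    have "ennreal (\<Prod>i<k. a i i) * (\<integral>\<^sup>+x. f (?A (Suc k) (x(k := y))) \<partial>Rd_lborel k) =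
      (\<integral>\<^sup>+x. f ((vadd k x ?u)(k := a k k * y)) \<partial>Rd_lborel k)"
      unfolding eq using Suc.prems(2,3)
      by (intro Suc.IH[where f = "\<lambda>x. f ((vadd k x ?u)(k := a k k * y))"]) auto
    also have "\<dots> = (\<integral>\<^sup>+x. f (x(k := a k k * y)) \<partial>Rd_lborel k)"
      by (rule nn_integral_vadd) measurable
    finally show ?thesis .
  qed
  have "ennreal (\<Prod>i<Suc k. a i i) * (\<integral>\<^sup>+t. f (?A (Suc k) t) \<partial>Rd_lborel (Suc k)) =
     ennreal (a k k) * (ennreal (\<Prod>i<k. a i i) * (\<integral>\<^sup>+y. (\<integral>\<^sup>+x. f (?A (Suc k) (x(k := y))) \<partial>Rd_lborel k) \<partial>lborel))"
  proof -
    have "ennreal (\<Prod>i<Suc k. a i i) = ennreal (a k k) * ennreal (\<Prod>i<k. a i i)"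
      using akk by (simp add: ennreal_mult'[symmetric] mult.commute)
    thus ?thesis by (subst split) (simp_all only: mult.assoc, measurable)
  qed
  also have "\<dots> = ennreal (a k k) * (\<integral>\<^sup>+y. ennreal (\<Prod>i<k. a i i) * (\<integral>\<^sup>+x. f (?A (Suc k) (x(k := y))) \<partial>Rd_lborel k) \<partial>lborel)"
  proof (subst nn_integral_cmult)
    interpret sigma_finite_measure "Rd_lborel k" by (rule lborel_product.sigma_finite) simp
    have "(\<lambda>p. f (?A (Suc k) ((snd p)(k := fst p)))) \<in> borel_measurable (lborel \<Otimes>\<^sub>M Rd_lborel k)"
      by (rule measurable_compose[OF m2 measurable_compose[OF Am Suc.prems(1)]])
    thus "(\<lambda>y. \<integral>\<^sup>+x. f (?A (Suc k) (x(k := y))) \<partial>Rd_lborel k) \<in> borel_measurable lborel"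
      by (intro borel_measurable_nn_integral) (simp add: split_beta)
  qed simp
  also have "\<dots> = ennreal \<bar>a k k\<bar> * (\<integral>\<^sup>+y. (\<integral>\<^sup>+x. f (x(k := 0 + a k k * y)) \<partial>Rd_lborel k) \<partial>lborel)"
    unfolding inner using akk by simp
  also have "\<dots> = (\<integral>\<^sup>+y. (\<integral>\<^sup>+x. f (x(k := y)) \<partial>Rd_lborel k) \<partial>lborel)"
    using akk gm by (intro nn_integral_real_affine[where c = "a k k" and t = 0, symmetric]) auto
  also have "\<dots> = (\<integral>\<^sup>+t. f t \<partial>Rd_lborel (Suc k))" by (rule split[symmetric]) measurable
  finally show ?case .
qed

text \<open>Integrate along coordinate \<open>m\<close> first: each line in that direction meets the
  hyperplane only at \<open>y0\<close>.\<close>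

lemma hyperplane_null_set:
  fixes a :: "nat \<Rightarrow> real"
  assumes m: "m < k" "a m \<noteq> 0"
  shows "{t \<in> space (Rd_lborel k). (\<Sum>i<k. a i * t i) = c} \<in> null_sets (Rd_lborel k)"
proof -
  let ?H = "{t \<in> space (Rd_lborel k). (\<Sum>i<k. a i * t i) = c}"
  have H [measurable]: "?H \<in> sets (Rd_lborel k)" by measurable
  have ins: "{..<k} = insert m ({..<k} - {m})" using m by auto
  have "emeasure (Rd_lborel k) ?H = (\<integral>\<^sup>+t. indicator ?H t \<partial>Rd_lborel k)" by simp
  also have "\<dots> = (\<integral>\<^sup>+x. (\<integral>\<^sup>+y. indicator ?H (x(m := y)) \<partial>lborel) \<partial>Pi\<^sub>M ({..<k} - {m}) (\<lambda>_. lborel))"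
    using H lborel_product.product_nn_integral_insert[of "{..<k} - {m}" m "indicator ?H"] m
    by (simp add: insert_absorb)
  also have "\<dots> = (\<integral>\<^sup>+x. 0 \<partial>Pi\<^sub>M ({..<k} - {m}) (\<lambda>_. lborel :: real measure))"
  proof (rule nn_integral_cong)
    fix x :: "nat \<Rightarrow> real"
    define y0 where "y0 = (c - (\<Sum>i\<in>{..<k} - {m}. a i * x i)) / a m"
    have "indicator ?H (x(m := y)) \<le> (indicator {y0} y :: ennreal)" for y
    proof -
      have "(\<Sum>i<k. a i * (x(m := y)) i) = a m * y + (\<Sum>i\<in>{..<k} - {m}. a i * x i)"
        by (subst ins, subst sum.insert) auto
      thus ?thesis using m by (auto simp: y0_def field_simps split: split_indicator)
    qed
    hence "(\<integral>\<^sup>+y. indicator ?H (x(m := y)) \<partial>lborel) \<le> (\<integral>\<^sup>+y. indicator {y0} y \<partial>lborel)"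
      by (intro nn_integral_mono) auto
    also have "\<dots> = 0" by simp
    finally show "(\<integral>\<^sup>+y. indicator ?H (x(m := y)) \<partial>lborel) = 0" by simp
  qed
  finally show ?thesis using H by (auto intro: null_setsI)
qed

section \<open>Coordinates with respect to a basis\<close>

definition lincomb :: "nat \<Rightarrow> (nat \<Rightarrow> 'a::real_vector) \<Rightarrow> (nat \<Rightarrow> real) \<Rightarrow> 'a" where
  "lincomb k b t = (\<Sum>i<k. t i *\<^sub>R b i)"

lemma lincomb_measurable [measurable]:
  "lincomb k (b :: nat \<Rightarrow> 'a::euclidean_space) \<in> measurable (Rd_lborel k) borel"
  unfolding lincomb_def by measurable

lemma lincomb_vadd: "lincomb k b (vadd k t u) = lincomb k b t + lincomb k b u"
  by (simp add: lincomb_def vadd_def scaleR_left_distrib sum.distrib)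

lemma lincomb_in_zspan: "lincomb k b (\<lambda>i. of_int (z i)) \<in> zspan k b"
  unfolding lincomb_def by (rule zspanI)

lemma lincomb_in_span: "lincomb k b t \<in> span (b ` {..<k})"
  unfolding lincomb_def span_family_iff by blast

lemma span_lincomb: "x \<in> span (b ` {..<k}) \<Longrightarrow> \<exists>t. x = lincomb k b t"
  unfolding lincomb_def span_family_iff .

lemma norm_sq_frame:
  assumes "indep_family k b" "x \<in> span (b ` {..<k})"
  shows "(norm x)\<^sup>2 = (\<Sum>i<k. (inner (gs_frame b i) x)\<^sup>2)"
proof -
  have "(norm x)\<^sup>2 = inner (\<Sum>i<k. inner (gs_frame b i) x *\<^sub>R gs_frame b i) x"
    using gs_frame_expand[OF assms(1) order_refl assms(2)] by (simp add: power2_norm_eq_inner)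
  thus ?thesis by (simp add: inner_sum_left power2_eq_square)
qed

lemma inner_frame_lincomb:
  "inner (gs_frame b i) (lincomb k b t) = (\<Sum>j<k. inner (gs_frame b i) (b j) * t j)"
  by (simp add: lincomb_def inner_sum_right mult.commute)

text \<open>Passing from lattice coordinates to orthonormal coordinates of the span multiplies
  volumes by the determinant.\<close>

lemma nn_integral_frame:
  fixes b :: "nat \<Rightarrow> 'a::euclidean_space"
  assumes ind: "indep_family k b" and f: "f \<in> borel_measurable (Rd_lborel k)"
  shows "ennreal (gs_prod k b) * (\<integral>\<^sup>+t. f (\<lambda>i\<in>{..<k}. inner (gs_frame b i) (lincomb k b t)) \<partial>Rd_lborel k)
    = (\<integral>\<^sup>+x. f x \<partial>Rd_lborel k)"
proof -
  have "gs_prod k b = (\<Prod>i<k. inner (gs_frame b i) (b i))"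
    unfolding gs_prod_def using gs_frame_diag[OF ind] by simp
  moreover have "ennreal (\<Prod>i<k. inner (gs_frame b i) (b i)) *
      (\<integral>\<^sup>+t. f (\<lambda>i\<in>{..<k}. \<Sum>j<k. inner (gs_frame b i) (b j) * t j) \<partial>Rd_lborel k) = (\<integral>\<^sup>+x. f x \<partial>Rd_lborel k)"
    by (rule nn_integral_triangular[OF f])
      (simp_all add: gs_frame_diag[OF ind] gs_nonzero[OF ind] gs_frame_orth_less(1))
  ultimately show ?thesis unfolding inner_frame_lincomb by simp
qed

lemma discrete_nearest:
  assumes "discrete_subgroup N"
  obtains z where "z \<in> N" "infdist x N = norm (x - z)" "\<And>y. y \<in> N \<Longrightarrow> norm (x - z) \<le> norm (x - y)"
proof -
  \<comment> \<open>The origin competes at distance \<open>norm x\<close>, so lattice points of norm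
    above \<open>2 * norm x\<close> are no nearer.\<close>
  define F where "F = N \<inter> cball 0 (2 * norm x)"
  have F: "finite F" "F \<noteq> {}" using discrete_subgroupD(1,3)[OF assms] by (auto simp: F_def)
  define z where "z = arg_min_on (\<lambda>z. norm (x - z)) F"
  have zF: "z \<in> F" unfolding z_def using arg_min_if_finite(1)[OF F] .
  have zmin: "norm (x - z) \<le> norm (x - y)" if "y \<in> F" for y
    unfolding z_def using arg_min_least[OF F that] .
  have z: "z \<in> N" using zF by (simp add: F_def)
  have 0: "norm (x - z) \<le> norm x" using zmin[of 0] discrete_subgroupD(1)[OF assms] by (simp add: F_def)
  have min: "norm (x - z) \<le> norm (x - y)" if "y \<in> N" for y
  proof (cases "y \<in> F")
    case False
    hence "norm y > 2 * norm x" using that by (simp add: F_def)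
    hence "norm (x - y) \<ge> norm x" using norm_triangle_ineq2[of y x] by (simp add: norm_minus_commute)
    thus ?thesis using 0 by simp
  qed (use zmin in auto)
  have "infdist x N = norm (x - z)"
  proof (rule antisym)
    show "infdist x N \<le> norm (x - z)" using infdist_le[OF z, of x] by (simp add: dist_norm)
    show "norm (x - z) \<le> infdist x N"
      using min z by (auto simp: infdist_def dist_norm intro!: cINF_greatest)
  qed
  thus ?thesis using that z min by blast
qed

section \<open>Determinant and covering radius\<close>

lemma infdist_attained:
  assumes "discrete_subgroup N" obtains z where "z \<in> N" "infdist x N = norm (x - z)"
  by (rule discrete_nearest[OF assms, where x = x]) (rule that)

text \<open>The balls of radius \<open>\<mu>\<close> around lattice points cover the span, so each
  point of the unit cube has an integer translate in the ball around 0. Folding the volume of this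
  ball over the cube gives at least 1 in lattice coordinates.\<close>

lemma lattice_det_le_ball:
  fixes N :: "'a::euclidean_space set"
  assumes N: "discrete_subgroup N" and mu: "\<mu> > 0" "\<And>x. x \<in> span N \<Longrightarrow> infdist x N \<le> \<mu>"
  shows "lattice_det N \<le> unit_ball_vol (real (dim (span N))) * \<mu> ^ dim (span N)"
proof -
  obtain bs where bs: "lattice_basis bs N" using lattice_basis_exists[OF N] by blast
  define k where "k = length bs"
  define b where "b = (!) bs"
  have k: "dim (span N) = k" using lattice_basis_length[OF bs] by (simp add: k_def)
  have ind: "indep_family k b" and Nz: "N = zspan k b" using bs unfolding lattice_basis_iff k_def b_def by auto
  define B where "B = {t \<in> space (Rd_lborel k). norm (lincomb k b t) \<le> \<mu>}"
  have B [measurable]: "B \<in> sets (Rd_lborel k)" unfolding B_def by measurable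
  have "1 = (\<integral>\<^sup>+t. 1 * indicator (unit_cube k) t \<partial>Rd_lborel k)" by simp
  also have "\<dots> \<le> (\<integral>\<^sup>+t. (\<integral>\<^sup>+z. indicator B (vadd k t (\<lambda>i. of_int (z i))) \<partial>count_space (int_vectors k))
      * indicator (unit_cube k) t \<partial>Rd_lborel k)"
  proof (intro nn_integral_mono mult_right_mono)
    fix t assume "t \<in> space (Rd_lborel k)"
    have "lincomb k b t \<in> span N" unfolding Nz span_zspan by (rule lincomb_in_span)
    moreover obtain z where z: "z \<in> N" "infdist (lincomb k b t) N = norm (lincomb k b t - z)"
      by (rule infdist_attained[OF N])
    ultimately have le: "norm (lincomb k b t - z) \<le> \<mu>" using mu(2) by metis
    obtain c where c: "z = (\<Sum>i<k. of_int (c i) *\<^sub>R b i)" using z(1) unfolding Nz by (rule zspanE)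
    \<comment> \<open>The folding adds integer vectors, hence the sign.\<close>
    define c' where "c' = (\<lambda>i\<in>{..<k}. - c i)"
    have "lincomb k b t - z = lincomb k b (vadd k t (\<lambda>i. of_int (c' i)))"
      unfolding lincomb_vadd c by (simp add: lincomb_def c'_def sum_negf)
    hence "vadd k t (\<lambda>i. of_int (c' i)) \<in> B" using le by (simp add: B_def space_Rd vadd_def)
    moreover have "c' \<in> int_vectors k" by (auto simp: c'_def int_vectors_def)
    ultimately show "1 \<le> (\<integral>\<^sup>+z. indicator B (vadd k t (\<lambda>i. of_int (z i))) \<partial>count_space (int_vectors k))"
      using nn_integral_ge_point[of c' "int_vectors k" "\<lambda>z. indicator B (vadd k t (\<lambda>i. of_int (z i)))"] by simp
  qed simp
  also have "\<dots> = (\<integral>\<^sup>+t. indicator B t \<partial>Rd_lborel k)"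
    by (rule nn_integral_tiling[symmetric]) measurable
  finally have one: "1 \<le> (\<integral>\<^sup>+t. indicator B t \<partial>Rd_lborel k)" .
  define C where "C = {x. sqrt (\<Sum>i<k. (x i)\<^sup>2) \<le> \<mu>} \<inter> space (Rd_lborel k)"
  have C [measurable]: "C \<in> sets (Rd_lborel k)"
  proof -
    have "C = {x \<in> space (Rd_lborel k). sqrt (\<Sum>i<k. (x i)\<^sup>2) \<le> \<mu>}" by (auto simp: C_def)
    also have "\<dots> \<in> sets (Rd_lborel k)" by measurable
    finally show ?thesis .
  qed
  have "ennreal (gs_prod k b) \<le> ennreal (gs_prod k b) * (\<integral>\<^sup>+t. indicator B t \<partial>Rd_lborel k)"
    using mult_left_mono[OF one, of "ennreal (gs_prod k b)"] by simp
  also have "(\<integral>\<^sup>+t. indicator B t \<partial>Rd_lborel k) =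
      (\<integral>\<^sup>+t. indicator C (\<lambda>i\<in>{..<k}. inner (gs_frame b i) (lincomb k b t)) \<partial>Rd_lborel k)"
  proof (rule nn_integral_cong)
    fix t assume t: "t \<in> space (Rd_lborel k)"
    have "norm (lincomb k b t) = sqrt (\<Sum>i<k. (inner (gs_frame b i) (lincomb k b t))\<^sup>2)"
      using norm_sq_frame[OF ind lincomb_in_span[of k b t]] by (metis norm_ge_zero real_sqrt_unique)
    thus "indicator B t = (indicator C (\<lambda>i\<in>{..<k}. inner (gs_frame b i) (lincomb k b t)) :: ennreal)"
      using t by (simp add: B_def C_def space_Rd split: split_indicator)
  qed
  also have "ennreal (gs_prod k b) * \<dots> = (\<integral>\<^sup>+x. indicator C x \<partial>Rd_lborel k)"
    by (rule nn_integral_frame[OF ind]) measurable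
  also have "\<dots> = ennreal (unit_ball_vol (real k) * \<mu> ^ k)"
    using emeasure_cball_aux[of "{..<k}" \<mu>] mu(1) C by (simp add: C_def)
  finally have "gs_prod k b \<le> unit_ball_vol (real k) * \<mu> ^ k"
    using mu(1) by (subst (asm) ennreal_le_iff) auto
  thus ?thesis using lattice_det_eq[OF bs] k by (simp add: k_def b_def)
qed

text \<open>The part of the Gamma integral over \<open>t \<ge> x\<close>, where
  \<open>t powr x\<close> is at least \<open>x powr x\<close>, already contributes
  \<open>x powr x * exp (- x)\<close>.\<close>

lemma Gamma_plus1_lower:
  assumes "x > (0::real)"
  shows "Gamma (x + 1) \<ge> (x / exp 1) powr x"
proof -
  have G: "((\<lambda>t. t powr x / exp t) has_integral Gamma (x + 1)) {0..}"
    using Gamma_integral_real[of "x + 1"] assms by simp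
  have "((\<lambda>t. x powr x * exp (- 1 * t)) has_integral x powr x * (exp (- 1 * x) / 1)) {x..}"
    by (intro has_integral_mult_right has_integral_exp_minus_to_infinity) simp
  hence E: "((\<lambda>t. if t \<in> {x..} then x powr x * exp (- t) else 0) has_integral x powr x * exp (- x)) {0..}"
    using assms by (subst has_integral_restrict) auto
  have "x powr x * exp (- x) \<le> Gamma (x + 1)"
    by (rule has_integral_le[OF E G])
      (use assms in \<open>auto simp: exp_minus field_simps intro!: powr_mono2\<close>)
  moreover have "(x / exp 1) powr x = x powr x * exp (- x)"
    using assms by (simp add: powr_divide exp_powr_real exp_minus field_simps)
  ultimately show ?thesis by simp
qed

text \<open>The source of \<open>sqrt (2 * pi * exp 1)\<close>: the volume is a power of
  \<open>pi\<close> over \<open>Gamma (k/2 + 1)\<close>, and the preceding bound applies to the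
  denominator.\<close>

lemma unit_ball_vol_le:
  assumes "k > 0"
  shows "unit_ball_vol (real k) \<le> sqrt (2 * pi * exp 1 / real k) ^ k"
proof -
  let ?x = "real k / 2"
  have x: "?x > 0" using assms by simp
  have "unit_ball_vol (real k) = pi powr ?x / Gamma (?x + 1)" by (simp add: unit_ball_vol_def)
  also have "\<dots> \<le> pi powr ?x / (?x / exp 1) powr ?x"
    using Gamma_plus1_lower[OF x] x by (intro divide_left_mono mult_pos_pos) auto
  also have "\<dots> = (2 * pi * exp 1 / real k) powr ?x"
    using assms by (subst powr_divide[symmetric]) (auto simp: field_simps)
  also have "\<dots> = ((2 * pi * exp 1 / real k) powr (1/2)) powr real k" by (simp add: powr_powr)
  also have "\<dots> = sqrt (2 * pi * exp 1 / real k) ^ k"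
    using assms by (simp add: powr_half_sqrt powr_realpow)
  finally show ?thesis .
qed

lemma lattice_det_root_le:
  fixes N :: "'a::euclidean_space set"
  assumes N: "discrete_subgroup N" and mu: "\<mu> > 0" "\<And>x. x \<in> span N \<Longrightarrow> infdist x N \<le> \<mu>"
    and k: "dim (span N) = k" "k > 0"
  shows "sqrt (real k) * lattice_det N powr (1 / real k) \<le> sqrt (2 * pi * exp 1) * \<mu>"
proof -
  define s where "s = sqrt (2 * pi * exp 1 / real k)"
  have s: "s > 0" using k by (simp add: s_def)
  have "lattice_det N \<le> unit_ball_vol (real k) * \<mu> ^ k" using lattice_det_le_ball[OF N mu] k by simp
  also have "\<dots> \<le> s ^ k * \<mu> ^ k" using unit_ball_vol_le[OF k(2)] mu by (intro mult_right_mono) (auto simp: s_def)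
  also have "\<dots> = (s * \<mu>) powr real k" using s mu by (simp add: power_mult_distrib powr_realpow)
  finally have "lattice_det N powr (1 / real k) \<le> ((s * \<mu>) powr real k) powr (1 / real k)"
    using lattice_det_pos[OF N] by (intro powr_mono2) auto
  also have "\<dots> = s * \<mu>" using k s mu by (simp add: powr_powr)
  finally have "sqrt (real k) * lattice_det N powr (1 / real k) \<le> sqrt (real k) * (s * \<mu>)"
    by (intro mult_left_mono) auto
  also have "\<dots> = sqrt (2 * pi * exp 1) * \<mu>" using k by (simp add: s_def real_sqrt_divide)
  finally show ?thesis .
qed

section \<open>Averages of periodic functions\<close>

text \<open>The mean over the span modulo the lattice. In lattice coordinates the parallelepiped is
  a cube of measure 1, so no division by the determinant appears.\<close>

definition avg :: "nat \<Rightarrow> (nat \<Rightarrow> 'a::euclidean_space) \<Rightarrow> ('a \<Rightarrow> ennreal) \<Rightarrow> ennreal" where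
  "avg k b h = (\<integral>\<^sup>+t. h (lincomb k b t) * indicator (unit_cube k) t \<partial>Rd_lborel k)"

lemma avg_const: "avg k b (\<lambda>_. c) = c"
  unfolding avg_def by (subst nn_integral_cmult) auto

lemma avg_mono: "(\<And>x. x \<in> span (b ` {..<k}) \<Longrightarrow> g x \<le> h x) \<Longrightarrow> avg k b g \<le> avg k b h"
  unfolding avg_def by (intro nn_integral_mono mult_right_mono) (auto simp: lincomb_in_span)

lemma avg_cong: "(\<And>x. x \<in> span (b ` {..<k}) \<Longrightarrow> g x = h x) \<Longrightarrow> avg k b g = avg k b h"
  by (intro antisym avg_mono) auto

lemma avg_add:
  assumes [measurable]: "g \<in> borel_measurable borel" "h \<in> borel_measurable borel"
  shows "avg k b (\<lambda>x. g x + h x) = avg k b g + avg k b h"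
  unfolding avg_def by (simp add: distrib_right nn_integral_add)

lemma avg_cmult:
  assumes [measurable]: "h \<in> borel_measurable borel"
  shows "avg k b (\<lambda>x. c * h x) = c * avg k b h"
  unfolding avg_def by (simp add: mult.assoc nn_integral_cmult)

lemma avg_shift:
  assumes [measurable]: "h \<in> borel_measurable borel"
    and per: "\<And>x z. z \<in> zspan k b \<Longrightarrow> h (x + z) = h x" and u: "u \<in> span (b ` {..<k})"
  shows "avg k b (\<lambda>x. h (x + u)) = avg k b h"
proof -
  obtain s where s: "u = lincomb k b s" using span_lincomb[OF u] by blast
  have "avg k b (\<lambda>x. h (x + u)) = (\<integral>\<^sup>+t. h (lincomb k b (vadd k t s)) * indicator (unit_cube k) t \<partial>Rd_lborel k)"
    unfolding avg_def s lincomb_vadd ..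
  also have "\<dots> = avg k b h" unfolding avg_def
    by (rule nn_integral_unit_cube_shift[where h = "\<lambda>t. h (lincomb k b t)"])
      (measurable, simp add: lincomb_vadd per lincomb_in_zspan)
  finally show ?thesis .
qed

text \<open>Average \<open>h (x + y)\<close> over both parallelepipeds and exchange the two integrals.\<close>
lemma avg_eq:
  assumes [measurable]: "h \<in> borel_measurable borel"
    and 1: "\<And>u. u \<in> span (b ` {..<k}) \<Longrightarrow> avg k' b' (\<lambda>x. h (x + u)) = avg k' b' h"
    and 2: "\<And>u. u \<in> span (b' ` {..<k'}) \<Longrightarrow> avg k b (\<lambda>x. h (x + u)) = avg k b h"
  shows "avg k b h = avg k' b' h"
proof -
  interpret P: pair_sigma_finite "Rd_lborel k" "Rd_lborel k'"
    unfolding pair_sigma_finite_def by (simp add: lborel_product.sigma_finite)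
  have "avg k b h = avg k' b' (\<lambda>_. avg k b h)" by (simp add: avg_const)
  also have "\<dots> = avg k' b' (\<lambda>u. avg k b (\<lambda>x. h (x + u)))" by (rule avg_cong) (simp add: 2)
  also have "\<dots> = (\<integral>\<^sup>+s. (\<integral>\<^sup>+t. h (lincomb k b t + lincomb k' b' s) * indicator (unit_cube k) t * indicator (unit_cube k') s \<partial>Rd_lborel k) \<partial>Rd_lborel k')"
    unfolding avg_def by (intro nn_integral_cong nn_integral_multc[symmetric]) measurable
  also have "\<dots> = (\<integral>\<^sup>+t. (\<integral>\<^sup>+s. h (lincomb k b t + lincomb k' b' s) * indicator (unit_cube k) t * indicator (unit_cube k') s \<partial>Rd_lborel k') \<partial>Rd_lborel k)"
    by (rule P.Fubini') measurable
  also have "\<dots> = (\<integral>\<^sup>+t. (\<integral>\<^sup>+s. h (lincomb k' b' s + lincomb k b t) * indicator (unit_cube k') s * indicator (unit_cube k) t \<partial>Rd_lborel k') \<partial>Rd_lborel k)"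
    by (intro nn_integral_cong) (simp add: add.commute mult_ac)
  also have "\<dots> = avg k b (\<lambda>u. avg k' b' (\<lambda>x. h (x + u)))"
    unfolding avg_def by (intro nn_integral_cong nn_integral_multc) measurable
  also have "\<dots> = avg k b (\<lambda>u. avg k' b' h)" by (rule avg_cong) (simp add: 1)
  finally show ?thesis by (simp add: avg_const)
qed

section \<open>Isotropic bodies\<close>

lemma continuous_map_lincomb:
  "continuous_map (Rd_top k) euclidean (lincomb k (b :: nat \<Rightarrow> 'a::euclidean_space))"
  unfolding lincomb_def
proof (rule continuous_map_sum)
  fix i assume "i \<in> {..<k}"
  hence "continuous_map (Rd_top k) euclideanreal (\<lambda>x. x i)" by (rule continuous_map_product_projection)
  moreover have "continuous_map euclideanreal euclidean (\<lambda>r. r *\<^sub>R b i)"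
    by (simp add: continuous_intros)
  ultimately have "continuous_map (Rd_top k) euclidean ((\<lambda>r. r *\<^sub>R b i) \<circ> (\<lambda>x. x i))"
    by (rule continuous_map_compose)
  thus "continuous_map (Rd_top k) euclidean (\<lambda>x. x i *\<^sub>R b i)" by (simp add: o_def)
qed simp

lemma topspace_Rd_top: "topspace (Rd_top k) = extensional {..<k}"
  by (simp add: PiE_def)

lemma compactin_Rd_bounded:
  assumes "compactin (Rd_top k) K"
  obtains R where "\<And>x i. x \<in> K \<Longrightarrow> i < k \<Longrightarrow> \<bar>x i\<bar> \<le> R" "R > 0"
proof -
  have "\<exists>R. \<forall>x\<in>K. \<bar>x i\<bar> \<le> R" if "i < k" for i
  proof -
    have "compactin euclideanreal ((\<lambda>x. x i) ` K)"
      by (rule image_compactin[OF assms continuous_map_product_projection]) (use that in auto)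
    hence "bounded ((\<lambda>x. x i) ` K)" by (simp add: compact_imp_bounded)
    thus ?thesis by (auto simp: bounded_iff)
  qed
  hence "\<forall>i. \<exists>R. i < k \<longrightarrow> (\<forall>x\<in>K. \<bar>x i\<bar> \<le> R)" by blast
  from choice[OF this] obtain R where R: "\<forall>i. i < k \<longrightarrow> (\<forall>x\<in>K. \<bar>x i\<bar> \<le> R i)" by blast
  show ?thesis
  proof (rule that[of "1 + (\<Sum>i<k. \<bar>R i\<bar>)"])
    fix x i assume xi: "x \<in> K" "i < k"
    have "\<bar>x i\<bar> \<le> \<bar>R i\<bar>" using R xi by fastforce
    also have "\<dots> \<le> (\<Sum>i<k. \<bar>R i\<bar>)" using xi by (intro member_le_sum) auto
    finally show "\<bar>x i\<bar> \<le> 1 + (\<Sum>i<k. \<bar>R i\<bar>)" by simp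
  qed (simp add: add_pos_nonneg sum_nonneg)
qed

lemma orthonormal_family_exists:
  assumes "d \<le> DIM('a::euclidean_space)"
  obtains e :: "nat \<Rightarrow> 'a::euclidean_space" where "\<And>i j. i < d \<Longrightarrow> j < d \<Longrightarrow> inner (e i) (e j) = (if i = j then 1 else 0)"
proof -
  obtain xs :: "'a list" where xs: "set xs = Basis" "distinct xs"
    using finite_distinct_list[OF finite_Basis] by blast
  hence l: "length xs = DIM('a)" using distinct_card by fastforce
  show ?thesis
  proof (rule that[of "(!) xs"])
    fix i j assume ij: "i < d" "j < d"
    hence "xs ! i \<in> Basis" "xs ! j \<in> Basis" using assms l xs(1) nth_mem by fastforce+
    thus "inner (xs ! i) (xs ! j) = (if i = j then 1 else 0)"
      using ij assms l xs(2) by (simp add: inner_Basis nth_eq_iff_index_eq)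
  qed
qed

lemma isotropic_body_facts:
  assumes K: "isotropic_body d K" and one: "measure (Rd_lborel d) K = 1"
  shows "K \<in> sets (Rd_lborel d)" "K \<subseteq> extensional {..<d}"
    "\<And>i j. i < d \<Longrightarrow> j < d \<Longrightarrow> integrable (Rd_lborel d) (\<lambda>x. indicator K x *\<^sub>R (x i * x j))"
proof -
  show Ks [measurable]: "K \<in> sets (Rd_lborel d)" using one measure_notin_sets by force
  have comp: "compactin (Rd_top d) K" using K by (simp add: isotropic_body_def convex_body_def)
  show "K \<subseteq> extensional {..<d}" using compactin_subset_topspace[OF comp] unfolding topspace_Rd_top .
  obtain R where R: "\<And>x i. x \<in> K \<Longrightarrow> i < d \<Longrightarrow> \<bar>x i\<bar> \<le> R" "R > 0"
    using compactin_Rd_bounded[OF comp] by blast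
  fix i j assume ij: "i < d" "j < d"
  have fin: "emeasure (Rd_lborel d) K < \<infinity>" using one
    by (metis infinity_ennreal_def less_top measure_eq_emeasure_eq_ennreal measure_def enn2real_top zero_neq_one)
  show "integrable (Rd_lborel d) (\<lambda>x. indicator K x *\<^sub>R (x i * x j))"
  proof (rule Bochner_Integration.integrable_bound[where f = "\<lambda>x. indicator K x *\<^sub>R (R * R)"])
    show "integrable (Rd_lborel d) (\<lambda>x. indicator K x *\<^sub>R (R * R))"
      using fin by (intro integrable_scaleR_left) (simp add: integrable_indicator_iff)
    show "(\<lambda>x. indicator K x *\<^sub>R (x i * x j)) \<in> borel_measurable (Rd_lborel d)"
      using ij measurable_coordinate by measurable
    show "AE x in Rd_lborel d. norm (indicator K x *\<^sub>R (x i * x j)) \<le> norm (indicator K x *\<^sub>R (R * R))"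
      using R ij by (intro AE_I2) (auto simp: abs_mult indicator_def intro!: mult_mono)
  qed
qed

text \<open>A point outside \<open>K\<close> is separated from \<open>K\<close> by a direction in which \<open>K\<close> is too narrow
  for its second moment.\<close>
lemma isotropic_body_contains_ball:
  assumes d: "d \<le> DIM('a::euclidean_space)"
    and K: "isotropic_body d K" and one: "measure (Rd_lborel d) K = 1"
    and al: "\<alpha> > 0" "\<And>i j. i < d \<Longrightarrow> j < d \<Longrightarrow> (LINT x:K|Rd_lborel d. x i * x j) = (if i = j then \<alpha> else 0)"
    and p: "p \<in> extensional {..<d}" "(\<Sum>i<d. (p i)\<^sup>2) \<le> \<alpha>"
  shows "p \<in> K"
proof (rule ccontr)
  assume pK: "p \<notin> K"
  \<comment> \<open>The function space carries no inner product, so \<open>K\<close> is carried into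
    \<open>'a\<close> by an orthonormal family, which exists because \<open>d \<le> DIM('a)\<close>;
    the separation theorem is used there.\<close>
  obtain e :: "nat \<Rightarrow> 'a" where e: "\<And>i j. i < d \<Longrightarrow> j < d \<Longrightarrow> inner (e i) (e j) = (if i = j then 1 else 0)"
    using orthonormal_family_exists[OF d] by blast
  let ?X = "lincomb d e"
  have comp: "compactin (Rd_top d) K" using K by (simp add: isotropic_body_def convex_body_def)
  note KS = isotropic_body_facts[OF K one]
  note [measurable] = KS(1)
  have Xi: "inner (e i) (?X x) = x i" if "i < d" for i x
  proof -
    have "inner (e i) (?X x) = (\<Sum>j<d. if j = i then x j else 0)"
      unfolding lincomb_def inner_sum_right using e that by (intro sum.cong) auto
    thus ?thesis using that by simp
  qed
  have inj: "x = y" if "?X x = ?X y" "x \<in> extensional {..<d}" "y \<in> extensional {..<d}" for x y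
    using that(2,3) Xi[of _ x] Xi[of _ y] that(1) by (intro extensionalityI[of _ "{..<d}"]) auto
  have "compactin euclidean (?X ` K)" by (rule image_compactin[OF comp continuous_map_lincomb])
  hence cl: "closed (?X ` K)" by (simp add: compact_imp_closed)
  have conv: "convex (?X ` K)"
    unfolding convex_alt
  proof (intro ballI allI impI)
    fix x y and u :: real assume "x \<in> ?X ` K" "y \<in> ?X ` K" and u: "0 \<le> u \<and> u \<le> 1"
    then obtain a b where ab: "a \<in> K" "b \<in> K" "x = ?X a" "y = ?X b" by auto
    have mem: "(\<lambda>i\<in>{..<d}. (1 - u) * a i + u * b i) \<in> K"
      using K ab u by (auto simp: isotropic_body_def convex_body_def)
    have eq: "?X (\<lambda>i\<in>{..<d}. (1 - u) * a i + u * b i) = (1 - u) *\<^sub>R x + u *\<^sub>R y"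
      unfolding ab(3,4) by (simp add: lincomb_def scaleR_left_distrib sum.distrib scaleR_sum_right)
    show "(1 - u) *\<^sub>R x + u *\<^sub>R y \<in> ?X ` K" unfolding eq[symmetric] by (rule imageI[OF mem])
  qed
  have "?X p \<notin> ?X ` K" using pK inj p(1) KS(2) by blast
  then obtain a b where sep: "inner a (?X p) < b" "\<And>x. x \<in> ?X ` K \<Longrightarrow> inner a x > b"
    using separating_hyperplane_closed_point[OF conv cl] by blast
  define \<theta> where "\<theta> = (\<lambda>i. inner a (e i))"
  have aX: "inner a (?X x) = (\<Sum>i<d. x i * \<theta> i)" for x by (simp add: lincomb_def inner_sum_right \<theta>_def)
  \<comment> \<open>Symmetry puts both \<open>x\<close> and its negative beyond the separating
    hyperplane, so the absolute value of \<open>b\<close> bounds the width of \<open>K\<close> in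
    this direction.\<close>
  have le: "(\<Sum>i<d. x i * \<theta> i)\<^sup>2 \<le> b\<^sup>2" if "x \<in> K" for x
  proof -
    have 1: "(\<Sum>i<d. x i * \<theta> i) > b" using sep(2) that unfolding aX[symmetric] by blast
    have "(\<lambda>i\<in>{..<d}. - x i) \<in> K" using K that by (auto simp: isotropic_body_def symmetric_body_def)
    hence "b < inner a (?X (\<lambda>i\<in>{..<d}. - x i))" using sep(2) by blast
    hence "- (\<Sum>i<d. x i * \<theta> i) > b" unfolding aX by (simp add: sum_negf)
    hence "\<bar>\<Sum>i<d. x i * \<theta> i\<bar> \<le> \<bar>b\<bar>" using 1 by linarith
    thus ?thesis by (simp add: abs_le_square_iff)
  qed
  have "K \<noteq> {}" using one by auto
  then obtain x0 where x0: "x0 \<in> K" by blast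
  have b0: "b < 0"
  proof -
    have 1: "(\<Sum>i<d. x0 i * \<theta> i) > b" using sep(2) x0 unfolding aX[symmetric] by blast
    have "(\<lambda>i\<in>{..<d}. - x0 i) \<in> K" using K x0 by (auto simp: isotropic_body_def symmetric_body_def)
    hence "b < inner a (?X (\<lambda>i\<in>{..<d}. - x0 i))" using sep(2) by blast
    hence "- (\<Sum>i<d. x0 i * \<theta> i) > b" unfolding aX by (simp add: sum_negf)
    thus ?thesis using 1 by linarith
  qed
  \<comment> \<open>By isotropy the second moment in direction \<open>\<theta>\<close> is
    \<open>\<alpha>\<close> times the squared length of \<open>\<theta>\<close>. It is at most the
    square of \<open>b\<close>, which is strictly below the square of the value at \<open>p\<close>;
    by Cauchy-Schwarz the latter is at most the same quantity, a contradiction.\<close>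
  have sq: "(\<Sum>i<d. x i * \<theta> i)\<^sup>2 = (\<Sum>i<d. \<Sum>j<d. (\<theta> i * \<theta> j) * (x i * x j))" for x
    by (simp add: power2_eq_square sum_product mult_ac)
  have int2: "integrable (Rd_lborel d) (\<lambda>x. (\<theta> i * \<theta> j) * (indicator K x * (x i * x j)))" if "i < d" "j < d" for i j
    using KS(3)[OF that] by simp
  have dist: "indicator K x * (\<Sum>i<d. x i * \<theta> i)\<^sup>2 = (\<Sum>i<d. \<Sum>j<d. (\<theta> i * \<theta> j) * (indicator K x * (x i * x j)))" for x
    unfolding sq sum_distrib_left by (simp add: mult_ac)
  have intsq: "integrable (Rd_lborel d) (\<lambda>x. indicator K x * (\<Sum>i<d. x i * \<theta> i)\<^sup>2)"
    unfolding dist using int2 by (intro Bochner_Integration.integrable_sum) auto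
  have "(LINT x|Rd_lborel d. indicator K x * (\<Sum>i<d. x i * \<theta> i)\<^sup>2) =
      (\<Sum>i<d. \<Sum>j<d. (\<theta> i * \<theta> j) * (LINT x|Rd_lborel d. indicator K x * (x i * x j)))"
    unfolding dist using int2
    by (subst Bochner_Integration.integral_sum, force intro!: Bochner_Integration.integrable_sum)
      (intro sum.cong refl, subst Bochner_Integration.integral_sum, auto)
  also have "\<dots> = (\<Sum>i<d. \<Sum>j<d. if j = i then \<theta> i * \<theta> j * \<alpha> else 0)"
    using al(2) by (intro sum.cong refl) (auto simp: set_lebesgue_integral_def)
  also have "\<dots> = \<alpha> * (\<Sum>i<d. (\<theta> i)\<^sup>2)" by (simp add: sum_distrib_left power2_eq_square mult_ac)
  finally have eq: "(LINT x|Rd_lborel d. indicator K x * (\<Sum>i<d. x i * \<theta> i)\<^sup>2) = \<alpha> * (\<Sum>i<d. (\<theta> i)\<^sup>2)" .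
  have fin: "emeasure (Rd_lborel d) K \<noteq> \<infinity>" using one by (auto simp: measure_def)
  have "(LINT x|Rd_lborel d. indicator K x * (\<Sum>i<d. x i * \<theta> i)\<^sup>2) \<le> (LINT x|Rd_lborel d. indicator K x * b\<^sup>2)"
  proof (rule integral_mono[OF intsq])
    show "integrable (Rd_lborel d) (\<lambda>x. indicator K x * b\<^sup>2)"
      using fin by (intro integrable_mult_left) (simp add: integrable_indicator_iff less_top)
    show "indicator K x * (\<Sum>i<d. x i * \<theta> i)\<^sup>2 \<le> indicator K x * b\<^sup>2" for x
      using le by (auto simp: indicator_def)
  qed
  also have "\<dots> = b\<^sup>2" using one KS(1) by simp
  also have "b\<^sup>2 < (\<Sum>i<d. p i * \<theta> i)\<^sup>2"
  proof -
    have "(- b)\<^sup>2 < (- (\<Sum>i<d. p i * \<theta> i))\<^sup>2"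
      using sep(1) b0 unfolding aX by (intro power_strict_mono) auto
    thus ?thesis by simp
  qed
  also have "\<dots> \<le> (\<Sum>i<d. (p i)\<^sup>2) * (\<Sum>i<d. (\<theta> i)\<^sup>2)" by (rule Cauchy_Schwarz_ineq_sum)
  also have "\<dots> \<le> \<alpha> * (\<Sum>i<d. (\<theta> i)\<^sup>2)" using p(2) by (intro mult_right_mono sum_nonneg) auto
  finally show False using eq by simp
qed

lemma isotropic_moment_eq:
  assumes K: "isotropic_body d K" and one: "measure (Rd_lborel d) K = 1"
    and al: "\<And>i. i < d \<Longrightarrow> (LINT x:K|Rd_lborel d. x i * x i) = \<alpha>"
  shows "(LINT x:K|Rd_lborel d. (L2_set x {..<d})\<^sup>2) = real d * \<alpha>"
proof -
  have "(LINT x:K|Rd_lborel d. (L2_set x {..<d})\<^sup>2) = (LINT x|Rd_lborel d. (\<Sum>i<d. indicator K x *\<^sub>R (x i * x i)))"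
    unfolding set_lebesgue_integral_def
    by (intro Bochner_Integration.integral_cong)
      (auto simp: L2_set_def sum_nonneg sum_distrib_left power2_eq_square)
  also have "\<dots> = (\<Sum>i<d. LINT x:K|Rd_lborel d. x i * x i)"
    unfolding set_lebesgue_integral_def
    using isotropic_body_facts(3)[OF K one] by (intro Bochner_Integration.integral_sum) auto
  finally show ?thesis using al by simp
qed

text \<open>Required before any body can be compared with the supremum in
  \<open>isotropic_constant\<close>. A ball of radius \<open>sqrt \<alpha>\<close> fits into a body
  of volume one, and this bounds \<open>\<alpha>\<close>.\<close>

lemma isotropic_moment_bounded:
  assumes d: "0 < d" "d \<le> DIM('a::euclidean_space)"
  shows "bdd_above ((\<lambda>K. LINT x:K|Rd_lborel d. (L2_set x {..<d})\<^sup>2) `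
    {K. isotropic_body d K \<and> measure (Rd_lborel d) K = 1})"
proof (rule bdd_aboveI2)
  fix K assume "K \<in> {K. isotropic_body d K \<and> measure (Rd_lborel d) K = 1}"
  hence K: "isotropic_body d K" and one: "measure (Rd_lborel d) K = 1" by auto
  note KS = isotropic_body_facts[OF K one]
  obtain \<alpha> where al: "\<alpha> > 0"
    "\<And>i j. i < d \<Longrightarrow> j < d \<Longrightarrow> (LINT x:K|Rd_lborel d. x i * x j) = (if i = j then \<alpha> else 0)"
    using K unfolding isotropic_body_def by blast
  let ?u = "unit_ball_vol (real d)"
  have u: "?u > 0" by (simp add: unit_ball_vol_pos)
  define C where "C = {x. sqrt (\<Sum>i<d. (x i)\<^sup>2) \<le> sqrt \<alpha>} \<inter> space (Rd_lborel d)"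
  have "C \<subseteq> K"
  proof
    fix x assume "x \<in> C"
    thus "x \<in> K" using isotropic_body_contains_ball[OF d(2) K one al, of x] by (simp add: C_def space_Rd)
  qed
  have fin: "emeasure (Rd_lborel d) K \<noteq> \<infinity>" using one by (auto simp: measure_def)
  have "ennreal (?u * sqrt \<alpha> ^ d) = emeasure (Rd_lborel d) C"
    using emeasure_cball_aux[of "{..<d}" "sqrt \<alpha>"] al(1) by (simp add: C_def)
  also have "\<dots> \<le> emeasure (Rd_lborel d) K" by (rule emeasure_mono[OF \<open>C \<subseteq> K\<close> KS(1)])
  also have "\<dots> = ennreal 1" using fin one by (simp add: emeasure_eq_ennreal_measure)
  finally have le: "?u * sqrt \<alpha> ^ d \<le> 1" by (subst (asm) ennreal_le_iff) auto
  \<comment> \<open>Above 1, \<open>sqrt \<alpha>\<close> is at most its power \<open>d\<close>,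
    which the volume bounds; the summand 1 covers the other case.\<close>
  have "sqrt \<alpha> \<le> 1 + 1 / ?u"
  proof (cases "sqrt \<alpha> \<le> 1")
    case True thus ?thesis using u by (simp add: add_increasing2)
  next
    case False
    hence "sqrt \<alpha> ^ 1 \<le> sqrt \<alpha> ^ d" using d by (intro power_increasing) auto
    also have "\<dots> \<le> 1 / ?u" using le u by (simp add: field_simps)
    finally show ?thesis by simp
  qed
  hence al2: "\<alpha> \<le> (1 + 1 / ?u)\<^sup>2" using al(1) by (simp add: real_le_lsqrt sqrt_le_D)
  have "(LINT x:K|Rd_lborel d. (L2_set x {..<d})\<^sup>2) = real d * \<alpha>"
    using al(2) by (intro isotropic_moment_eq[OF K one]) simp
  also have "\<dots> \<le> real d * (1 + 1 / ?u)\<^sup>2" using al2 by (simp add: mult_left_mono)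
  finally show "(LINT x:K|Rd_lborel d. (L2_set x {..<d})\<^sup>2) \<le> real d * (1 + 1 / ?u)\<^sup>2" .
qed

text \<open>The witness that lets \<open>isotropic_constant_nonneg\<close> be drawn from
  \<open>isotropic_moment_le\<close>, which speaks about a given body.\<close>

lemma isotropic_interval:
  fixes K :: "(nat \<Rightarrow> real) set"
  defines "K \<equiv> PiE {..<1} (\<lambda>_. {-1/2..1/2})"
  shows "isotropic_body 1 K" "measure (Rd_lborel 1) K = 1"
proof -
  have set1: "{..<1::nat} = {0}" by auto
  show "measure (Rd_lborel 1) K = 1"
    unfolding K_def measure_def by (subst lborel_product.emeasure_PiM) auto
  have "(LINT x:K|Rd_lborel 1. x 0 * x 0) = (LINT x|Rd_lborel 1. (x 0)\<^sup>2 * indicator {-1/2..1/2} (x 0))"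
    unfolding set_lebesgue_integral_def
    by (intro Bochner_Integration.integral_cong refl)
      (auto simp: K_def space_Rd PiE_iff power2_eq_square split: split_indicator)
  also have "\<dots> = (LINT x|Pi\<^sub>M {0::nat} (\<lambda>_. lborel). (x 0)\<^sup>2 * indicator {-1/2..1/2::real} (x 0))"
    unfolding set1 ..
  also have "\<dots> = (LINT y|lborel. y\<^sup>2 * indicator {-1/2..1/2} y)"
    by (rule lborel_product.product_integral_singleton) measurable
  also have "\<dots> = 1 / 12" using integral_power[of "-1/2" "1/2" 2] by (simp add: power3_eq_cube)
  finally have mom: "(LINT x:K|Rd_lborel 1. x 0 * x 0) = 1 / 12" .
  have comp: "compactin (Rd_top 1) K" unfolding K_def by (simp add: compactin_PiE)
  have int: "Rd_top 1 interior_of K \<noteq> {}"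
  proof -
    have "openin (Rd_top 1) (PiE {..<1} (\<lambda>_. {-1/2<..<1/2}))" by (simp add: openin_PiE_gen)
    moreover have "PiE {..<1::nat} (\<lambda>_. {-1/2<..<1/2}) \<subseteq> K" unfolding K_def by (intro PiE_mono) auto
    ultimately have "PiE {..<1} (\<lambda>_. {-1/2<..<1/2}) \<subseteq> Rd_top 1 interior_of K" by (intro interior_of_maximal)
    moreover have "(\<lambda>i\<in>{..<1::nat}. 0::real) \<in> PiE {..<1} (\<lambda>_. {-1/2<..<1/2})" by auto
    ultimately show ?thesis by blast
  qed
  have K_iff: "x \<in> K \<longleftrightarrow> x \<in> extensional {..<1} \<and> x 0 \<in> {-1/2..1/2}" for x
    unfolding K_def PiE_iff set1 by (simp add: conj_commute)
  have conv: "(\<lambda>i\<in>{..<1}. (1 - t) * x i + t * y i) \<in> K" if "x \<in> K" "y \<in> K" "t \<in> {0..1}" for x y t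
  proof -
    have "(1 - t) *\<^sub>R x 0 + t *\<^sub>R y 0 \<in> {-1/2..1/2}"
      using that unfolding K_iff by (intro convexD_alt convex_real_interval) auto
    thus ?thesis unfolding K_iff by simp
  qed
  have neg: "(\<lambda>i\<in>{..<1}. - x i) \<in> K" if "x \<in> K" for x using that unfolding K_iff by simp
  have "(\<lambda>x. \<lambda>i\<in>{..<1}. - x i) ` K = K"
  proof
    show "(\<lambda>x. \<lambda>i\<in>{..<1}. - x i) ` K \<subseteq> K" using neg by blast
    show "K \<subseteq> (\<lambda>x. \<lambda>i\<in>{..<1}. - x i) ` K"
    proof
      fix x assume x: "x \<in> K"
      have "x = (\<lambda>i\<in>{..<1}. - (\<lambda>i\<in>{..<1}. - x i) i)"
        using x unfolding K_iff by (simp add: extensional_def fun_eq_iff)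
      thus "x \<in> (\<lambda>x. \<lambda>i\<in>{..<1}. - x i) ` K" using neg[OF x] by (rule image_eqI)
    qed
  qed
  thus "isotropic_body 1 K"
    unfolding isotropic_body_def convex_body_def symmetric_body_def
    using comp int conv mom by (intro conjI exI[of _ "1/12"]) auto
qed

lemma isotropic_moment_le:
  assumes d: "0 < d" "d \<le> DIM('a::euclidean_space)"
    and K: "isotropic_body d K" and one: "measure (Rd_lborel d) K = 1"
  shows "(LINT x:K|Rd_lborel d. (L2_set x {..<d})\<^sup>2) \<le> real d * (isotropic_constant DIM('a))\<^sup>2"
    "0 \<le> isotropic_constant DIM('a)"
proof -
  let ?v = "\<lambda>d K. LINT x:K|Rd_lborel d. (L2_set x {..<d})\<^sup>2"
  let ?S = "\<lambda>d. SUP K \<in> {K. isotropic_body d K \<and> measure (Rd_lborel d) K = 1}. ?v d K"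
  let ?M = "MAX d\<in>{1..DIM('a)}. 1 / real d * ?S d"
  have v0: "0 \<le> ?v d K" unfolding set_lebesgue_integral_def by (intro integral_nonneg_AE) auto
  have vS: "?v d K \<le> ?S d" using K one by (intro cSUP_upper isotropic_moment_bounded[OF d]) auto
  have "1 / real d * ?S d \<le> ?M" using d by (intro Max_ge) auto
  hence 1: "1 / real d * ?v d K \<le> ?M" using mult_left_mono[OF vS, of "1 / real d"] by simp
  moreover have "0 \<le> 1 / real d * ?v d K" using v0 by simp
  ultimately have M: "0 \<le> ?M" by linarith
  thus "0 \<le> isotropic_constant DIM('a)" unfolding isotropic_constant_def by simp
  have "(isotropic_constant DIM('a))\<^sup>2 = ?M" using M unfolding isotropic_constant_def by simp
  thus "?v d K \<le> real d * (isotropic_constant DIM('a))\<^sup>2" using 1 d by (simp add: field_simps)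
qed

lemma isotropic_constant_nonneg: "0 \<le> isotropic_constant DIM('a::euclidean_space)"
  by (rule isotropic_moment_le(2)[OF _ _ isotropic_interval]) (simp_all add: Suc_le_eq)

text \<open>\<open>X\<close> is the orthogonal sum of \<open>W\<close> and its own
  projection.\<close>

lemma qproj_image_dim:
  assumes W: "subspace W" and X: "subspace X" and WX: "W \<subseteq> X"
  shows "dim (qproj W ` X) + dim W = dim X"
proof -
  have sub: "qproj W ` X \<subseteq> X"
  proof
    fix u assume "u \<in> qproj W ` X"
    then obtain x where "x \<in> X" "u = qproj W x" by auto
    thus "u \<in> X" using subspace_diff[OF X, of x "x - qproj W x"] qproj_diff[OF W] WX by auto
  qed
  have "span (qproj W ` X \<union> W) = X"
  proof
    show "span (qproj W ` X \<union> W) \<subseteq> X" using sub WX X by (intro span_minimal) auto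
    show "X \<subseteq> span (qproj W ` X \<union> W)"
    proof
      fix x assume "x \<in> X"
      hence "qproj W x + (x - qproj W x) \<in> span (qproj W ` X \<union> W)"
        using qproj_diff[OF W, of x] by (intro span_add span_base) auto
      thus "x \<in> span (qproj W ` X \<union> W)" by simp
    qed
  qed
  moreover have "dim (qproj W ` X \<union> W) = dim (qproj W ` X) + dim W"
    by (rule dim_orthogonal_sum) (use inner_qproj[OF W] in auto)
  ultimately show ?thesis by (metis dim_span)
qed

section \<open>The second moment of a lattice\<close>

text \<open>\<open>T\<close> deforms the point and the lattice together, while the argument stays
  undeformed. For singular \<open>T\<close> the image of \<open>N\<close> need not be discrete, so
  the infimum may fail to be attained.\<close>

definition dist_sq :: "'a::euclidean_space set \<Rightarrow> ('a \<Rightarrow> 'a) \<Rightarrow> 'a \<Rightarrow> real" where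
  "dist_sq N T x = (infdist (T x) (T ` N))\<^sup>2"

text \<open>The squared Hilbert-Schmidt norm, taken on the whole space and not only on the span of
  the lattice.\<close>

definition hs_norm_sq :: "('a::euclidean_space \<Rightarrow> 'a) \<Rightarrow> real" where
  "hs_norm_sq T = (\<Sum>i\<in>Basis. (norm (T i))\<^sup>2)"

lemma hs_norm_sq_nonneg: "hs_norm_sq T \<ge> 0"
  by (simp add: hs_norm_sq_def sum_nonneg)

lemma norm_le_hs:
  assumes "linear T" shows "(norm (T x))\<^sup>2 \<le> hs_norm_sq T * (norm x)\<^sup>2"
proof -
  have "T x = T (\<Sum>i\<in>Basis. inner x i *\<^sub>R i)" by (simp add: euclidean_representation)
  also have "\<dots> = (\<Sum>i\<in>Basis. inner x i *\<^sub>R T i)" using assms by (simp add: linear_sum linear_scale)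
  finally have "norm (T x) \<le> (\<Sum>i\<in>Basis. \<bar>inner x i\<bar> * norm (T i))"
    by (simp add: sum_norm_le)
  hence "(norm (T x))\<^sup>2 \<le> (\<Sum>i\<in>Basis. \<bar>inner x i\<bar> * norm (T i))\<^sup>2" by (intro power_mono) auto
  also have "\<dots> \<le> (\<Sum>i\<in>Basis. \<bar>inner x i\<bar>\<^sup>2) * (\<Sum>i\<in>Basis. (norm (T i))\<^sup>2)"
    by (rule Cauchy_Schwarz_ineq_sum)
  also have "(\<Sum>i\<in>Basis. \<bar>inner x i\<bar>\<^sup>2) = (norm x)\<^sup>2"
    unfolding power2_norm_eq_inner by (subst euclidean_inner) (simp add: power2_eq_square)
  finally show ?thesis by (simp add: hs_norm_sq_def mult.commute)
qed

lemma infdist_greatest: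
  assumes "S \<noteq> {}" "\<And>s. s \<in> S \<Longrightarrow> c \<le> dist x s" shows "c \<le> infdist x S"
  using assms by (auto simp: infdist_def intro!: cINF_greatest)

lemma infdist_linear_image_greatest:
  assumes "linear T" "0 \<in> N" "\<And>z. z \<in> N \<Longrightarrow> c \<le> norm (T (x - z))"
  shows "c \<le> infdist (T x) (T ` N)"
  using assms by (intro infdist_greatest) (auto simp: dist_norm linear_diff)

lemma infdist_linear_image_le:
  "linear T \<Longrightarrow> z \<in> N \<Longrightarrow> infdist (T x) (T ` N) \<le> norm (T (x - z))"
  using infdist_le[of "T z" "T ` N" "T x"] by (simp add: dist_norm linear_diff)

lemma linear_borel_measurable:
  fixes T :: "'a::euclidean_space \<Rightarrow> 'a"
  shows "linear T \<Longrightarrow> T \<in> borel_measurable borel"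
  using linear_continuous_on[of T UNIV] by (intro borel_measurable_continuous_onI) (simp add: linear_linear)

lemma dist_sq_measurable:
  fixes T :: "'a::euclidean_space \<Rightarrow> 'a"
  assumes "linear T" shows "dist_sq N T \<in> borel_measurable borel"
proof -
  have "continuous_on UNIV (\<lambda>x. infdist (T x) (T ` N))"
    using assms by (intro continuous_on_infdist linear_continuous_on) (simp add: linear_linear)
  hence "(\<lambda>x. infdist (T x) (T ` N)) \<in> borel_measurable borel" by (rule borel_measurable_continuous_onI)
  thus ?thesis unfolding dist_sq_def by measurable
qed

lemma dist_sq_periodic:
  assumes T: "linear T" and N: "discrete_subgroup N" and z: "T w \<in> T ` N"
  shows "dist_sq N T (x + w) = dist_sq N T x"
proof -
  have le: "infdist (T (x + u)) (T ` N) \<le> infdist (T x) (T ` N)" if u: "T u \<in> T ` N" for x u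
  proof (rule infdist_linear_image_greatest[OF T discrete_subgroupD(1)[OF N]])
    fix y assume y: "y \<in> N"
    obtain z where z: "z \<in> N" "T u = T z" using u by auto
    have "infdist (T (x + u)) (T ` N) \<le> norm (T (x + u - (y + z)))"
      by (rule infdist_linear_image_le[OF T discrete_subgroupD(5)[OF N y z(1)]])
    also have "T (x + u - (y + z)) = T (x - y)" using z T by (simp add: linear_diff linear_add)
    finally show "infdist (T (x + u)) (T ` N) \<le> norm (T (x - y))" .
  qed
  have "T (- w) \<in> T ` N" using z discrete_subgroupD(4)[OF N] T by (auto simp: linear_neg) (metis image_eqI linear_neg)
  hence "infdist (T (x + w + (- w))) (T ` N) \<le> infdist (T (x + w)) (T ` N)" by (rule le)
  thus ?thesis using le[OF z, of x] by (simp add: dist_sq_def)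
qed

lemma lattice_cover_bound:
  fixes b :: "nat \<Rightarrow> 'a::euclidean_space"
  obtains R where "R > 0" "\<And>x. x \<in> span (b ` {..<k}) \<Longrightarrow> \<exists>z\<in>zspan k b. norm (x - z) \<le> R"
proof (rule that[of "1 + (\<Sum>i<k. norm (b i))"])
  show "1 + (\<Sum>i<k. norm (b i)) > 0" by (simp add: add_pos_nonneg sum_nonneg)
  fix x assume "x \<in> span (b ` {..<k})"
  then obtain t where t: "x = (\<Sum>i<k. t i *\<^sub>R b i)" unfolding span_family_iff by blast
  define z where "z = (\<Sum>i<k. of_int \<lfloor>t i\<rfloor> *\<^sub>R b i)"
  have "x - z = (\<Sum>i<k. frac (t i) *\<^sub>R b i)"
    unfolding t z_def frac_def by (simp add: sum_subtractf scaleR_left_diff_distrib)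
  also have "norm \<dots> \<le> (\<Sum>i<k. norm (b i))"
    by (intro sum_norm_le) (simp add: mult_left_le_one_le frac_ge_0 less_imp_le[OF frac_lt_1])
  finally show "\<exists>z\<in>zspan k b. norm (x - z) \<le> 1 + (\<Sum>i<k. norm (b i))"
    by (intro bexI[of _ z]) (auto simp: z_def zspanI)
qed

text \<open>The function F of the overview. Values in \<open>ennreal\<close> let Tonelli and Fatou
  apply without integrability conditions.\<close>

definition second_moment :: "nat \<Rightarrow> (nat \<Rightarrow> 'a::euclidean_space) \<Rightarrow> ('a \<Rightarrow> 'a) \<Rightarrow> ennreal" where
  "second_moment k b T = avg k b (\<lambda>x. ennreal (dist_sq (zspan k b) T x))"

text \<open>Some lattice point lies within a fixed distance of \<open>x\<close>, and
  \<open>T\<close> stretches that distance by at most its Hilbert-Schmidt norm. The averaged bound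
  makes the supremum over unit \<open>T\<close> finite; the pointwise one bounds difference
  quotients from below.\<close>

lemma second_moment_bounded:
  fixes b :: "nat \<Rightarrow> 'a::euclidean_space"
  obtains R where "R \<ge> 0" "\<And>T. linear T \<Longrightarrow> second_moment k b T \<le> ennreal (R * hs_norm_sq T)"
    "\<And>T x. linear T \<Longrightarrow> x \<in> span (b ` {..<k}) \<Longrightarrow> dist_sq (zspan k b) T x \<le> R * hs_norm_sq T"
proof -
  obtain R where R: "R > 0" "\<And>x. x \<in> span (b ` {..<k}) \<Longrightarrow> \<exists>z\<in>zspan k b. norm (x - z) \<le> R"
    using lattice_cover_bound[of b k] by blast
  have *: "dist_sq (zspan k b) T x \<le> R\<^sup>2 * hs_norm_sq T" if T: "linear T" and x: "x \<in> span (b ` {..<k})" for T x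
  proof -
    obtain z where z: "z \<in> zspan k b" "norm (x - z) \<le> R" using R(2)[OF x] by blast
    have "dist_sq (zspan k b) T x \<le> (norm (T (x - z)))\<^sup>2"
      unfolding dist_sq_def using infdist_linear_image_le[OF T z(1)] by (intro power_mono infdist_nonneg)
    also have "\<dots> \<le> hs_norm_sq T * (norm (x - z))\<^sup>2" by (rule norm_le_hs[OF T])
    also have "\<dots> \<le> hs_norm_sq T * R\<^sup>2" using z R by (intro mult_left_mono power_mono hs_norm_sq_nonneg) auto
    finally show ?thesis by (simp add: mult.commute)
  qed
  show ?thesis
  proof (rule that[of "R\<^sup>2"])
    fix T :: "'a \<Rightarrow> 'a" assume "linear T"
    hence "second_moment k b T \<le> avg k b (\<lambda>_. ennreal (R\<^sup>2 * hs_norm_sq T))"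
      unfolding second_moment_def using * by (intro avg_mono ennreal_leI)
    thus "second_moment k b T \<le> ennreal (R\<^sup>2 * hs_norm_sq T)" by (simp add: avg_const)
  qed (use * in auto)
qed

text \<open>For a deep hole \<open>x\<close> and any \<open>y\<close>, one of \<open>y\<close> and \<open>y - x\<close> is at distance at least half of
  the covering radius from the lattice.\<close>
lemma infdist_sq_le_second_moment:
  assumes ind: "indep_family k b" and x: "x \<in> span (b ` {..<k})"
  shows "ennreal ((infdist x (zspan k b))\<^sup>2) \<le> 4 * second_moment k b (\<lambda>x. x)"
proof -
  let ?N = "zspan k b" and ?D = "dist_sq (zspan k b) (\<lambda>x. x)"
  have N: "discrete_subgroup ?N" by (rule discrete_zspan[OF ind])
  have [measurable]: "?D \<in> borel_measurable borel" by (rule dist_sq_measurable) (simp add: linear_ident)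
  have D: "?D x = (infdist x ?N)\<^sup>2" for x by (simp add: dist_sq_def)
  have le: "(infdist x ?N)\<^sup>2 / 2 \<le> ?D y + ?D (y + (- x))" for y
  proof -
    obtain z1 where z1: "z1 \<in> ?N" "infdist y ?N = norm (y - z1)" by (rule infdist_attained[OF N])
    obtain z2 where z2: "z2 \<in> ?N" "infdist (y + (- x)) ?N = norm (y + (- x) - z2)" by (rule infdist_attained[OF N])
    have "infdist x ?N \<le> norm (x - (z1 - z2))"
      using infdist_le[OF discrete_subgroupD(2)[OF N z1(1) z2(1)], of x] by (simp add: dist_norm)
    also have "x - (z1 - z2) = (y - z1) - (y + (- x) - z2)" by simp
    also have "norm \<dots> \<le> infdist y ?N + infdist (y + (- x)) ?N"
      unfolding z1(2) z2(2) by (rule norm_triangle_ineq4)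
    finally have "(infdist x ?N)\<^sup>2 \<le> (infdist y ?N + infdist (y + (- x)) ?N)\<^sup>2" by (intro power_mono infdist_nonneg)
    also have "\<dots> \<le> 2 * ((infdist y ?N)\<^sup>2 + (infdist (y + (- x)) ?N)\<^sup>2)"
      using zero_le_power2[of "infdist y ?N - infdist (y + (- x)) ?N"] by (simp add: power2_eq_square algebra_simps)
    finally show ?thesis by (simp add: D)
  qed
  \<comment> \<open>Both distances have the same mean by translation invariance, so half of the
    squared distance is at most twice the second moment. This is the origin of the 4.\<close>
  have "ennreal ((infdist x ?N)\<^sup>2 / 2) = avg k b (\<lambda>_. ennreal ((infdist x ?N)\<^sup>2 / 2))" by (simp add: avg_const)
  also have "\<dots> \<le> avg k b (\<lambda>y. ennreal (?D y) + ennreal (?D (y + (- x))))"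
    using le by (intro avg_mono) (simp add: ennreal_plus[symmetric] D del: ennreal_plus)
  also have "\<dots> = avg k b (\<lambda>y. ennreal (?D y)) + avg k b (\<lambda>y. ennreal (?D (y + (- x))))"
    by (rule avg_add) measurable
  also have "avg k b (\<lambda>y. ennreal (?D (y + (- x)))) = avg k b (\<lambda>y. ennreal (?D y))"
    using x by (intro avg_shift[where h = "\<lambda>y. ennreal (?D y)"])
      (measurable, auto simp: dist_sq_periodic[OF _ N] linear_ident intro: span_neg)
  finally have "ennreal ((infdist x ?N)\<^sup>2 / 2) \<le> 2 * second_moment k b (\<lambda>x. x)"
    by (simp add: second_moment_def mult_2)
  hence "2 * ennreal ((infdist x ?N)\<^sup>2 / 2) \<le> 2 * (2 * second_moment k b (\<lambda>x. x))" by (rule mult_left_mono) simp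
  moreover have "2 * ennreal ((infdist x ?N)\<^sup>2 / 2) = ennreal ((infdist x ?N)\<^sup>2)"
    by (subst ennreal_numeral[symmetric], subst ennreal_mult[symmetric]) auto
  ultimately show ?thesis by (simp add: mult.assoc[symmetric])
qed

text \<open>Approximate in the projection orthogonal to \<open>T v\<close>, then move along
  \<open>v\<close> by integers. Rounding leaves at most half of \<open>T v\<close>, and Pythagoras
  turns this into a quarter of its square.\<close>

lemma dist_sq_quotient_le:
  assumes T: "linear T" and N: "discrete_subgroup N" and v: "v \<in> N"
  shows "dist_sq N T x \<le> dist_sq N (\<lambda>y. qproj (span {T v}) (T y)) x + (norm (T v))\<^sup>2 / 4"
proof -
  let ?P = "qproj (span {T v})"
  let ?T = "\<lambda>y. ?P (T y)"
  have lin: "linear ?T" using linear_compose[OF T linear_qproj[OF subspace_span]] by (simp add: o_def)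
  have 1: "dist_sq N T x \<le> (norm (?T (x - z)))\<^sup>2 + (norm (T v))\<^sup>2 / 4" if z: "z \<in> N" for z
  proof -
    define w where "w = T (x - z)"
    obtain a where a: "w - ?P w = a *\<^sub>R T v" using qproj_diff[OF subspace_span, of w "{T v}"] by (auto simp: span_singleton)
    define m where "m = round a"
    have mem: "z + of_int m *\<^sub>R v \<in> N"
      by (intro discrete_subgroupD(5)[OF N] z subgroup_int_scale discrete_subgroupD(1)[OF N] v discrete_subgroupD(2)[OF N])
    have eq: "T (x - (z + of_int m *\<^sub>R v)) = ?P w + (a - of_int m) *\<^sub>R T v"
      using a T by (simp add: w_def linear_diff linear_add linear_scale algebra_simps)
    have "inner (?P w) (T v) = 0" by (rule inner_qproj) (auto intro: span_base)
    hence orth: "inner (?P w) ((a - of_int m) *\<^sub>R T v) = 0"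
      by simp
    have "dist_sq N T x \<le> (norm (T (x - (z + of_int m *\<^sub>R v))))\<^sup>2"
      unfolding dist_sq_def using infdist_linear_image_le[OF T mem] by (intro power_mono infdist_nonneg)
    also have "\<dots> = (norm (?P w))\<^sup>2 + (norm ((a - of_int m) *\<^sub>R T v))\<^sup>2"
      unfolding eq by (rule norm_add_Pythagorean) (simp only: real_inner_class.orthogonal_def orth)
    also have "(norm ((a - of_int m) *\<^sub>R T v))\<^sup>2 \<le> (1/2 * norm (T v))\<^sup>2"
      using of_int_round_abs_le[of a] unfolding norm_scaleR m_def
      by (intro power_mono mult_right_mono) (auto simp: abs_minus_commute)
    finally show ?thesis by (simp add: w_def power2_eq_square)
  qed
  show ?thesis
  proof (cases "dist_sq N T x \<le> (norm (T v))\<^sup>2 / 4")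
    case True
    thus ?thesis by (simp add: dist_sq_def add_increasing)
  next
    case False
    \<comment> \<open>Here \<open>r\<close> is positive, so its square root can be compared with the
      infimum.\<close>
    define r where "r = dist_sq N T x - (norm (T v))\<^sup>2 / 4"
    have "sqrt r \<le> infdist (?T x) (?T ` N)"
    proof (rule infdist_linear_image_greatest[OF lin discrete_subgroupD(1)[OF N]])
      fix z assume "z \<in> N"
      thus "sqrt r \<le> norm (?T (x - z))" using 1[of z] by (intro real_le_lsqrt) (auto simp: r_def)
    qed
    hence "(sqrt r)\<^sup>2 \<le> dist_sq N ?T x" unfolding dist_sq_def using False by (intro power_mono) (auto simp: r_def)
    thus ?thesis using False by (simp add: r_def)
  qed
qed

text \<open>\<open>Q\<close> kills \<open>v\<close>, so the distance after \<open>Q\<close> only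
  sees classes modulo the line of \<open>v\<close>. Its mean over the parallelepiped of
  \<open>b\<close> therefore equals that over \<open>b'\<close>, which is a second moment of the
  projected lattice.\<close>

lemma second_moment_quotient_le:
  assumes b: "indep_family k b" and T: "linear T" and v: "v \<in> zspan k b"
    and b': "indep_family k' b'" "zspan k' b' = qproj (span {v}) ` zspan k b"
  shows "second_moment k b T \<le> second_moment k' b' (\<lambda>y. qproj (span {T v}) (T y)) + ennreal ((norm (T v))\<^sup>2 / 4)"
proof -
  let ?N = "zspan k b" and ?N' = "zspan k' b'" and ?P = "qproj (span {v})"
  define Q where "Q = (\<lambda>y. qproj (span {T v}) (T y))"
  have N: "discrete_subgroup ?N" by (rule discrete_zspan[OF b])
  have N': "discrete_subgroup ?N'" by (rule discrete_zspan[OF b'(1)])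
  have lin: "linear Q" unfolding Q_def using linear_compose[OF T linear_qproj[OF subspace_span]] by (simp add: o_def)
  have linP: "linear ?P" by (rule linear_qproj) simp
  have TP: "Q (?P z) = Q z" for z
  proof -
    obtain a where a: "z - ?P z = a *\<^sub>R v" using qproj_diff[OF subspace_span, of z "{v}"] by (auto simp: span_singleton)
    have "Q v = 0" unfolding Q_def by (rule qproj_eq_0) (auto intro: span_base)
    hence "Q (z - ?P z) = 0" unfolding a using lin by (simp add: linear_scale)
    thus ?thesis using lin by (simp add: linear_diff)
  qed
  have im: "Q ` ?N' = Q ` ?N" unfolding b'(2) image_image TP ..
  have D: "dist_sq ?N' Q = dist_sq ?N Q" by (simp add: dist_sq_def im fun_eq_iff)
  let ?h = "\<lambda>x. ennreal (dist_sq ?N Q x)"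
  have [measurable]: "dist_sq ?N Q \<in> borel_measurable borel" "dist_sq ?N T \<in> borel_measurable borel"
    by (rule dist_sq_measurable[OF lin], rule dist_sq_measurable[OF T])
  have hP: "?h (x + u) = ?h (x + ?P u)" for x u
    using lin TP[of u] by (simp add: dist_sq_def linear_add)
  have spanN': "span (b' ` {..<k'}) = ?P ` span (b ` {..<k})"
    using linear_span_image[OF linP, of ?N] b'(2) by (metis span_zspan)
  have per: "?h (x + z) = ?h x" if "z \<in> ?N" for x z
    using dist_sq_periodic[OF lin N, of z x] that by simp
  have per': "?h (x + z) = ?h x" if "z \<in> ?N'" for x z
    using dist_sq_periodic[OF lin N, of z x] imageI[OF that, of Q] im by simp
  have eq: "avg k b ?h = avg k' b' ?h"
  proof (rule avg_eq)
    fix u assume "u \<in> span (b ` {..<k})"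
    hence "?P u \<in> span (b' ` {..<k'})" unfolding spanN' by simp
    hence "avg k' b' (\<lambda>x. ?h (x + ?P u)) = avg k' b' ?h" by (intro avg_shift[where h = ?h] per') measurable
    thus "avg k' b' (\<lambda>x. ?h (x + u)) = avg k' b' ?h" unfolding hP[of _ u] .
  next
    fix u assume "u \<in> span (b' ` {..<k'})"
    then obtain w where w: "w \<in> span (b ` {..<k})" "u = ?P w" unfolding spanN' by auto
    have "avg k b (\<lambda>x. ?h (x + w)) = avg k b ?h" by (intro avg_shift[where h = ?h] per w) measurable
    thus "avg k b (\<lambda>x. ?h (x + u)) = avg k b ?h" unfolding w(2) hP[of _ w] .
  qed measurable
  have "second_moment k b T \<le> avg k b (\<lambda>x. ?h x + ennreal ((norm (T v))\<^sup>2 / 4))"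
    unfolding second_moment_def using dist_sq_quotient_le[OF T N v, folded Q_def]
    by (intro avg_mono) (simp add: ennreal_plus[symmetric] dist_sq_def ennreal_leI del: ennreal_plus)
  also have "\<dots> = avg k b ?h + ennreal ((norm (T v))\<^sup>2 / 4)" by (subst avg_add) (auto simp: avg_const)
  also have "avg k b ?h = second_moment k' b' Q" unfolding eq second_moment_def D ..
  finally show ?thesis unfolding Q_def .
qed

section \<open>Voronoi cells and the first variation\<close>

lemma countable_discrete: assumes "discrete_subgroup N" shows "countable N"
proof -
  have "x \<in> (\<Union>n::nat. N \<inter> cball 0 (real n))" if "x \<in> N" for x
    using that real_arch_simple[of "norm x"] by auto
  hence "N = (\<Union>n::nat. N \<inter> cball 0 (real n))" by blast
  moreover have "countable (\<Union>n::nat. N \<inter> cball 0 (real n))"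
    using discrete_subgroupD(3)[OF assms] by (intro countable_UN) (auto intro: countable_finite)
  ultimately show ?thesis by simp
qed

text \<open>Injectivity in quantitative form, and only on the span: \<open>c\<close> turns errors of
  \<open>T\<close> into relative errors of distances.\<close>

locale lattice_form =
  fixes k :: nat and b :: "nat \<Rightarrow> 'a::euclidean_space" and T :: "'a \<Rightarrow> 'a" and c :: real
  assumes ind: "indep_family k b" and T: "linear T" and c: "c > 0"
    and low: "\<And>y. y \<in> span (b ` {..<k}) \<Longrightarrow> c * norm y \<le> norm (T y)"
begin

abbreviation "N \<equiv> zspan k b"
abbreviation "V \<equiv> span (b ` {..<k})"
abbreviation "X \<equiv> lincomb k b"

text \<open>Cut out by the deformed norm but placed in the undeformed space, so that stationarity
  yields moments of this cell and not of its image under \<open>T\<close>.\<close>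

definition vor :: "'a set" where
  "vor = {x. \<forall>z\<in>N. norm (T x) \<le> norm (T (x - z))}"

definition vor_coords :: "(nat \<Rightarrow> real) set" where
  "vor_coords = {t \<in> space (Rd_lborel k). X t \<in> vor}"

text \<open>At ties the closed cells overlap and the squared distance may have a kink. Asking all
  distances to differ is more than uniqueness of the nearest point, but in coordinates it fails only
  on countably many hyperplanes.\<close>

definition untied :: "'a \<Rightarrow> bool" where
  "untied x \<longleftrightarrow> (\<forall>z\<in>N. \<forall>z'\<in>N. z \<noteq> z' \<longrightarrow> norm (T (x - z)) \<noteq> norm (T (x - z')))"

lemma discrete_N: "discrete_subgroup N" by (rule discrete_zspan[OF ind])

lemma N_sub_V: "N \<subseteq> V" using span_superset[of N] unfolding span_zspan .

lemma T_eq_0: assumes "y \<in> V" "T y = 0" shows "y = 0"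
proof -
  have "c * norm y \<le> 0" using low[OF assms(1)] by (simp only: assms(2) norm_zero)
  hence "norm y \<le> 0" using c by (simp add: mult_le_0_iff)
  thus ?thesis by simp
qed

lemma T_measurable [measurable]: "T \<in> borel_measurable borel"
  by (rule linear_borel_measurable[OF T])

lemma vor_coords_sets [measurable]: "vor_coords \<in> sets (Rd_lborel k)"
proof -
  have "vor_coords = (\<Inter>z\<in>N. {t \<in> space (Rd_lborel k). norm (T (X t)) \<le> norm (T (X t - z))})"
    using discrete_subgroupD(1)[OF discrete_N] by (auto simp: vor_coords_def vor_def)
  also have "\<dots> \<in> sets (Rd_lborel k)"
  proof (rule sets.countable_INT'[OF countable_discrete[OF discrete_N]])
    have "{t \<in> space (Rd_lborel k). norm (T (X t)) \<le> norm (T (X t - z))} \<in> sets (Rd_lborel k)" for z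
      by measurable
    thus "(\<lambda>z. {t \<in> space (Rd_lborel k). norm (T (X t)) \<le> norm (T (X t - z))}) ` N \<subseteq> sets (Rd_lborel k)"
      by blast
  qed (use discrete_subgroupD(1)[OF discrete_N] in auto)
  finally show ?thesis .
qed

lemma vor_bounded:
  obtains R where "R > 0" "\<And>x. x \<in> V \<Longrightarrow> x \<in> vor \<Longrightarrow> norm x \<le> R"
proof -
  obtain R where R: "R > 0" "\<And>x. x \<in> V \<Longrightarrow> \<exists>z\<in>N. norm (x - z) \<le> R"
    using lattice_cover_bound[of b k] by blast
  show ?thesis
  proof (rule that[of "1 + sqrt (hs_norm_sq T) * R / c"])
    show "1 + sqrt (hs_norm_sq T) * R / c > 0"
      using R c hs_norm_sq_nonneg[of T] by (simp add: add_pos_nonneg)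
    fix x assume x: "x \<in> V" "x \<in> vor"
    obtain z where z: "z \<in> N" "norm (x - z) \<le> R" using R(2)[OF x(1)] by blast
    have "c * norm x \<le> norm (T x)" by (rule low[OF x(1)])
    also have "\<dots> \<le> norm (T (x - z))" using x(2) z(1) by (simp add: vor_def)
    also have "\<dots> \<le> sqrt (hs_norm_sq T * (norm (x - z))\<^sup>2)"
      using norm_le_hs[OF T] by (intro real_le_rsqrt)
    also have "\<dots> = sqrt (hs_norm_sq T) * norm (x - z)" by (simp add: real_sqrt_mult)
    also have "\<dots> \<le> sqrt (hs_norm_sq T) * R" using z hs_norm_sq_nonneg[of T] by (intro mult_left_mono) auto
    finally have "norm x \<le> sqrt (hs_norm_sq T) * R / c" using c by (simp add: field_simps)
    thus "norm x \<le> 1 + sqrt (hs_norm_sq T) * R / c" by simp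
  qed
qed

lemma untied_AE: "AE t in Rd_lborel k. untied (X t)"
  unfolding untied_def
proof (intro AE_ball_countable[OF countable_discrete[OF discrete_N], THEN iffD2] ballI)
  fix z z' assume z: "z \<in> N" "z' \<in> N"
  show "AE t in Rd_lborel k. z \<noteq> z' \<longrightarrow> norm (T (X t - z)) \<noteq> norm (T (X t - z'))"
  proof (cases "z = z'")
    case False
    define w where "w = z' - z"
    have w: "w \<in> N" "w \<noteq> 0" using False discrete_subgroupD(2)[OF discrete_N z(2,1)] by (auto simp: w_def)
    define a where "a = (\<lambda>i. 2 * inner (T (b i)) (T w))"
    define r where "r = (norm (T z'))\<^sup>2 - (norm (T z))\<^sup>2"
    have TX: "T (X t) = (\<Sum>i<k. t i *\<^sub>R T (b i))" for t
      unfolding lincomb_def using T by (simp add: linear_sum linear_scale)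
    have aX: "(\<Sum>i<k. a i * t i) = 2 * inner (T (X t)) (T w)" for t
      unfolding TX a_def by (simp add: inner_sum_left sum_distrib_left mult_ac)
    obtain m where m: "w = (\<Sum>i<k. of_int (m i) *\<^sub>R b i)" using w(1) by (rule zspanE)
    \<comment> \<open>Pairing \<open>a\<close> with the coordinates of \<open>w\<close> gives twice
      the squared norm of \<open>T w\<close>, which is nonzero; so a tie is a genuine hyperplane
      condition.\<close>
    have "\<exists>i<k. a i \<noteq> 0"
    proof (rule ccontr)
      assume "\<not> (\<exists>i<k. a i \<noteq> 0)"
      hence "(\<Sum>i<k. a i * of_int (m i)) = 0" by simp
      hence "inner (T w) (T w) = 0" unfolding aX by (simp add: lincomb_def m[symmetric])
      thus False using T_eq_0[of w] w N_sub_V by auto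
    qed
    then obtain i where i: "i < k" "a i \<noteq> 0" by blast
    have "(\<Sum>i<k. a i * t i) = r" if "norm (T (X t - z)) = norm (T (X t - z'))" for t
    proof -
      have "(norm (T (X t) - T z))\<^sup>2 = (norm (T (X t) - T z'))\<^sup>2" using that T by (simp add: linear_diff)
      thus ?thesis unfolding aX r_def w_def using T
        by (simp add: power2_norm_eq_inner linear_diff inner_diff_left inner_diff_right inner_commute algebra_simps)
    qed
    thus ?thesis using hyperplane_null_set[of i k a r, OF i]
      by (intro AE_I'[of "{t \<in> space (Rd_lborel k). (\<Sum>i<k. a i * t i) = r}"]) auto
  qed simp
qed

lemma image_N: "T ` N = zspan k (\<lambda>i. T (b i))"
proof -
  have "T (\<Sum>i<k. of_int (f i) *\<^sub>R b i) = (\<Sum>i<k. of_int (f i) *\<^sub>R T (b i))" for f :: "nat \<Rightarrow> int"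
    using T by (simp add: linear_sum linear_scale)
  moreover have "zspan k g = range (\<lambda>f. \<Sum>i<k. of_int (f i) *\<^sub>R g i)" for g :: "nat \<Rightarrow> 'a"
    by (auto simp: zspan_def)
  ultimately show ?thesis by (simp add: image_image)
qed

lemma ind_image: "indep_family k (\<lambda>i. T (b i))"
  unfolding indep_family_def
proof (intro allI impI)
  fix f :: "nat \<Rightarrow> real" and i assume "(\<Sum>i<k. f i *\<^sub>R T (b i)) = 0" and i: "i < k"
  hence "T (\<Sum>i<k. f i *\<^sub>R b i) = 0" using T by (simp add: linear_sum linear_scale)
  hence "(\<Sum>i<k. f i *\<^sub>R b i) = 0" by (rule T_eq_0[OF lincomb_in_span[unfolded lincomb_def]])
  thus "f i = 0" using indep_familyD[OF ind] i by blast
qed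

lemma nearest_exists: "\<exists>z\<in>N. x - z \<in> vor"
proof -
  have D: "discrete_subgroup (T ` N)" unfolding image_N by (rule discrete_zspan[OF ind_image])
  obtain u where u: "u \<in> T ` N" "infdist (T x) (T ` N) = norm (T x - u)" "\<And>y. y \<in> T ` N \<Longrightarrow> norm (T x - u) \<le> norm (T x - y)"
    by (rule discrete_nearest[OF D, where x = "T x"]) blast
  then obtain z where z: "z \<in> N" "u = T z" by auto
  have "norm (T (x - z)) \<le> norm (T (x - z - y))" if "y \<in> N" for y
  proof -
    have "z + y \<in> N" using discrete_subgroupD(5)[OF discrete_N z(1) that] .
    hence "norm (T x - T z) \<le> norm (T x - T (z + y))" using u(3)[OF imageI] z(2) by simp
    thus ?thesis by (simp only: linear_diff[OF T, symmetric] diff_diff_eq)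
  qed
  hence "x - z \<in> vor" by (simp add: vor_def)
  thus ?thesis using z by blast
qed

lemma infdist_nearest:
  assumes "z \<in> N" "x - z \<in> vor" shows "infdist (T x) (T ` N) = norm (T (x - z))"
proof (rule antisym)
  show "infdist (T x) (T ` N) \<le> norm (T (x - z))" by (rule infdist_linear_image_le[OF T assms(1)])
  show "norm (T (x - z)) \<le> infdist (T x) (T ` N)"
  proof (rule infdist_linear_image_greatest[OF T discrete_subgroupD(1)[OF discrete_N]])
    fix y assume "y \<in> N"
    hence "y - z \<in> N" using discrete_subgroupD(2)[OF discrete_N _ assms(1)] by blast
    hence "norm (T (x - z)) \<le> norm (T (x - z - (y - z)))" using assms(2) unfolding vor_def by blast
    thus "norm (T (x - z)) \<le> norm (T (x - y))" by simp
  qed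
qed

text \<open>Up to ties the cell is a second fundamental domain: exactly one integer translate of an
  untied point lies in it. Integrals over the cell become integrals over the cube of the
  displacement from the nearest lattice point, so \<open>g\<close> is prescribed at untied points
  only.\<close>

lemma nn_integral_vor:
  fixes f :: "'a \<Rightarrow> ennreal" and g :: "(nat \<Rightarrow> real) \<Rightarrow> ennreal"
  assumes [measurable]: "f \<in> borel_measurable borel"
    and g: "\<And>t z. t \<in> space (Rd_lborel k) \<Longrightarrow> untied (X t) \<Longrightarrow> z \<in> N \<Longrightarrow> X t - z \<in> vor \<Longrightarrow> g t = f (X t - z)"
  shows "(\<integral>\<^sup>+t. f (X t) * indicator vor_coords t \<partial>Rd_lborel k) = (\<integral>\<^sup>+t. g t * indicator (unit_cube k) t \<partial>Rd_lborel k)"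
proof -
  let ?i = "\<lambda>z :: nat \<Rightarrow> int. \<lambda>i. real_of_int (z i)"
  have "(\<integral>\<^sup>+t. f (X t) * indicator vor_coords t \<partial>Rd_lborel k) =
    (\<integral>\<^sup>+t. (\<integral>\<^sup>+z. f (X (vadd k t (?i z))) * indicator vor_coords (vadd k t (?i z)) \<partial>count_space (int_vectors k))
      * indicator (unit_cube k) t \<partial>Rd_lborel k)"
    by (rule nn_integral_tiling) measurable
  also have "\<dots> = (\<integral>\<^sup>+t. g t * indicator (unit_cube k) t \<partial>Rd_lborel k)"
  proof (rule nn_integral_cong_AE)
    show "AE t in Rd_lborel k. (\<integral>\<^sup>+z. f (X (vadd k t (?i z))) * indicator vor_coords (vadd k t (?i z)) \<partial>count_space (int_vectors k))
      * indicator (unit_cube k) t = g t * indicator (unit_cube k) t"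
      using untied_AE
    proof eventually_elim
      case (elim t)
      show ?case
      proof (cases "t \<in> unit_cube k")
        case True
        hence t: "t \<in> space (Rd_lborel k)" using sets.sets_into_space[OF unit_cube_sets] by blast
        have in_vc: "vadd k t (?i z) \<in> vor_coords \<longleftrightarrow> X t + X (?i z) \<in> vor" for z
        proof -
          have "vadd k t (?i z) \<in> space (Rd_lborel k)" by (simp add: space_Rd vadd_def)
          thus ?thesis by (simp add: vor_coords_def lincomb_vadd)
        qed
        obtain z0 where z0: "z0 \<in> N" "X t - z0 \<in> vor" using nearest_exists by blast
        obtain m where m: "z0 = (\<Sum>i<k. of_int (m i) *\<^sub>R b i)" using z0(1) by (rule zspanE)
        define m' where "m' = (\<lambda>i\<in>{..<k}. - m i)"
        have m': "m' \<in> int_vectors k" by (auto simp: m'_def int_vectors_def)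
        have Xm': "X (?i m') = - z0" unfolding m by (simp add: lincomb_def m'_def sum_negf)
        have uniq: "z = m'" if z: "z \<in> int_vectors k" "vadd k t (?i z) \<in> vor_coords" for z
        proof -
          let ?w = "X (?i z)"
          have w: "?w \<in> N" by (rule lincomb_in_zspan)
          have v: "X t + ?w \<in> vor" using z(2) in_vc by simp
          have mw: "- ?w \<in> N" by (rule discrete_subgroupD(4)[OF discrete_N w])
          have "infdist (T (X t)) (T ` N) = norm (T (X t - (- ?w)))" by (rule infdist_nearest[OF mw]) (use v in simp)
          moreover have "infdist (T (X t)) (T ` N) = norm (T (X t - z0))" by (rule infdist_nearest[OF z0])
          ultimately have eq: "norm (T (X t - z0)) = norm (T (X t - (- ?w)))" by simp
          have "z0 = - ?w"
            by (rule ccontr) (use elim[unfolded untied_def, rule_format, OF z0(1) mw] eq in simp)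
        hence "X (\<lambda>i. ?i z i - ?i m' i) = 0"
          using Xm' by (simp add: lincomb_def scaleR_left_diff_distrib sum_subtractf)
        hence "?i z i - ?i m' i = 0" if "i < k" for i
          using indep_familyD[OF ind, of "\<lambda>i. ?i z i - ?i m' i" i] that by (simp add: lincomb_def)
        hence "z i = m' i" if "i < k" for i using that by simp
        thus "z = m'" using z(1) m' unfolding int_vectors_def by (intro PiE_ext) auto
        qed
        have "(\<integral>\<^sup>+z. f (X (vadd k t (?i z))) * indicator vor_coords (vadd k t (?i z)) \<partial>count_space (int_vectors k)) =
          f (X (vadd k t (?i m'))) * indicator vor_coords (vadd k t (?i m'))"
          using uniq by (intro nn_integral_count_single m') (auto split: split_indicator)
        also have "\<dots> = f (X t - z0)" using in_vc[of m'] z0(2) by (simp add: lincomb_vadd Xm')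
        also have "\<dots> = g t" by (rule g[OF t elim z0, symmetric])
        finally show ?thesis by simp
      qed simp
    qed
  qed
  finally show ?thesis .
qed

lemma emeasure_vor_coords: "emeasure (Rd_lborel k) vor_coords = 1"
  using nn_integral_vor[of "\<lambda>_. 1" "\<lambda>_. 1"] by simp

text \<open>An error of \<open>\<delta> * norm y\<close> is at most \<open>\<delta> / c\<close>
  relative to \<open>norm (T y)\<close>. The factors pass to the infimum: above through the point
  nearest for \<open>T\<close>, below uniformly over the lattice.\<close>

lemma dist_sq_perturb:
  assumes T': "linear T'" and x: "x \<in> V" and h: "\<And>y. norm (T' y - T y) \<le> \<delta> * norm y" and d: "0 \<le> \<delta>" "\<delta> \<le> c"
  shows "infdist (T' x) (T' ` N) \<le> (1 + \<delta> / c) * infdist (T x) (T ` N)"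
    "(1 - \<delta> / c) * infdist (T x) (T ` N) \<le> infdist (T' x) (T' ` N)"
    "\<And>y. y \<in> V \<Longrightarrow> (1 - \<delta> / c) * norm (T y) \<le> norm (T' y)"
    "\<And>y. y \<in> V \<Longrightarrow> norm (T' y) \<le> (1 + \<delta> / c) * norm (T y)"
proof -
  have dy: "norm (T' y - T y) \<le> \<delta> / c * norm (T y)" if "y \<in> V" for y
  proof -
    have "norm (T' y - T y) \<le> \<delta> * norm y" by (rule h)
    also have "\<dots> = \<delta> / c * (c * norm y)" using c by simp
    also have "\<dots> \<le> \<delta> / c * norm (T y)" using low[OF that] c d by (intro mult_left_mono) auto
    finally show ?thesis .
  qed
  show up: "norm (T' y) \<le> (1 + \<delta> / c) * norm (T y)" if "y \<in> V" for y
    using dy[OF that] norm_triangle_ineq[of "T y" "T' y - T y"] by (simp add: algebra_simps)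
  show lo: "(1 - \<delta> / c) * norm (T y) \<le> norm (T' y)" if "y \<in> V" for y
    using dy[OF that] norm_triangle_ineq[of "T' y" "T y - T' y"] by (simp add: algebra_simps norm_minus_commute)
  obtain z where z: "z \<in> N" "x - z \<in> vor" using nearest_exists by blast
  have V: "x - y \<in> V" if "y \<in> N" for y using x that N_sub_V by (intro span_diff) auto
  have "infdist (T' x) (T' ` N) \<le> norm (T' (x - z))" by (rule infdist_linear_image_le[OF T' z(1)])
  also have "\<dots> \<le> (1 + \<delta> / c) * norm (T (x - z))" by (rule up[OF V[OF z(1)]])
  finally show "infdist (T' x) (T' ` N) \<le> (1 + \<delta> / c) * infdist (T x) (T ` N)"
    by (simp add: infdist_nearest[OF z])
  show "(1 - \<delta> / c) * infdist (T x) (T ` N) \<le> infdist (T' x) (T' ` N)"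
  proof (rule infdist_linear_image_greatest[OF T' discrete_subgroupD(1)[OF discrete_N]])
    fix y assume y: "y \<in> N"
    have "(1 - \<delta> / c) * infdist (T x) (T ` N) \<le> (1 - \<delta> / c) * norm (T (x - y))"
      using d c by (intro mult_left_mono infdist_linear_image_le[OF T y]) (simp add: field_simps)
    also have "\<dots> \<le> norm (T' (x - y))" by (rule lo[OF V[OF y]])
    finally show "(1 - \<delta> / c) * infdist (T x) (T ` N) \<le> norm (T' (x - y))" .
  qed
qed

end

section \<open>First variation at a maximizer\<close>

definition hs_inner :: "('a::euclidean_space \<Rightarrow> 'a) \<Rightarrow> ('a \<Rightarrow> 'a) \<Rightarrow> real" where
  "hs_inner T H = (\<Sum>i\<in>Basis. inner (T i) (H i))"

lemma norm_le_sqrt_hs: "linear T \<Longrightarrow> norm (T x) \<le> sqrt (hs_norm_sq T) * norm x"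
  using norm_le_hs[of T x] by (metis norm_ge_zero real_le_rsqrt real_sqrt_abs real_sqrt_mult abs_norm_cancel)

lemma perturbation_le:
  assumes "linear H"
  shows "norm (T u + e *\<^sub>R H u - T u) \<le> \<bar>e\<bar> * sqrt (hs_norm_sq H) * norm u"
  using mult_left_mono[OF norm_le_sqrt_hs[OF assms, of u], of "\<bar>e\<bar>"] by (simp add: mult.assoc)

lemma norm_add_scale_sq:
  "(norm (x + e *\<^sub>R y))\<^sup>2 = (norm x)\<^sup>2 + 2 * e * inner x y + e\<^sup>2 * (norm y)\<^sup>2"
  unfolding power2_norm_eq_inner
  by (simp add: inner_add_left inner_add_right inner_commute[of y x] power2_eq_square[of e] distrib_left mult.assoc)

lemma hs_norm_sq_add:
  "hs_norm_sq (\<lambda>x. T x + e *\<^sub>R H x) = hs_norm_sq T + 2 * e * hs_inner T H + e\<^sup>2 * hs_norm_sq H"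
  by (simp add: hs_norm_sq_def hs_inner_def norm_add_scale_sq sum.distrib sum_distrib_left)

context lattice_form
begin

text \<open>At an untied point the nearest lattice point stays nearest under small perturbations, so
  the perturbed squared distance is that of a fixed vector, a quadratic polynomial in
  \<open>1 / n\<close>.\<close>

lemma variation_limit:
  assumes H: "linear H" and x: "x \<in> V" "untied x" and z: "z \<in> N" "x - z \<in> vor"
  shows "(\<lambda>n. real n * (dist_sq N (\<lambda>y. T y + (1 / real n) *\<^sub>R H y) x - dist_sq N T x))
    \<longlonglongrightarrow> 2 * inner (T (x - z)) (H (x - z))"
proof -
  define y where "y = x - z"
  define Tn where "Tn = (\<lambda>n::nat. \<lambda>y. T y + (1 / real n) *\<^sub>R H y)"
  define h where "h = sqrt (hs_norm_sq H)"
  have h0: "h \<ge> 0" by (simp add: h_def hs_norm_sq_nonneg)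
  have linTn: "linear (Tn n)" for n unfolding Tn_def
    using T H by (intro linear_compose_add linear_compose_scale_right)
  have hn: "norm (Tn n u - T u) \<le> h / real n * norm u" for n u
    using perturbation_le[OF H, where T = T and e = "1 / real n" and u = u] by (simp add: Tn_def h_def)
  have Vx: "x - w \<in> V" if "w \<in> N" for w using x that N_sub_V by (intro span_diff) auto
  \<comment> \<open>A gap between the nearest and all other lattice points: finitely many lie within
    1 of the minimum, and the cap 1 in \<open>\<eta>\<close> handles the rest.\<close>
  obtain \<eta> where eta: "\<eta> > 0" "\<And>w. w \<in> N \<Longrightarrow> w \<noteq> z \<Longrightarrow> norm (T y) + \<eta> \<le> norm (T (x - w))"
  proof -
    define F where "F = {w \<in> N. w \<noteq> z \<and> norm (T (x - w)) \<le> norm (T y) + 1}"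
    have "F \<subseteq> N \<inter> cball 0 (norm x + (norm (T y) + 1) / c)"
    proof
      fix w assume w: "w \<in> F"
      have "c * norm (x - w) \<le> norm (T y) + 1" using low[OF Vx, of w] w by (simp add: F_def)
      hence "norm (x - w) \<le> (norm (T y) + 1) / c" using c by (simp add: field_simps)
      moreover have "norm w \<le> norm x + norm (x - w)" using norm_triangle_ineq4[of x "x - w"] by simp
      ultimately show "w \<in> N \<inter> cball 0 (norm x + (norm (T y) + 1) / c)" using w by (simp add: F_def)
    qed
    hence fin: "finite F" using discrete_subgroupD(3)[OF discrete_N] finite_subset by blast
    define \<eta> where "\<eta> = Min (insert 1 ((\<lambda>w. norm (T (x - w)) - norm (T y)) ` F))"
    have pos: "norm (T (x - w)) - norm (T y) > 0" if "w \<in> F" for w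
    proof -
      have w: "w \<in> N" "w \<noteq> z" using that by (auto simp: F_def)
      have "norm (T (x - w)) \<noteq> norm (T y)" using x(2) w z(1) unfolding untied_def y_def by metis
      moreover have "norm (T y) \<le> norm (T (y - (w - z)))"
        using z(2) discrete_subgroupD(2)[OF discrete_N w(1) z(1)] by (auto simp: y_def vor_def)
      ultimately show ?thesis by (simp add: y_def)
    qed
    have "\<eta> > 0" unfolding \<eta>_def using fin pos by (subst Min_gr_iff) auto
    moreover have "norm (T y) + \<eta> \<le> norm (T (x - w))" if w: "w \<in> N" "w \<noteq> z" for w
    proof (cases "w \<in> F")
      case True
      hence "\<eta> \<le> norm (T (x - w)) - norm (T y)" unfolding \<eta>_def using fin by (intro Min_le) auto
      thus ?thesis by simp
    next
      case False
      have "\<eta> \<le> 1" unfolding \<eta>_def using fin by (intro Min_le) auto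
      moreover have "norm (T (x - w)) > norm (T y) + 1" using False w by (auto simp: F_def)
      ultimately show ?thesis by simp
    qed
    ultimately show ?thesis using that by blast
  qed
  \<comment> \<open>Once this expression is positive, the gap outweighs the distortion and
    \<open>z\<close> is still nearest.\<close>
  have "(\<lambda>n. (1 - h / real n / c) * (norm (T y) + \<eta>) - (1 + h / real n / c) * norm (T y))
      \<longlonglongrightarrow> (1 - 0 / c) * (norm (T y) + \<eta>) - (1 + 0 / c) * norm (T y)"
    using c by (intro tendsto_intros lim_const_over_n) auto
  hence ev1: "eventually (\<lambda>n. (1 - h / real n / c) * (norm (T y) + \<eta>) - (1 + h / real n / c) * norm (T y) > 0) sequentially"
    using eta(1) by (intro order_tendstoD(1)) auto
  have ev2: "eventually (\<lambda>n. h / real n < c) sequentially"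
    using lim_const_over_n[of h] c by (intro order_tendstoD(2)[where y = 0]) auto
  have ev: "eventually (\<lambda>n. 2 * inner (T y) (H y) + (norm (H y))\<^sup>2 / real n =
      real n * (dist_sq N (Tn n) x - dist_sq N T x)) sequentially"
    using ev1 ev2 eventually_gt_at_top[of 0]
  proof eventually_elim
    case (elim n)
    have d: "0 \<le> h / real n" "h / real n \<le> c" using elim h0 by auto
    have d1: "0 \<le> 1 - h / real n / c" using divide_right_mono[OF d(2), of c] c by simp
    note pert = dist_sq_perturb[OF linTn x(1) hn d]
    have "norm (Tn n y) \<le> infdist (Tn n x) (Tn n ` N)"
    proof (rule infdist_linear_image_greatest[OF linTn discrete_subgroupD(1)[OF discrete_N]])
      fix w assume w: "w \<in> N"
      show "norm (Tn n y) \<le> norm (Tn n (x - w))"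
      proof (cases "w = z")
        case False
        have "norm (Tn n y) \<le> (1 + h / real n / c) * norm (T y)" unfolding y_def by (rule pert(4)[OF Vx[OF z(1)]])
        also have "\<dots> \<le> (1 - h / real n / c) * (norm (T y) + \<eta>)" using elim by simp
        also have "\<dots> \<le> (1 - h / real n / c) * norm (T (x - w))"
          using eta(2)[OF w False] d1 by (intro mult_left_mono) auto
        also have "\<dots> \<le> norm (Tn n (x - w))" by (rule pert(3)[OF Vx[OF w]])
        finally show ?thesis .
      qed (simp add: y_def)
    qed
    hence "infdist (Tn n x) (Tn n ` N) = norm (Tn n y)"
      using infdist_linear_image_le[OF linTn z(1), of n x] by (simp add: y_def)
    hence "dist_sq N (Tn n) x = (norm (Tn n y))\<^sup>2" by (simp add: dist_sq_def)
    also have "\<dots> = (norm (T y))\<^sup>2 + 2 / real n * inner (T y) (H y) + (norm (H y))\<^sup>2 / (real n)\<^sup>2"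
      unfolding Tn_def norm_add_scale_sq by (simp add: power_divide)
    finally show ?case using infdist_nearest[OF z] elim
      by (simp add: dist_sq_def y_def field_simps power2_eq_square)
  qed
  have "(\<lambda>n. 2 * inner (T y) (H y) + (norm (H y))\<^sup>2 / real n) \<longlonglongrightarrow> 2 * inner (T y) (H y) + 0"
    by (intro tendsto_intros lim_const_over_n)
  hence "(\<lambda>n. real n * (dist_sq N (Tn n) x - dist_sq N T x)) \<longlonglongrightarrow> 2 * inner (T y) (H y)"
    using ev by (simp add: tendsto_cong)
  thus ?thesis by (simp add: Tn_def y_def)
qed

text \<open>Fatou's lemma for difference quotients, raised by \<open>M\<close> to be nonnegative.
  Their means are controlled by maximality: the perturbed maps obey the bound
  \<open>S * hs_norm_sq\<close>, while \<open>T\<close> reaches \<open>S\<close>. Only an inequality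
  results; using \<open>- H\<close> as well later gives equality.\<close>

lemma variation_nn:
  assumes H: "linear H" and S: "S \<ge> 0"
    and max: "\<And>T'. linear T' \<Longrightarrow> second_moment k b T' \<le> ennreal (S * hs_norm_sq T')"
    and att: "ennreal S \<le> second_moment k b T" and hs: "hs_norm_sq T \<le> 1"
  obtains M0 where "\<And>M. M \<ge> M0 \<Longrightarrow>
    (\<integral>\<^sup>+t. ennreal (2 * inner (T (X t)) (H (X t)) + M) * indicator vor_coords t \<partial>Rd_lborel k)
      \<le> ennreal (M + 2 * S * hs_inner T H)"
proof -
  define Tn where "Tn = (\<lambda>n::nat. \<lambda>y. T y + (1 / real n) *\<^sub>R H y)"
  define f where "f = (\<lambda>n x. real n * (dist_sq N (Tn n) x - dist_sq N T x))"
  define h where "h = sqrt (hs_norm_sq H)"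
  have h0: "h \<ge> 0" by (simp add: h_def hs_norm_sq_nonneg)
  have linTn: "linear (Tn n)" for n unfolding Tn_def
    using T H by (intro linear_compose_add linear_compose_scale_right)
  have [measurable]: "dist_sq N T \<in> borel_measurable borel" "dist_sq N (Tn n) \<in> borel_measurable borel" for n
    by (rule dist_sq_measurable[OF T], rule dist_sq_measurable[OF linTn])
  note [measurable] = linear_borel_measurable[OF H]
  have fm [measurable]: "f n \<in> borel_measurable borel" for n unfolding f_def by measurable
  have hn: "norm (Tn n u - T u) \<le> h / real n * norm u" for n u
    using perturbation_le[OF H, where T = T and e = "1 / real n" and u = u] by (simp add: Tn_def h_def)
  obtain R where R: "R \<ge> 0" "\<And>x. x \<in> V \<Longrightarrow> dist_sq N T x \<le> R * hs_norm_sq T"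
    using second_moment_bounded[of k b] T by metis
  define M0 where "M0 = 2 * h / c * (R * hs_norm_sq T)"
  have M0: "M0 \<ge> 0" using h0 c R hs_norm_sq_nonneg[of T] by (simp add: M0_def)
  \<comment> \<open>With \<open>\<delta> = h / (n * c)\<close> the relative loss of the squared
    distance is at most \<open>2 * \<delta>\<close>, so the factor \<open>n\<close> cancels and the
    bound is uniform in \<open>n\<close>.\<close>
  have lower: "f n x \<ge> - M0" if n: "n > 0" "h / real n \<le> c" and x: "x \<in> V" for n x
  proof -
    define \<delta> where "\<delta> = h / real n / c"
    have d: "0 \<le> \<delta>" "\<delta> \<le> 1" using h0 c n by (auto simp: \<delta>_def field_simps)
    let ?D = "infdist (T x) (T ` N)"
    have "(1 - \<delta>) * ?D \<le> infdist (Tn n x) (Tn n ` N)"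
      using dist_sq_perturb(2)[OF linTn x hn, of n] h0 n by (simp add: \<delta>_def)
    hence "((1 - \<delta>) * ?D)\<^sup>2 \<le> dist_sq N (Tn n) x"
      unfolding dist_sq_def using d by (intro power_mono mult_nonneg_nonneg infdist_nonneg) auto
    moreover have "((1 - \<delta>) * ?D)\<^sup>2 \<ge> (1 - 2 * \<delta>) * ?D\<^sup>2"
      unfolding power_mult_distrib by (intro mult_right_mono) (auto simp: power2_eq_square algebra_simps)
    ultimately have "dist_sq N (Tn n) x - dist_sq N T x \<ge> - (2 * \<delta> * dist_sq N T x)"
      by (simp add: dist_sq_def algebra_simps)
    hence "f n x \<ge> real n * (- (2 * \<delta> * dist_sq N T x))" unfolding f_def using n by (intro mult_left_mono) auto
    also have "real n * (- (2 * \<delta> * dist_sq N T x)) = - (2 * h / c * dist_sq N T x)" using n by (simp add: \<delta>_def)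
    finally have "- (2 * h / c * dist_sq N T x) \<le> f n x" .
    moreover have "2 * h / c * dist_sq N T x \<le> M0" unfolding M0_def
      using R(2)[OF x] h0 c by (intro mult_left_mono) auto
    ultimately show ?thesis by linarith
  qed
  show ?thesis
  proof (rule that[of M0])
    fix M assume M: "M \<ge> M0"
    define u where "u = (\<lambda>n t. ennreal (f n (X t) + M) * indicator (unit_cube k) t)"
    have um: "u n \<in> borel_measurable (Rd_lborel k)" for n unfolding u_def by measurable
    have "(\<integral>\<^sup>+t. ennreal (2 * inner (T (X t)) (H (X t)) + M) * indicator vor_coords t \<partial>Rd_lborel k) =
        (\<integral>\<^sup>+t. liminf (\<lambda>n. ennreal (f n (X t) + M)) * indicator (unit_cube k) t \<partial>Rd_lborel k)"
    proof (rule nn_integral_vor[where f = "\<lambda>x. ennreal (2 * inner (T x) (H x) + M)"])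
      fix t z assume "t \<in> space (Rd_lborel k)" "untied (X t)" "z \<in> N" "X t - z \<in> vor"
      hence "(\<lambda>n. f n (X t)) \<longlonglongrightarrow> 2 * inner (T (X t - z)) (H (X t - z))"
        unfolding f_def Tn_def by (intro variation_limit H lincomb_in_span)
      hence "(\<lambda>n. ennreal (f n (X t) + M)) \<longlonglongrightarrow> ennreal (2 * inner (T (X t - z)) (H (X t - z)) + M)"
        by (intro tendsto_ennrealI tendsto_intros)
      thus "liminf (\<lambda>n. ennreal (f n (X t) + M)) = ennreal (2 * inner (T (X t - z)) (H (X t - z)) + M)"
        by (intro lim_imp_Liminf) auto
    qed measurable
    also have "\<dots> = (\<integral>\<^sup>+t. liminf (\<lambda>n. u n t) \<partial>Rd_lborel k)"
      unfolding u_def by (intro nn_integral_cong) (auto simp: Liminf_const split: split_indicator)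
    also have "\<dots> \<le> liminf (\<lambda>n. \<integral>\<^sup>+t. u n t \<partial>Rd_lborel k)" by (rule nn_integral_liminf[OF um])
    also have "\<dots> \<le> liminf (\<lambda>n. ennreal (M + 2 * S * hs_inner T H + S * hs_norm_sq H / real n))"
    proof (rule Liminf_mono)
      have ev2: "eventually (\<lambda>n. h / real n < c) sequentially"
        using lim_const_over_n[of h] c by (intro order_tendstoD(2)[where y = 0]) auto
      show "eventually (\<lambda>n. (\<integral>\<^sup>+t. u n t \<partial>Rd_lborel k) \<le> ennreal (M + 2 * S * hs_inner T H + S * hs_norm_sq H / real n)) sequentially"
        using ev2 eventually_gt_at_top[of 0]
      proof eventually_elim
        case (elim n)
        let ?I = "\<integral>\<^sup>+t. u n t \<partial>Rd_lborel k"
        have I: "?I = avg k b (\<lambda>x. ennreal (f n x + M))" by (simp add: u_def avg_def)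
        \<comment> \<open>Subtraction in \<open>ennreal\<close> is truncated, so \<open>n\<close>
          times the second moment of \<open>T\<close> is carried along on the left until all terms
          are known to be finite.\<close>
        have "avg k b (\<lambda>x. ennreal (f n x + M)) + ennreal (real n) * second_moment k b T
            = avg k b (\<lambda>x. ennreal (f n x + M) + ennreal (real n) * ennreal (dist_sq N T x))"
          unfolding second_moment_def by (subst avg_cmult[symmetric], measurable, subst avg_add[symmetric], measurable)
        also have "\<dots> = avg k b (\<lambda>x. ennreal (real n) * ennreal (dist_sq N (Tn n) x) + ennreal M)"
        proof (rule avg_cong)
          fix x assume x: "x \<in> V"
          have "f n x + M \<ge> 0" using lower[OF _ _ x, of n] elim M by simp
          hence "ennreal (f n x + M) + ennreal (real n) * ennreal (dist_sq N T x) = ennreal (f n x + M + real n * dist_sq N T x)"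
            by (simp add: ennreal_mult'[symmetric] ennreal_plus[symmetric] dist_sq_def del: ennreal_plus)
          also have "f n x + M + real n * dist_sq N T x = real n * dist_sq N (Tn n) x + M"
            by (simp add: f_def algebra_simps)
          also have "ennreal \<dots> = ennreal (real n) * ennreal (dist_sq N (Tn n) x) + ennreal M"
            using M M0 by (simp add: ennreal_mult'[symmetric] ennreal_plus[symmetric] dist_sq_def del: ennreal_plus)
          finally show "ennreal (f n x + M) + ennreal (real n) * ennreal (dist_sq N T x) = 
            ennreal (real n) * ennreal (dist_sq N (Tn n) x) + ennreal M" .
        qed
        also have "\<dots> = ennreal (real n) * second_moment k b (Tn n) + ennreal M"
          unfolding second_moment_def by (subst avg_add, measurable, subst avg_cmult, measurable) (simp add: avg_const)
        also have "\<dots> \<le> ennreal (real n) * ennreal (S * hs_norm_sq (Tn n)) + ennreal M"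
          by (intro add_mono mult_left_mono max linTn) auto
        also have "\<dots> = ennreal (real n * (S * hs_norm_sq (Tn n)) + M)"
          using M M0 S hs_norm_sq_nonneg[of "Tn n"] by (simp add: ennreal_mult'[symmetric] ennreal_plus[symmetric] del: ennreal_plus)
        finally have 1: "?I + ennreal (real n) * second_moment k b T \<le> ennreal (real n * (S * hs_norm_sq (Tn n)) + M)"
          unfolding I .
        have "?I + ennreal (real n * S) \<le> ?I + ennreal (real n) * second_moment k b T"
          using mult_left_mono[OF att, of "ennreal (real n)"] S by (intro add_left_mono) (simp add: ennreal_mult'')
        hence 2: "?I + ennreal (real n * S) \<le> ennreal (real n * (S * hs_norm_sq (Tn n)) + M)" using 1 by order
        have "?I \<le> ?I + ennreal (real n * S)" by simp
        also note 2
        finally have "?I \<le> ennreal (real n * (S * hs_norm_sq (Tn n)) + M)" .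
        from le_less_trans[OF this ennreal_less_top] obtain r where r: "r \<ge> 0" "?I = ennreal r"
          unfolding less_top_ennreal by blast
        have nn: "real n * (S * hs_norm_sq (Tn n)) + M \<ge> 0" using S M M0 hs_norm_sq_nonneg[of "Tn n"] by simp
        have "ennreal (r + real n * S) \<le> ennreal (real n * (S * hs_norm_sq (Tn n)) + M)"
          using 2 r S by (simp add: ennreal_plus)
        hence "r + real n * S \<le> real n * (S * hs_norm_sq (Tn n)) + M" using nn by (simp add: ennreal_le_iff)
        moreover have "real n * (S * hs_norm_sq (Tn n)) = real n * S * hs_norm_sq T + 2 * S * hs_inner T H + S * hs_norm_sq H / real n"
          unfolding Tn_def hs_norm_sq_add using elim by (simp add: field_simps power2_eq_square)
        moreover have "real n * S * hs_norm_sq T \<le> real n * S" using hs S by (intro mult_left_le) auto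
        ultimately have "r \<le> M + 2 * S * hs_inner T H + S * hs_norm_sq H / real n" by linarith
        thus ?case unfolding r(2) by (rule ennreal_leI)
      qed
    qed
    also have "\<dots> = ennreal (M + 2 * S * hs_inner T H)"
    proof (rule lim_imp_Liminf)
      have "(\<lambda>n. ennreal (M + 2 * S * hs_inner T H + S * hs_norm_sq H / real n)) \<longlonglongrightarrow> ennreal (M + 2 * S * hs_inner T H + 0)"
        by (intro tendsto_ennrealI tendsto_intros lim_const_over_n)
      thus "(\<lambda>n. ennreal (M + 2 * S * hs_inner T H + S * hs_norm_sq H / real n)) \<longlonglongrightarrow> ennreal (M + 2 * S * hs_inner T H)" by simp
    qed simp
    finally show "(\<integral>\<^sup>+t. ennreal (2 * inner (T (X t)) (H (X t)) + M) * indicator vor_coords t \<partial>Rd_lborel k)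
      \<le> ennreal (M + 2 * S * hs_inner T H)" .
  qed
qed

lemma vor_integrable:
  assumes f: "f \<in> borel_measurable borel" and bd: "\<And>x. x \<in> V \<Longrightarrow> x \<in> vor \<Longrightarrow> \<bar>f x\<bar> \<le> C"
  shows "integrable (Rd_lborel k) (\<lambda>t. indicator vor_coords t * f (X t) :: real)"
proof (rule Bochner_Integration.integrable_bound[where f = "\<lambda>t. indicator vor_coords t * C"])
  note [measurable] = f
  show "integrable (Rd_lborel k) (\<lambda>t. indicator vor_coords t * C)"
    using emeasure_vor_coords by (intro integrable_mult_left) (simp add: integrable_indicator_iff)
  show "(\<lambda>t. indicator vor_coords t * f (X t)) \<in> borel_measurable (Rd_lborel k)" by measurable
  show "AE t in Rd_lborel k. norm (indicator vor_coords t * f (X t)) \<le> norm (indicator vor_coords t * C)"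
    using bd lincomb_in_span by (intro AE_I2) (force simp: indicator_def vor_coords_def)
qed

text \<open>A large \<open>M\<close> makes both the integrand and the bound nonnegative, so the
  \<open>ennreal\<close> inequality can be read in the reals; there \<open>M\<close> cancels because
  the cell has measure one.\<close>

lemma variation:
  assumes H: "linear H" and S: "S \<ge> 0"
    and max: "\<And>T'. linear T' \<Longrightarrow> second_moment k b T' \<le> ennreal (S * hs_norm_sq T')"
    and att: "ennreal S \<le> second_moment k b T" and hs: "hs_norm_sq T \<le> 1"
  shows "(LINT t|Rd_lborel k. indicator vor_coords t * inner (T (X t)) (H (X t))) \<le> S * hs_inner T H"
proof -
  note [measurable] = linear_borel_measurable[OF H]
  obtain R where R: "R > 0" "\<And>x. x \<in> V \<Longrightarrow> x \<in> vor \<Longrightarrow> norm x \<le> R" using vor_bounded by blast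
  define C where "C = (sqrt (hs_norm_sq T) * R) * (sqrt (hs_norm_sq H) * R)"
  have C: "\<bar>inner (T x) (H x)\<bar> \<le> C" if "x \<in> V" "x \<in> vor" for x
  proof -
    have "\<bar>inner (T x) (H x)\<bar> \<le> norm (T x) * norm (H x)" by (rule Cauchy_Schwarz_ineq2)
    also have "\<dots> \<le> (sqrt (hs_norm_sq T) * norm x) * (sqrt (hs_norm_sq H) * norm x)"
      by (intro mult_mono norm_le_sqrt_hs T H) (auto simp: hs_norm_sq_nonneg)
    also have "\<dots> \<le> C" unfolding C_def using R(2)[OF that] hs_norm_sq_nonneg[of T] hs_norm_sq_nonneg[of H] R(1)
      by (intro mult_mono mult_left_mono) auto
    finally show ?thesis .
  qed
  obtain M0 where M0: "\<And>M. M \<ge> M0 \<Longrightarrow>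
    (\<integral>\<^sup>+t. ennreal (2 * inner (T (X t)) (H (X t)) + M) * indicator vor_coords t \<partial>Rd_lborel k)
      \<le> ennreal (M + 2 * S * hs_inner T H)" using variation_nn[OF H S max att hs] by blast
  define M where "M = max M0 (2 * C + \<bar>2 * S * hs_inner T H\<bar>)"
  let ?q = "\<lambda>t. indicator vor_coords t * inner (T (X t)) (H (X t))"
  have int1: "integrable (Rd_lborel k) ?q"
    by (rule vor_integrable[where f = "\<lambda>x. inner (T x) (H x)"]) (use C in \<open>auto intro!: borel_measurable_inner\<close>)
  have int2: "integrable (Rd_lborel k) (\<lambda>t. indicator vor_coords t * M)"
    using emeasure_vor_coords by (intro integrable_mult_left) (simp add: integrable_indicator_iff)
  have mv: "measure (Rd_lborel k) vor_coords = 1" using emeasure_vor_coords by (simp add: measure_def)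
  have "(LINT t|Rd_lborel k. 2 * ?q t + indicator vor_coords t * M) = 2 * (LINT t|Rd_lborel k. ?q t) + M"
    using int1 int2 mv by (subst Bochner_Integration.integral_add) auto
  moreover have "ennreal (LINT t|Rd_lborel k. 2 * ?q t + indicator vor_coords t * M) =
      (\<integral>\<^sup>+t. ennreal (2 * ?q t + indicator vor_coords t * M) \<partial>Rd_lborel k)"
  proof (rule nn_integral_eq_integral[symmetric])
    show "integrable (Rd_lborel k) (\<lambda>t. 2 * ?q t + indicator vor_coords t * M)"
      using int1 int2 by (intro Bochner_Integration.integrable_add) auto
    show "AE t in Rd_lborel k. 0 \<le> 2 * ?q t + indicator vor_coords t * M"
    proof (intro AE_I2)
      fix t show "0 \<le> 2 * ?q t + indicator vor_coords t * M"
        using C[of "X t"] lincomb_in_span[of k b t] by (auto simp: indicator_def vor_coords_def M_def)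
    qed
  qed
  moreover have "(\<integral>\<^sup>+t. ennreal (2 * ?q t + indicator vor_coords t * M) \<partial>Rd_lborel k) =
      (\<integral>\<^sup>+t. ennreal (2 * inner (T (X t)) (H (X t)) + M) * indicator vor_coords t \<partial>Rd_lborel k)"
    by (intro nn_integral_cong) (auto split: split_indicator)
  ultimately have "ennreal (2 * (LINT t|Rd_lborel k. ?q t) + M) \<le> ennreal (M + 2 * S * hs_inner T H)"
    using M0[of M] by (simp add: M_def)
  moreover have "M + 2 * S * hs_inner T H \<ge> 0"
  proof -
    have "C \<ge> 0" unfolding C_def using hs_norm_sq_nonneg[of T] hs_norm_sq_nonneg[of H] R(1)
      by (intro mult_nonneg_nonneg) auto
    thus ?thesis by (simp add: M_def)
  qed
  ultimately show ?thesis by (simp add: ennreal_le_iff)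
qed

text \<open>The test direction has rank one: \<open>H\<close> sends \<open>y\<close> to
  \<open>inner e' y\<close> times a vector \<open>w\<close> with
  \<open>inner (T v) w = inner e v\<close> on the span. Then the integrand is the product of
  \<open>inner e\<close> and \<open>inner e'\<close>, and the Hilbert-Schmidt product is
  \<open>inner e e'\<close>.\<close>

lemma isotropic_moments:
  assumes S: "S \<ge> 0"
    and max: "\<And>T'. linear T' \<Longrightarrow> second_moment k b T' \<le> ennreal (S * hs_norm_sq T')"
    and att: "ennreal S \<le> second_moment k b T" and hs: "hs_norm_sq T \<le> 1" and e: "e \<in> V" "e' \<in> V"
  shows "(LINT t|Rd_lborel k. indicator vor_coords t * (inner e (X t) * inner e' (X t))) = S * inner e e'"
proof -
  have "inj_on T V" unfolding inj_on_def
  proof (intro ballI impI)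
    fix x y assume "x \<in> V" "y \<in> V" "T x = T y"
    thus "x = y" using T_eq_0[of "x - y"] T by (simp add: linear_diff span_diff)
  qed
  then obtain g where g: "linear g" "\<And>v. v \<in> V \<Longrightarrow> g (T v) = v"
    using linear_exists_left_inverse_on[OF T subspace_span, of "b ` {..<k}"] by blast
  \<comment> \<open>The adjoint of a left inverse of \<open>T\<close> solves the equation that
    \<open>w\<close> has to satisfy.\<close>
  define w where "w = adjoint g e"
  have w: "inner (T v) w = inner e v" if "v \<in> V" for v
    unfolding w_def using adjoint_works[OF g(1), of "T v" e] g(2)[OF that] by (simp add: inner_commute)
  define H where "H = (\<lambda>y. inner e' y *\<^sub>R w)"
  have H: "linear H" unfolding H_def by (intro linearI) (auto simp: inner_add_right scaleR_left_distrib)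
  have H': "linear (\<lambda>y. - H y)" using H by (rule linear_compose_neg)
  have TH: "inner (T (X t)) (H (X t)) = inner e (X t) * inner e' (X t)" for t
    using w[OF lincomb_in_span] by (simp add: H_def)
  have hsi: "hs_inner T H = inner e e'"
  proof -
    have "hs_inner T H = inner (\<Sum>i\<in>Basis. inner e' i *\<^sub>R T i) w"
      unfolding hs_inner_def H_def by (simp add: inner_sum_left)
    also have "(\<Sum>i\<in>Basis. inner e' i *\<^sub>R T i) = T (\<Sum>i\<in>Basis. inner e' i *\<^sub>R i)"
      using T by (simp add: linear_sum linear_scale)
    also have "\<dots> = T e'" by (simp add: euclidean_representation)
    finally show ?thesis using w[OF e(2)] by simp
  qed
  have hsn: "hs_inner T (\<lambda>y. - H y) = - inner e e'" using hsi by (simp add: hs_inner_def sum_negf)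
  have 1: "(LINT t|Rd_lborel k. indicator vor_coords t * (inner e (X t) * inner e' (X t))) \<le> S * inner e e'"
    using variation[OF H S max att hs] unfolding TH hsi .
  have "(LINT t|Rd_lborel k. - (indicator vor_coords t * (inner e (X t) * inner e' (X t)))) \<le> S * (- inner e e')"
    using variation[OF H' S max att hs] unfolding hsn by (simp add: TH)
  thus ?thesis using 1 by simp
qed

end

section \<open>The rescaled Voronoi cell as an isotropic body\<close>

lemma indep_family_le_DIM:
  assumes "indep_family k (b :: nat \<Rightarrow> 'a::euclidean_space)" shows "k \<le> DIM('a)"
proof -
  have "distinct (map b [0..<k]) \<and> independent (set (map b [0..<k]))"
    using assms unfolding indep_family_iff by (simp add: indep_family_def)
  hence "independent (set (map b [0..<k]))" "card (set (map b [0..<k])) = k"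
    using distinct_card[of "map b [0..<k]"] by auto
  thus ?thesis using independent_card_le[of "set (map b [0..<k])"] by simp
qed

context lattice_form
begin

text \<open>Expanding squares exhibits the cell as an intersection of half-spaces, from which
  closedness, convexity and symmetry follow.\<close>

lemma vor_iff: "x \<in> vor \<longleftrightarrow> (\<forall>z\<in>N. 2 * inner (T x) (T z) \<le> inner (T z) (T z))"
proof -
  have "norm (T x) \<le> norm (T (x - z)) \<longleftrightarrow> 2 * inner (T x) (T z) \<le> inner (T z) (T z)" for z
  proof -
    have "norm (T x) \<le> norm (T (x - z)) \<longleftrightarrow> inner (T x) (T x) \<le> inner (T x - T z) (T x - T z)"
      unfolding linear_diff[OF T] by (rule norm_le)
    also have "inner (T x - T z) (T x - T z) = inner (T x) (T x) - 2 * inner (T x) (T z) + inner (T z) (T z)"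
      by (simp add: inner_diff_left inner_diff_right inner_commute[of "T z" "T x"])
    finally show ?thesis by simp
  qed
  thus ?thesis by (simp add: vor_def)
qed

lemma closed_vor: "closed vor"
proof -
  have cont: "continuous_on UNIV T" using linear_continuous_on[of T UNIV] T by (simp add: linear_linear)
  have "vor = (\<Inter>z\<in>N. {x. 2 * inner (T x) (T z) \<le> inner (T z) (T z)})"
    by (auto simp: vor_iff)
  also have "closed \<dots>" using cont by (intro closed_INT ballI closed_Collect_le continuous_intros)
  finally show ?thesis .
qed

lemma vor_uminus: "x \<in> vor \<Longrightarrow> - x \<in> vor"
  unfolding vor_iff
proof
  fix z assume x: "\<forall>z\<in>N. 2 * inner (T x) (T z) \<le> inner (T z) (T z)" and z: "z \<in> N"
  have "2 * inner (T x) (T (- z)) \<le> inner (T (- z)) (T (- z))" using x discrete_subgroupD(4)[OF discrete_N z] by blast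
  thus "2 * inner (T (- x)) (T z) \<le> inner (T z) (T z)" by (simp add: linear_neg[OF T])
qed

lemma vor_convex_comb:
  assumes "x \<in> vor" "y \<in> vor" "0 \<le> s" "s \<le> 1" shows "(1 - s) *\<^sub>R x + s *\<^sub>R y \<in> vor"
  unfolding vor_iff
proof
  fix z assume z: "z \<in> N"
  have "(1 - s) * (2 * inner (T x) (T z)) + s * (2 * inner (T y) (T z)) \<le>
      (1 - s) * inner (T z) (T z) + s * inner (T z) (T z)"
    using assms z by (intro add_mono mult_left_mono) (auto simp: vor_iff)
  thus "2 * inner (T ((1 - s) *\<^sub>R x + s *\<^sub>R y)) (T z) \<le> inner (T z) (T z)"
    unfolding linear_add[OF T] linear_scale[OF T] inner_add_left inner_scaleR_left
    by (simp add: algebra_simps)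
qed

text \<open>For \<open>x\<close> short compared with the shortest lattice vector, Cauchy-Schwarz
  gives the half-space inequalities. The summand 1 in the radius keeps the denominator
  positive.\<close>

lemma vor_near_0: obtains \<rho> where "\<rho> > 0" "\<And>x. norm x < \<rho> \<Longrightarrow> x \<in> vor"
proof -
  obtain m where m: "m > 0" "\<And>z. z \<in> N \<Longrightarrow> z \<noteq> 0 \<Longrightarrow> m \<le> norm z"
  proof -
    define F where "F = (N \<inter> cball 0 1) - {0}"
    have fin: "finite F" using discrete_subgroupD(3)[OF discrete_N] by (simp add: F_def)
    define m where "m = Min (insert 1 (norm ` F))"
    have "m > 0" unfolding m_def using fin by (subst Min_gr_iff) (auto simp: F_def)
    moreover have "m \<le> norm z" if "z \<in> N" "z \<noteq> 0" for z
    proof (cases "norm z \<le> 1")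
      case True
      hence "z \<in> F" using that by (simp add: F_def)
      thus ?thesis unfolding m_def using fin by (intro Min_le) auto
    next
      case False
      have "m \<le> 1" unfolding m_def using fin by (intro Min_le) auto
      thus ?thesis using False by simp
    qed
    ultimately show ?thesis using that by blast
  qed
  define h where "h = sqrt (hs_norm_sq T)"
  have h: "h \<ge> 0" by (simp add: h_def hs_norm_sq_nonneg)
  show ?thesis
  proof (rule that[of "c * m / (2 * (h + 1))"])
    show "c * m / (2 * (h + 1)) > 0" using c m h by simp
    fix x :: 'a assume x: "norm x < c * m / (2 * (h + 1))"
    show "x \<in> vor" unfolding vor_iff
    proof
      fix z assume z: "z \<in> N"
      show "2 * inner (T x) (T z) \<le> inner (T z) (T z)"
      proof (cases "z = 0")
        case True thus ?thesis by (simp add: linear_0[OF T])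
      next
        case False
        have "2 * norm (T x) \<le> 2 * (h * norm x)" using norm_le_sqrt_hs[OF T, of x] by (simp add: h_def)
        also have "\<dots> \<le> 2 * ((h + 1) * norm x)" by (intro mult_left_mono mult_right_mono) auto
        also have "\<dots> \<le> c * m" using x h by (simp add: field_simps)
        also have "\<dots> \<le> c * norm z" using m(2)[OF z False] c by (intro mult_left_mono) auto
        also have "\<dots> \<le> norm (T z)" by (rule low) (use z N_sub_V in blast)
        finally have le: "2 * norm (T x) \<le> norm (T z)" .
        have "2 * inner (T x) (T z) \<le> 2 * (norm (T x) * norm (T z))" using norm_cauchy_schwarz[of "T x" "T z"] by simp
        also have "\<dots> \<le> norm (T z) * norm (T z)" using mult_right_mono[OF le norm_ge_zero[of "T z"]] by simp
        also have "\<dots> = inner (T z) (T z)" by (simp add: power2_norm_eq_inner[symmetric] power2_eq_square)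
        finally show ?thesis .
      qed
    qed
  qed
qed

text \<open>Orthonormal coordinates scaled by \<open>r\<close> turn the cell into a body of volume
  one with second moments \<open>r\<^sup>2 * S\<close>, to which the isotropic constant
  applies.\<close>

lemma maximizer_bound:
  assumes k: "k > 0" and S: "S > 0"
    and max: "\<And>T'. linear T' \<Longrightarrow> second_moment k b T' \<le> ennreal (S * hs_norm_sq T')"
    and att: "ennreal S \<le> second_moment k b T" and hs: "hs_norm_sq T \<le> 1"
  obtains r where "r > 0" "r ^ k * gs_prod k b = 1" "r\<^sup>2 * S \<le> (isotropic_constant DIM('a))\<^sup>2"
proof -
  define e where "e = gs_frame b"
  have eV: "e i \<in> V" if "i < k" for i unfolding e_def by (rule gs_frame_in_span[OF that])
  have orth: "inner (e i) (e j) = (if i = j then 1 else 0)" if "i < k" "j < k" for i j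
    unfolding e_def by (rule gs_frame_orthonormal[OF ind that])
  define g where "g = gs_prod k b"
  have g: "g > 0" unfolding g_def by (rule gs_prod_pos[OF ind])
  \<comment> \<open>Chosen so that the triangular map \<open>F\<close> has determinant 1 and
    preserves measure.\<close>
  define r where "r = g powr (- (1 / real k))"
  have r: "r > 0" using g by (simp add: r_def)
  have "r ^ k = g powr (- 1)" unfolding r_def using g k by (simp add: powr_powr powr_realpow[symmetric])
  hence rk: "r ^ k * g = 1" using g by (simp add: powr_minus)
  define F where "F = (\<lambda>t. \<lambda>i\<in>{..<k}. r * inner (e i) (X t))"
  have Fmat: "F t = (\<lambda>i\<in>{..<k}. \<Sum>j<k. (r * inner (e i) (b j)) * t j)" for t
    unfolding F_def by (simp add: lincomb_def inner_sum_right sum_distrib_left mult_ac)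
  have Fm [measurable]: "F \<in> measurable (Rd_lborel k) (Rd_lborel k)" unfolding F_def by measurable
  have prod1: "(\<Prod>i<k. r * inner (e i) (b i)) = 1"
    using rk gs_frame_diag[OF ind] by (simp add: prod.distrib e_def g_def gs_prod_def)
  have nnF: "(\<integral>\<^sup>+t. f (F t) \<partial>Rd_lborel k) = (\<integral>\<^sup>+x. f x \<partial>Rd_lborel k)" if f: "f \<in> borel_measurable (Rd_lborel k)" for f
  proof -
    have "ennreal (\<Prod>i<k. r * inner (e i) (b i)) * (\<integral>\<^sup>+t. f (\<lambda>i\<in>{..<k}. \<Sum>j<k. (r * inner (e i) (b j)) * t j) \<partial>Rd_lborel k)
      = (\<integral>\<^sup>+x. f x \<partial>Rd_lborel k)"
      by (rule nn_integral_triangular[OF f])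
        (use r gs_frame_diag[OF ind] gs_nonzero[OF ind] gs_frame_orth_less(1) in \<open>auto simp: e_def\<close>)
    thus ?thesis unfolding prod1 Fmat by simp
  qed
  have dF: "distr (Rd_lborel k) (Rd_lborel k) F = Rd_lborel k"
  proof (rule measure_eqI)
    fix A assume "A \<in> sets (distr (Rd_lborel k) (Rd_lborel k) F)"
    hence [measurable]: "A \<in> sets (Rd_lborel k)" by simp
    have "emeasure (distr (Rd_lborel k) (Rd_lborel k) F) A = (\<integral>\<^sup>+x. indicator A x \<partial>distr (Rd_lborel k) (Rd_lborel k) F)"
      by simp
    also have "\<dots> = (\<integral>\<^sup>+t. indicator A (F t) \<partial>Rd_lborel k)" by (rule nn_integral_distr) measurable
    also have "\<dots> = emeasure (Rd_lborel k) A" by (subst nnF) auto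
    finally show "emeasure (distr (Rd_lborel k) (Rd_lborel k) F) A = emeasure (Rd_lborel k) A" .
  qed simp
  \<comment> \<open>Undoes \<open>F\<close> and lands in the ambient space, so that the properties
    of \<open>vor\<close> can be pulled back to \<open>K\<close>.\<close>
  define Y where "Y = (\<lambda>x. (1 / r) *\<^sub>R lincomb k e x)"
  have YF: "Y (F t) = X t" for t
  proof -
    have "lincomb k e (F t) = r *\<^sub>R (\<Sum>i<k. inner (e i) (X t) *\<^sub>R e i)"
      by (simp add: lincomb_def F_def scaleR_sum_right)
    also have "(\<Sum>i<k. inner (e i) (X t) *\<^sub>R e i) = X t"
      unfolding e_def using gs_frame_expand[OF ind order_refl lincomb_in_span] by simp
    finally show ?thesis using r by (simp add: Y_def)
  qed
  have YV: "Y x \<in> V" for x unfolding Y_def lincomb_def using eV by (intro span_scale span_sum) auto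
  have eY: "inner (e i) (Y x) = x i / r" if "i < k" for i x
  proof -
    have "inner (e i) (lincomb k e x) = (\<Sum>j<k. if j = i then x j else 0)"
      unfolding lincomb_def inner_sum_right using orth that by (intro sum.cong) auto
    thus ?thesis using that by (simp add: Y_def)
  qed
  have Ym [measurable]: "Y \<in> borel_measurable (Rd_lborel k)" unfolding Y_def by measurable
  have Yc: "continuous_map (Rd_top k) euclidean Y"
  proof -
    have "continuous_map euclidean euclidean (\<lambda>y::'a. (1 / r) *\<^sub>R y)" by (simp add: continuous_intros)
    from continuous_map_compose[OF continuous_map_lincomb this] show ?thesis by (simp add: Y_def o_def)
  qed
  define K where "K = {x \<in> extensional {..<k}. Y x \<in> vor}"
  have Ks [measurable]: "K \<in> sets (Rd_lborel k)"
  proof -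
    have [measurable]: "vor \<in> sets borel" by (rule borel_closed[OF closed_vor])
    have "K = {x \<in> space (Rd_lborel k). Y x \<in> vor}" by (simp add: K_def space_Rd)
    also have "\<dots> \<in> sets (Rd_lborel k)" by measurable
    finally show ?thesis .
  qed
  have FK: "F t \<in> K \<longleftrightarrow> t \<in> vor_coords" if "t \<in> space (Rd_lborel k)" for t
    using that by (simp add: K_def vor_coords_def YF) (simp add: F_def)
  have measK: "measure (Rd_lborel k) K = 1"
  proof -
    have "emeasure (Rd_lborel k) K = (\<integral>\<^sup>+x. indicator K x \<partial>Rd_lborel k)" by simp
    also have "\<dots> = (\<integral>\<^sup>+t. indicator K (F t) \<partial>Rd_lborel k)" by (rule nnF[symmetric]) measurable
    also have "\<dots> = (\<integral>\<^sup>+t. indicator vor_coords t \<partial>Rd_lborel k)"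
      using FK by (intro nn_integral_cong) (auto split: split_indicator)
    also have "\<dots> = 1" using emeasure_vor_coords by simp
    finally show ?thesis by (simp add: measure_def)
  qed
  have mom: "(LINT x:K|Rd_lborel k. x i * x j) = (if i = j then r\<^sup>2 * S else 0)" if ij: "i < k" "j < k" for i j
  proof -
    have m: "(\<lambda>x. indicator K x *\<^sub>R (x i * x j)) \<in> borel_measurable (Rd_lborel k)"
      using ij measurable_coordinate by measurable
    have "(LINT x:K|Rd_lborel k. x i * x j) = (LINT x|distr (Rd_lborel k) (Rd_lborel k) F. indicator K x *\<^sub>R (x i * x j))"
      unfolding dF set_lebesgue_integral_def ..
    also have "\<dots> = (LINT t|Rd_lborel k. indicator K (F t) *\<^sub>R (F t i * F t j))"
      by (rule integral_distr[OF Fm m])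
    also have "\<dots> = (LINT t|Rd_lborel k. r\<^sup>2 * (indicator vor_coords t * (inner (e i) (X t) * inner (e j) (X t))))"
      using FK ij by (intro Bochner_Integration.integral_cong refl)
        (simp add: F_def power2_eq_square split: split_indicator)
    also have "\<dots> = r\<^sup>2 * (S * inner (e i) (e j))"
      using isotropic_moments[OF less_imp_le[OF S] max att hs eV[OF ij(1)] eV[OF ij(2)]] by simp
    finally show ?thesis using orth[OF ij] by simp
  qed
  have iso: "isotropic_body k K"
    unfolding isotropic_body_def
  proof (intro conjI)
    obtain R where R: "R > 0" "\<And>x. x \<in> V \<Longrightarrow> x \<in> vor \<Longrightarrow> norm x \<le> R" using vor_bounded by blast
    have xb: "\<bar>x i\<bar> \<le> r * R" if "x \<in> K" "i < k" for x i
    proof -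
      have "norm (e i) = 1" using orth[OF that(2,2)] by (simp add: norm_eq_sqrt_inner)
      hence "\<bar>x i / r\<bar> \<le> norm (Y x)" using Cauchy_Schwarz_ineq2[of "e i" "Y x"] eY[OF that(2)] by simp
      also have "\<dots> \<le> R" using R(2)[OF YV] that(1) by (simp add: K_def)
      finally show ?thesis using r by (simp add: field_simps abs_divide)
    qed
    have "compactin (Rd_top k) (PiE {..<k} (\<lambda>_. {- (r * R)..r * R}))"
      by (simp add: compactin_PiE)
    moreover have "K \<subseteq> PiE {..<k} (\<lambda>_. {- (r * R)..r * R})"
    proof
      fix x assume x: "x \<in> K"
      have "x \<in> extensional {..<k}" using x by (simp add: K_def)
      moreover have "x i \<in> {- (r * R)..r * R}" if "i < k" for i using xb[OF x that] by (simp add: abs_le_iff)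
      ultimately show "x \<in> PiE {..<k} (\<lambda>_. {- (r * R)..r * R})" by (simp add: PiE_iff)
    qed
    moreover have "closedin (Rd_top k) K"
    proof -
      have "closedin (Rd_top k) {x \<in> topspace (Rd_top k). Y x \<in> vor}"
        by (rule closedin_continuous_map_preimage[OF Yc]) (simp add: closed_vor)
      thus ?thesis unfolding topspace_Rd_top K_def .
    qed
    ultimately have comp: "compactin (Rd_top k) K" by (rule closed_compactin)
    have int: "Rd_top k interior_of K \<noteq> {}"
    proof -
      obtain \<rho> where rho: "\<rho> > 0" "\<And>x. norm x < \<rho> \<Longrightarrow> x \<in> vor" using vor_near_0 by blast
      define O' where "O' = {x \<in> topspace (Rd_top k). Y x \<in> ball 0 \<rho>}"
      have "openin (Rd_top k) O'" unfolding O'_def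
        by (rule openin_continuous_map_preimage[OF Yc]) simp
      moreover have "O' \<subseteq> K"
      proof
        fix x assume "x \<in> O'"
        hence "x \<in> extensional {..<k}" "norm (Y x) < \<rho>" unfolding O'_def topspace_Rd_top by auto
        thus "x \<in> K" using rho(2) by (simp add: K_def)
      qed
      ultimately have "O' \<subseteq> Rd_top k interior_of K" by (intro interior_of_maximal)
      moreover have "(\<lambda>i\<in>{..<k}. 0) \<in> O'"
        unfolding O'_def topspace_Rd_top using rho(1) by (simp add: Y_def lincomb_def)
      ultimately show ?thesis by blast
    qed
    have conv: "(\<lambda>i\<in>{..<k}. (1 - s) * x i + s * y i) \<in> K" if "x \<in> K" "y \<in> K" "s \<in> {0..1}" for x y s
    proof -
      have "Y (\<lambda>i\<in>{..<k}. (1 - s) * x i + s * y i) = (1 - s) *\<^sub>R Y x + s *\<^sub>R Y y"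
        by (simp add: Y_def lincomb_def scaleR_left_distrib sum.distrib scaleR_sum_right scaleR_add_right add_divide_distrib mult_ac)
      also have "\<dots> \<in> vor" using that by (intro vor_convex_comb) (auto simp: K_def)
      finally show ?thesis by (simp add: K_def)
    qed
    show "convex_body k K" unfolding convex_body_def using comp int conv by blast
    have neg: "(\<lambda>i\<in>{..<k}. - x i) \<in> K" if "x \<in> K" for x
    proof -
      have "Y (\<lambda>i\<in>{..<k}. - x i) = - Y x" by (simp add: Y_def lincomb_def sum_negf)
      also have "\<dots> \<in> vor" using that by (intro vor_uminus) (auto simp: K_def)
      finally show ?thesis by (simp add: K_def)
    qed
    show "symmetric_body k K" unfolding symmetric_body_def
    proof
      show "(\<lambda>x. \<lambda>i\<in>{..<k}. - x i) ` K \<subseteq> K" using neg by blast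
      show "K \<subseteq> (\<lambda>x. \<lambda>i\<in>{..<k}. - x i) ` K"
      proof
        fix x assume x: "x \<in> K"
        have "x = (\<lambda>i\<in>{..<k}. - (\<lambda>i\<in>{..<k}. - x i) i)"
          using x by (auto simp: K_def extensional_def)
        thus "x \<in> (\<lambda>x. \<lambda>i\<in>{..<k}. - x i) ` K" using neg[OF x] by (rule image_eqI)
      qed
    qed
    show "\<exists>\<alpha>>0. \<forall>i<k. \<forall>j<k. (LINT x:K|Rd_lborel k. x i * x j) = (if i = j then \<alpha> else 0)"
      using mom S r by (intro exI[of _ "r\<^sup>2 * S"]) simp
  qed
  have "real k * (r\<^sup>2 * S) = (LINT x:K|Rd_lborel k. (L2_set x {..<k})\<^sup>2)"
    using mom by (intro isotropic_moment_eq[OF iso measK, symmetric]) simp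
  also have "\<dots> \<le> real k * (isotropic_constant DIM('a))\<^sup>2"
    by (rule isotropic_moment_le(1)[OF k indep_family_le_DIM[OF ind] iso measK])
  finally have "r\<^sup>2 * S \<le> (isotropic_constant DIM('a))\<^sup>2" using k by simp
  thus ?thesis using that[OF r] rk by (simp add: g_def)
qed

end

section \<open>Lattices with bounded quotient determinants\<close>

lemma lattice_basis_map: "indep_family k b \<Longrightarrow> lattice_basis (map b [0..<k]) (zspan k b)"
  unfolding lattice_basis_iff by (simp add: indep_family_def zspan_def)

lemma dim_span_zspan:
  fixes b :: "nat \<Rightarrow> 'a::euclidean_space"
  shows "indep_family k b \<Longrightarrow> dim (span (zspan k b)) = k"
  using lattice_basis_length[OF lattice_basis_map[of k b]] by simp

lemma lattice_det_zspan: assumes "indep_family k b" shows "lattice_det (zspan k b) = gs_prod k b"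
proof -
  have "gs (\<lambda>i. map b [0..<k] ! i) i = gs b i" if "i < k" for i
  proof -
    have "(!) (map b [0..<k]) ` {..<i} = b ` {..<i}" using that by (intro image_cong) auto
    thus ?thesis using that by (simp add: gs_def)
  qed
  thus ?thesis using lattice_det_eq[OF lattice_basis_map[OF assms]] by (simp add: gs_prod_def)
qed

text \<open>Dirichlet's argument: multiples of \<open>u\<close> stay within bounded distance of the
  lattice, two of the remainders \<open>y\<close> come close, and the difference of the two lattice
  points is nearly a multiple of \<open>u\<close>, which \<open>T\<close> kills. Remainders closer
  than \<open>norm u\<close> exclude the zero vector.\<close>

lemma short_vector:
  fixes T :: "'a::euclidean_space \<Rightarrow>\<^sub>L 'a"
  assumes ind: "indep_family k b" and u: "u \<in> span (b ` {..<k})" "u \<noteq> 0" "T u = 0" and eps: "\<epsilon> > 0"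
  obtains v where "v \<in> zspan k b" "v \<noteq> 0" "norm (T v) \<le> \<epsilon>"
proof -
  have N: "discrete_subgroup (zspan k b)" by (rule discrete_zspan[OF ind])
  obtain R where R: "R > 0" "\<And>x. x \<in> span (b ` {..<k}) \<Longrightarrow> \<exists>z\<in>zspan k b. norm (x - z) \<le> R"
    using lattice_cover_bound[of b k] by blast
  have "\<forall>m::nat. \<exists>z. z \<in> zspan k b \<and> norm (real m *\<^sub>R u - z) \<le> R" using R(2) u(1) span_scale by blast
  from choice[OF this] obtain z where z: "\<And>m::nat. z m \<in> zspan k b" "\<And>m. norm (real m *\<^sub>R u - z m) \<le> R" by blast
  define y where "y = (\<lambda>m. real m *\<^sub>R u - z m)"
  have "seq_compact (cball (0::'a) R)" by (simp add: compact_imp_seq_compact)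
  moreover have "\<forall>n. y n \<in> cball 0 R" using z(2) by (simp add: y_def)
  ultimately obtain l r where r: "strict_mono (r :: nat \<Rightarrow> nat)" "(y \<circ> r) \<longlonglongrightarrow> l" by (rule seq_compactE)
  define \<delta> where "\<delta> = min (\<epsilon> / (norm T + 1)) (norm u)"
  have pos: "norm T + 1 > 0" using norm_ge_zero[of T] by linarith
  have "\<delta> > 0" using eps u pos by (simp add: \<delta>_def)
  hence "\<exists>M. \<forall>m\<ge>M. \<forall>n\<ge>M. norm ((y \<circ> r) m - (y \<circ> r) n) < \<delta>"
    using LIMSEQ_imp_Cauchy[OF r(2)] unfolding Cauchy_iff by blast
  then obtain M where "\<forall>m\<ge>M. \<forall>n\<ge>M. norm ((y \<circ> r) m - (y \<circ> r) n) < \<delta>" by blast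
  hence M: "norm (y (r (Suc M)) - y (r M)) < \<delta>" by simp
  define i where "i = r M"
  define j where "j = r (Suc M)"
  have ij: "i < j" unfolding i_def j_def using r(1) by (simp add: strict_mono_less)
  define v where "v = z j - z i"
  have v: "v = real (j - i) *\<^sub>R u - (y j - y i)"
    using ij by (simp add: v_def y_def of_nat_diff scaleR_left_diff_distrib)
  have "v \<in> zspan k b" unfolding v_def using discrete_subgroupD(2)[OF N z(1) z(1)] .
  moreover have "v \<noteq> 0"
  proof
    assume "v = 0"
    hence "y j - y i = real (j - i) *\<^sub>R u" using v by simp
    hence "norm (y j - y i) = real (j - i) * norm u" by simp
    moreover have "1 * norm u \<le> real (j - i) * norm u" using ij by (intro mult_right_mono) auto
    ultimately show False using M by (simp add: \<delta>_def i_def j_def)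
  qed
  moreover have "norm (T v) \<le> \<epsilon>"
  proof -
    have "T v = - T (y j - y i)" unfolding v by (simp add: blinfun.diff_right blinfun.scaleR_right u(3))
    hence "norm (T v) \<le> norm T * norm (y j - y i)" using norm_blinfun[of T "y j - y i"] by simp
    also have "\<dots> \<le> (norm T + 1) * (\<epsilon> / (norm T + 1))"
      using M by (intro mult_mono) (auto simp: \<delta>_def i_def j_def)
    finally show ?thesis using pos by simp
  qed
  ultimately show ?thesis using that by blast
qed

lemma second_moment_scale:
  assumes T: "linear T" and N: "indep_family k b" and a: "a > 0"
  shows "second_moment k b (\<lambda>x. a *\<^sub>R T x) \<le> ennreal (a\<^sup>2) * second_moment k b T"
proof -
  have lin: "linear (\<lambda>x. a *\<^sub>R T x)" using T by (rule linear_compose_scale_right)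
  note D = discrete_zspan[OF N]
  have le: "dist_sq (zspan k b) (\<lambda>x. a *\<^sub>R T x) x \<le> a\<^sup>2 * dist_sq (zspan k b) T x" for x
  proof -
    have "infdist (a *\<^sub>R T x) ((\<lambda>x. a *\<^sub>R T x) ` zspan k b) / a \<le> infdist (T x) (T ` zspan k b)"
    proof (rule infdist_linear_image_greatest[OF T discrete_subgroupD(1)[OF D]])
      fix z assume "z \<in> zspan k b"
      from infdist_linear_image_le[OF lin this, of x]
      show "infdist (a *\<^sub>R T x) ((\<lambda>x. a *\<^sub>R T x) ` zspan k b) / a \<le> norm (T (x - z))"
        using a by (simp add: field_simps)
    qed
    hence "infdist (a *\<^sub>R T x) ((\<lambda>x. a *\<^sub>R T x) ` zspan k b) \<le> a * infdist (T x) (T ` zspan k b)"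
      using a by (simp add: field_simps)
    hence "(infdist (a *\<^sub>R T x) ((\<lambda>x. a *\<^sub>R T x) ` zspan k b))\<^sup>2 \<le> (a * infdist (T x) (T ` zspan k b))\<^sup>2"
      by (intro power_mono infdist_nonneg)
    thus ?thesis by (simp add: dist_sq_def power_mult_distrib)
  qed
  have [measurable]: "dist_sq (zspan k b) T \<in> borel_measurable borel" by (rule dist_sq_measurable[OF T])
  have "second_moment k b (\<lambda>x. a *\<^sub>R T x) \<le> avg k b (\<lambda>x. ennreal (a\<^sup>2) * ennreal (dist_sq (zspan k b) T x))"
    unfolding second_moment_def using le by (intro avg_mono) (simp add: ennreal_mult'[symmetric] ennreal_leI)
  thus ?thesis unfolding second_moment_def by (subst (asm) avg_cmult) measurable
qed

text \<open>The claim is quadratic in \<open>T\<close>, so it suffices to bound the supremum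
  \<open>M\<close> over the Hilbert-Schmidt unit ball. A maximizing sequence there has a limit
  \<open>T0\<close>, and the two cases are whether \<open>T0\<close> is injective on the
  span.\<close>

lemma second_moment_le:
  fixes b :: "nat \<Rightarrow> 'a::euclidean_space"
  assumes "indep_family k b" "s > 0" "linear T"
    and "\<And>S. S \<subseteq> zspan k b \<Longrightarrow> dim (span S) < k \<Longrightarrow>
      lattice_det (qproj (span S) ` zspan k b) \<le> s ^ (k - dim (span S))"
  shows "second_moment k b T \<le> ennreal ((isotropic_constant DIM('a))\<^sup>2 * s\<^sup>2 * hs_norm_sq T)"
  using assms
proof (induction k arbitrary: b T)
  case 0
  have "second_moment 0 b T \<le> avg 0 b (\<lambda>_. 0)"
    unfolding second_moment_def by (rule avg_mono) (simp add: dist_sq_def zspan_def)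
  thus ?case by (simp add: avg_const)
next
  case (Suc k')
  define k where "k = Suc k'"
  note ind = Suc.prems(1)[folded k_def] and s = Suc.prems(2) and H = Suc.prems(4)[folded k_def]
  let ?N = "zspan k b" and ?V = "span (b ` {..<k})"
  have N: "discrete_subgroup ?N" by (rule discrete_zspan[OF ind])
  define C where "C = (isotropic_constant DIM('a))\<^sup>2 * s\<^sup>2"
  have C0: "C \<ge> 0" by (simp add: C_def)
  \<comment> \<open>The induction hypothesis applies to the projected lattice, since composing with
    a projection does not raise the Hilbert-Schmidt norm; the price is the rounding term along
    \<open>v\<close>.\<close>
  have quot: "second_moment k b T \<le> ennreal (C * hs_norm_sq T + (norm (T v))\<^sup>2 / 4)"
    if T: "linear T" and v: "v \<in> ?N" "v \<noteq> 0" for T v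
  proof -
    let ?P = "qproj (span {v})" and ?T = "\<lambda>y. qproj (span {T v}) (T y)"
    have linP: "linear ?P" by (rule linear_qproj) simp
    have linT: "linear ?T" using linear_compose[OF T linear_qproj[OF subspace_span]] by (simp add: o_def)
    have d1: "dim (span {v}) = 1" using v(2) by (simp add: dim_eq_card_independent)
    obtain bs where bs: "lattice_basis bs (?P ` ?N)"
      using lattice_basis_exists[OF discrete_qproj_singleton[OF N v(1)]] by blast
    have "span (?P ` ?N) = ?P ` span ?N" by (rule linear_span_image[OF linP])
    moreover have "dim (?P ` span ?N) + dim (span {v}) = dim (span ?N)"
      using v by (intro qproj_image_dim span_minimal) (auto intro: span_base)
    ultimately have len: "length bs = k'"
      using lattice_basis_length[OF bs] d1 dim_span_zspan[OF ind] by (simp add: k_def)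
    define b' where "b' = (!) bs"
    have b': "indep_family k' b'" "zspan k' b' = ?P ` ?N"
      using bs len unfolding lattice_basis_iff b'_def by auto
    \<comment> \<open>Projecting further along \<open>S'\<close> is projecting \<open>N\<close>
      along \<open>insert v S\<close>. Rank and dimension both grow by one, so the exponent is
      unchanged.\<close>
    have H': "lattice_det (qproj (span S') ` zspan k' b') \<le> s ^ (k' - dim (span S'))"
      if S': "S' \<subseteq> zspan k' b'" "dim (span S') < k'" for S'
    proof -
      obtain S where S: "S \<subseteq> ?N" "S' = ?P ` S" using S'(1) unfolding b'(2) subset_image_iff by blast
      let ?X = "span (insert v S)"
      have WX: "span {v} \<subseteq> ?X" by (intro span_mono) auto
      have "?P ` ?X = span (?P ` insert v S)" by (rule linear_span_image[OF linP, symmetric])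
      also have "?P ` insert v S = insert 0 S'"
        using qproj_eq_0[OF subspace_span span_base[OF singletonI], of v] by (simp add: S(2))
      finally have PX: "?P ` ?X = span S'" by (simp add: span_insert_0)
      have "dim (?P ` ?X) + dim (span {v}) = dim ?X" by (rule qproj_image_dim) (use WX in auto)
      hence dX: "dim ?X = Suc (dim (span S'))" using d1 PX by simp
      have "qproj (span S') ` zspan k' b' = (\<lambda>x. qproj (?P ` ?X) (?P x)) ` ?N" by (simp add: b'(2) image_image PX)
      also have "\<dots> = qproj ?X ` ?N"
        using qproj_comp[OF subspace_span subspace_span WX] by simp
      finally have eq: "qproj (span S') ` zspan k' b' = qproj ?X ` ?N" .
      have "lattice_det (qproj ?X ` ?N) \<le> s ^ (k - dim ?X)"
        using S(1) v(1) dX S'(2) by (intro H) (auto simp: k_def)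
      thus ?thesis unfolding eq dX by (simp add: k_def)
    qed
    have "hs_norm_sq ?T \<le> hs_norm_sq T"
      unfolding hs_norm_sq_def by (intro sum_mono power_mono norm_qproj_le) auto
    hence "C * hs_norm_sq ?T \<le> C * hs_norm_sq T" using C0 by (rule mult_left_mono)
    moreover have "second_moment k' b' ?T \<le> ennreal (C * hs_norm_sq ?T)"
      unfolding C_def by (rule Suc.IH[OF b'(1) s linT H'])
    ultimately have "second_moment k' b' ?T \<le> ennreal (C * hs_norm_sq T)"
      using order_trans ennreal_leI by blast
    hence "second_moment k b T \<le> ennreal (C * hs_norm_sq T) + ennreal ((norm (T v))\<^sup>2 / 4)"
      using second_moment_quotient_le[OF ind T v(1) b'] by (meson add_right_mono order_trans)
    thus ?thesis using C0 hs_norm_sq_nonneg[of T] by (simp add: ennreal_plus)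
  qed
  obtain R where R: "R \<ge> 0" "\<And>T. linear T \<Longrightarrow> second_moment k b T \<le> ennreal (R * hs_norm_sq T)"
    using second_moment_bounded[of k b] by metis
  \<comment> \<open>Bounded linear functions on a Euclidean space form a finite-dimensional normed
    space, so this ball is compact.\<close>
  define K where "K = {T :: 'a \<Rightarrow>\<^sub>L 'a. hs_norm_sq (blinfun_apply T) \<le> 1}"
  define G where "G = (\<lambda>T :: 'a \<Rightarrow>\<^sub>L 'a. enn2real (second_moment k b (blinfun_apply T)))"
  have linB: "linear (blinfun_apply T)" for T :: "'a \<Rightarrow>\<^sub>L 'a"
    using blinfun.bounded_linear_right[of T] by (rule bounded_linear.linear)
  have smG: "second_moment k b (blinfun_apply T) = ennreal (G T)" for T
    unfolding G_def by (rule ennreal_enn2real[OF le_less_trans[OF R(2)[OF linB] ennreal_less_top], symmetric])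
  have G0: "G T \<ge> 0" for T by (simp add: G_def)
  have GR: "G T \<le> R" if "T \<in> K" for T
  proof -
    have "ennreal (G T) \<le> ennreal (R * hs_norm_sq T)" unfolding smG[symmetric] by (rule R(2)[OF linB])
    hence "G T \<le> R * hs_norm_sq T" using R(1) hs_norm_sq_nonneg[of T] by (simp add: ennreal_le_iff)
    also have "\<dots> \<le> R" using that R(1) by (simp add: K_def mult_left_le)
    finally show ?thesis .
  qed
  have zero: "0 \<in> K" by (simp add: K_def hs_norm_sq_def)
  define M where "M = Sup (G ` K)"
  have bdd: "bdd_above (G ` K)" using GR by (intro bdd_aboveI2)
  have GM: "G T \<le> M" if "T \<in> K" for T unfolding M_def using that bdd by (rule cSUP_upper)
  have M0: "M \<ge> 0" using GM[OF zero] G0[of 0] by linarith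
  \<comment> \<open>Homogeneity carries the bound from the unit ball to all linear maps, the form in
    which the first variation uses maximality.\<close>
  have max: "second_moment k b T \<le> ennreal (M * hs_norm_sq T)" if T: "linear T" for T
  proof (cases "hs_norm_sq T = 0")
    case True thus ?thesis using R(2)[OF T] by simp
  next
    case False
    define a where "a = sqrt (hs_norm_sq T)"
    have a: "a > 0" "a\<^sup>2 = hs_norm_sq T" using False hs_norm_sq_nonneg[of T] by (auto simp: a_def)
    define T1 where "T1 = (\<lambda>x. (1 / a) *\<^sub>R T x)"
    have lin1: "linear T1" unfolding T1_def using T by (rule linear_compose_scale_right)
    have "hs_norm_sq T1 = hs_norm_sq T / a\<^sup>2"
      unfolding hs_norm_sq_def T1_def by (simp add: power_divide sum_divide_distrib)
    hence hs1: "hs_norm_sq T1 = 1" using a False by simp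
    have B: "blinfun_apply (Blinfun T1) = T1" using lin1 by (intro bounded_linear_Blinfun_apply) (simp add: linear_linear)
    have "Blinfun T1 \<in> K" by (simp add: K_def B hs1)
    hence "second_moment k b T1 \<le> ennreal M" using GM[of "Blinfun T1"] smG[of "Blinfun T1"] by (simp add: B ennreal_leI)
    hence "ennreal (a\<^sup>2) * second_moment k b T1 \<le> ennreal (a\<^sup>2) * ennreal M" by (rule mult_left_mono) simp
    moreover have "second_moment k b (\<lambda>x. a *\<^sub>R T1 x) \<le> ennreal (a\<^sup>2) * second_moment k b T1"
      by (rule second_moment_scale[OF lin1 ind a(1)])
    moreover have "(\<lambda>x. a *\<^sub>R T1 x) = T" using a by (simp add: T1_def)
    ultimately show ?thesis using a(2) M0 by (simp add: ennreal_mult'[symmetric] mult.commute)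
  qed
  have "M \<le> C"
  proof -
    have "\<forall>j::nat. \<exists>T. T \<in> K \<and> M - 1 / real (Suc j) < G T"
    proof
      fix j :: nat
      have "M - 1 / real (Suc j) < Sup (G ` K)" by (simp add: M_def)
      thus "\<exists>T. T \<in> K \<and> M - 1 / real (Suc j) < G T"
        using less_cSUP_iff[OF _ bdd] zero by blast
    qed
    from choice[OF this] obtain Tj where Tj: "\<And>j. Tj j \<in> K" "\<And>j. M - 1 / real (Suc j) < G (Tj j)" by blast
    have "closed K" unfolding K_def hs_norm_sq_def by (intro closed_Collect_le continuous_intros)
    moreover have "bounded K" unfolding bounded_iff
    proof (intro exI ballI)
      fix T assume "T \<in> K"
      show "norm T \<le> 1"
      proof (rule norm_blinfun_bound)
        fix x
        have "norm (T x) \<le> sqrt (hs_norm_sq T) * norm x" by (rule norm_le_sqrt_hs[OF linB])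
        also have "\<dots> \<le> 1 * norm x" using \<open>T \<in> K\<close> by (intro mult_right_mono) (auto simp: K_def)
        finally show "norm (T x) \<le> 1 * norm x" .
      qed simp
    qed
    ultimately have "seq_compact K" by (simp add: compact_imp_seq_compact compact_eq_bounded_closed)
    moreover have "\<forall>n. Tj n \<in> K" using Tj(1) by blast
    ultimately obtain T0 r where T0: "T0 \<in> K" and r: "strict_mono (r :: nat \<Rightarrow> nat)" "(Tj \<circ> r) \<longlonglongrightarrow> T0"
      by (rule seq_compactE)
    define U where "U = (\<lambda>j. Tj (r j))"
    have U: "U \<longlonglongrightarrow> T0" using r(2) by (simp add: U_def o_def)
    have UK: "U j \<in> K" for j by (simp add: U_def Tj(1))
    have lowlim: "(\<lambda>j. M - 1 / real (Suc (r j))) \<longlonglongrightarrow> M"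
    proof -
      have "(\<lambda>j. 1 / real (Suc j)) \<longlonglongrightarrow> 0" using LIMSEQ_inverse_real_of_nat by (simp add: inverse_eq_divide)
      hence "(\<lambda>j. 1 / real (Suc (r j))) \<longlonglongrightarrow> 0" using LIMSEQ_subseq_LIMSEQ[OF _ r(1)] by (force simp: o_def)
      hence "(\<lambda>j. M - 1 / real (Suc (r j))) \<longlonglongrightarrow> M - 0" by (intro tendsto_intros)
      thus ?thesis by simp
    qed
    have lowG: "M - 1 / real (Suc (r j)) \<le> G (U j)" for j using Tj(2)[of "r j"] by (simp add: U_def)
    show ?thesis
    proof (cases "\<forall>y\<in>?V. T0 y = 0 \<longrightarrow> y = 0")
      case True
      obtain c where c: "c > 0" "\<forall>y\<in>?V. norm (T0 y) \<ge> c * norm y"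
        using injective_imp_isometric[OF closed_subspace[OF subspace_span] subspace_span blinfun.bounded_linear_right True] by blast
      interpret lattice_form k b "blinfun_apply T0" c
        by (rule lattice_form.intro[OF ind linB c(1)]) (use c(2) in blast)
      \<comment> \<open>Upper semicontinuity at an injective limit, by the relative distortion
        bound.\<close>
      have "M \<le> G T0"
      proof -
        define \<delta> where "\<delta> = (\<lambda>j. norm (U j - T0))"
        have d: "\<delta> \<longlonglongrightarrow> 0" unfolding \<delta>_def using U by (simp add: LIM_zero tendsto_norm_zero)
        have step: "G (U j) \<le> (1 + \<delta> j / c)\<^sup>2 * G T0" if dj: "\<delta> j \<le> c" for j
        proof -
          have h: "norm (U j y - T0 y) \<le> \<delta> j * norm y" for y
            unfolding \<delta>_def blinfun.diff_left[symmetric] by (rule norm_blinfun)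
          have "dist_sq ?N (U j) x \<le> (1 + \<delta> j / c)\<^sup>2 * dist_sq ?N T0 x" if "x \<in> ?V" for x
            unfolding dist_sq_def power_mult_distrib[symmetric]
            using dist_sq_perturb(1)[OF linB that h _ dj] by (intro power_mono infdist_nonneg) (simp add: \<delta>_def)
          hence "second_moment k b (U j) \<le> avg k b (\<lambda>x. ennreal ((1 + \<delta> j / c)\<^sup>2) * ennreal (dist_sq ?N T0 x))"
            unfolding second_moment_def by (intro avg_mono) (simp add: ennreal_mult'[symmetric] ennreal_leI)
          also have "\<dots> = ennreal ((1 + \<delta> j / c)\<^sup>2) * second_moment k b T0"
            unfolding second_moment_def by (rule avg_cmult) (use dist_sq_measurable[OF linB] in measurable)
          finally have "ennreal (G (U j)) \<le> ennreal ((1 + \<delta> j / c)\<^sup>2 * G T0)"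
            unfolding smG by (simp add: ennreal_mult'[symmetric])
          thus ?thesis using G0 by (simp add: ennreal_le_iff)
        qed
        have "(\<lambda>j. (1 + \<delta> j / c)\<^sup>2 * G T0) \<longlonglongrightarrow> (1 + 0 / c)\<^sup>2 * G T0"
          using c(1) by (intro tendsto_intros d) auto
        hence lim: "(\<lambda>j. (1 + \<delta> j / c)\<^sup>2 * G T0) \<longlonglongrightarrow> G T0" by simp
        have "eventually (\<lambda>j. \<delta> j < c) sequentially" using d c(1) by (rule order_tendstoD(2))
        hence "eventually (\<lambda>j. M - 1 / real (Suc (r j)) \<le> (1 + \<delta> j / c)\<^sup>2 * G T0) sequentially"
        proof eventually_elim
          case (elim j)
          show ?case using step[OF less_imp_le[OF elim]] lowG[of j] by linarith
        qed
        thus ?thesis by (rule tendsto_le[OF sequentially_bot lim lowlim])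
      qed
      show ?thesis
      proof (cases "M > 0")
        case True
        have att: "ennreal M \<le> second_moment k b T0" unfolding smG by (rule ennreal_leI) fact
        have hs: "hs_norm_sq T0 \<le> 1" using T0 by (simp add: K_def)
        obtain \<rho> where rho: "\<rho> > 0" "\<rho> ^ k * gs_prod k b = 1" "\<rho>\<^sup>2 * M \<le> (isotropic_constant DIM('a))\<^sup>2"
          using maximizer_bound[OF _ True max att hs] by (auto simp: k_def)
        \<comment> \<open>The empty \<open>S\<close> bounds the determinant of \<open>N\<close>
          itself, which makes \<open>\<rho> * s\<close> at least 1.\<close>
        have "lattice_det (qproj (span {}) ` ?N) \<le> s ^ (k - dim (span {} :: 'a set))"
          by (rule H) (auto simp: k_def)
        hence "gs_prod k b \<le> s ^ k" using lattice_det_zspan[OF ind] by (simp add: span_empty)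
        hence "\<rho> ^ k * gs_prod k b \<le> \<rho> ^ k * s ^ k" using rho(1) by (intro mult_left_mono) auto
        hence "1 ^ k \<le> (\<rho> * s) ^ k" using rho(2) by (simp add: power_mult_distrib)
        hence "1 \<le> \<rho> * s" using rho(1) s power_le_imp_le_base[of 1 k' "\<rho> * s"] by (simp add: k_def)
        hence "1 \<le> (\<rho> * s)\<^sup>2" by (simp add: one_le_power)
        hence "1 * M \<le> (\<rho> * s)\<^sup>2 * M" using True by (intro mult_right_mono) auto
        also have "\<dots> = s\<^sup>2 * (\<rho>\<^sup>2 * M)" by (simp add: power_mult_distrib)
        also have "\<dots> \<le> s\<^sup>2 * (isotropic_constant DIM('a))\<^sup>2" by (intro mult_left_mono rho(3)) auto
        finally show ?thesis by (simp add: C_def mult.commute)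
      qed (use C0 in simp)
    next
      case False
      then obtain u where u: "u \<in> ?V" "u \<noteq> 0" "T0 u = 0" by blast
      show ?thesis
      proof (rule field_le_epsilon)
        fix e :: real assume e: "e > 0"
        \<comment> \<open>At this length the rounding term is at most \<open>e\<close>. Only
          \<open>norm (U j v)\<close> passes to the limit; the second moment is never evaluated at
          the singular \<open>T0\<close>.\<close>
        have "2 * sqrt e > 0" using e by simp
        then obtain v where v: "v \<in> ?N" "v \<noteq> 0" "norm (T0 v) \<le> 2 * sqrt e"
          using short_vector[OF ind u] by blast
        have Gle: "G (U j) \<le> C + (norm (U j v))\<^sup>2 / 4" for j
        proof -
          have "ennreal (G (U j)) \<le> ennreal (C * hs_norm_sq (U j) + (norm (U j v))\<^sup>2 / 4)"
            unfolding smG[symmetric] by (rule quot[OF linB v(1,2)])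
          hence "G (U j) \<le> C * hs_norm_sq (U j) + (norm (U j v))\<^sup>2 / 4"
            using C0 hs_norm_sq_nonneg[of "U j"] by (simp add: ennreal_le_iff del: ennreal_plus)
          also have "C * hs_norm_sq (U j) \<le> C" using UK[of j] C0 by (simp add: K_def mult_left_le)
          finally show ?thesis by simp
        qed
        have "(\<lambda>j. C + (norm (U j v))\<^sup>2 / 4) \<longlonglongrightarrow> C + (norm (T0 v))\<^sup>2 / 4"
          by (intro tendsto_intros U) auto
        moreover have "eventually (\<lambda>j. M - 1 / real (Suc (r j)) \<le> C + (norm (U j v))\<^sup>2 / 4) sequentially"
          using lowG Gle order_trans by (intro always_eventually allI) blast
        ultimately have "M \<le> C + (norm (T0 v))\<^sup>2 / 4" by (intro tendsto_le[OF sequentially_bot _ lowlim])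
        also have "(norm (T0 v))\<^sup>2 / 4 \<le> e"
          using power_mono[OF v(3), of 2] e by (simp add: power_mult_distrib)
        finally show "M \<le> C + e" by simp
      qed
    qed
  qed
  hence "M * hs_norm_sq T \<le> C * hs_norm_sq T" using hs_norm_sq_nonneg[of T] by (intro mult_right_mono)
  thus ?case using order_trans[OF max[OF Suc.prems(3)] ennreal_leI] unfolding C_def k_def by blast
qed

lemma stable_lattice_cover:
  fixes N :: "'a::euclidean_space set"
  assumes N: "discrete_subgroup N" and s: "s > 0"
    and H: "\<And>S. S \<subseteq> N \<Longrightarrow> dim (span S) < dim (span N) \<Longrightarrow>
      lattice_det (qproj (span S) ` N) \<le> s ^ (dim (span N) - dim (span S))"
    and x: "x \<in> span N"
  shows "(infdist x N)\<^sup>2 \<le> 4 * (isotropic_constant DIM('a))\<^sup>2 * (real (dim (span N)) * s\<^sup>2)"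
proof -
  obtain bs where bs: "lattice_basis bs N" using lattice_basis_exists[OF N] by blast
  define k where "k = length bs"
  define b where "b = (!) bs"
  have k: "dim (span N) = k" using lattice_basis_length[OF bs] by (simp add: k_def)
  have ind: "indep_family k b" and Nz: "N = zspan k b" using bs unfolding lattice_basis_iff k_def b_def by auto
  let ?V = "span (b ` {..<k})"
  have V: "span N = ?V" unfolding Nz by (rule span_zspan)
  \<comment> \<open>The orthogonal projection onto the span acts there as the identity, but its
    squared Hilbert-Schmidt norm is the rank \<open>k\<close>, not the ambient dimension.\<close>
  define T where "T = (\<lambda>x. x - qproj ?V x)"
  have linT: "linear T" unfolding T_def
    by (intro linear_compose_sub linear_ident linear_qproj subspace_span)
  have Tx: "T x = x" if "x \<in> ?V" for x using qproj_eq_0[OF subspace_span that] by (simp add: T_def)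
  have TV: "T x \<in> ?V" for x unfolding T_def by (rule qproj_diff) simp
  have "hs_norm_sq T = (\<Sum>i\<in>Basis. \<Sum>j<k. (inner (gs_frame b j) i)\<^sup>2)"
    unfolding hs_norm_sq_def
  proof (intro sum.cong refl)
    fix i :: 'a assume "i \<in> Basis"
    have "inner (gs_frame b j) (T i) = inner (gs_frame b j) i" if "j < k" for j
      using inner_qproj[OF subspace_span gs_frame_in_span[OF that], of b i]
      by (simp add: T_def inner_diff_right inner_commute)
    thus "(norm (T i))\<^sup>2 = (\<Sum>j<k. (inner (gs_frame b j) i)\<^sup>2)" using norm_sq_frame[OF ind TV[of i]] by simp
  qed
  also have "\<dots> = (\<Sum>j<k. \<Sum>i\<in>Basis. (inner (gs_frame b j) i)\<^sup>2)" by (rule sum.swap)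
  also have "\<dots> = (\<Sum>j<k. 1)"
  proof (intro sum.cong refl)
    fix j assume "j \<in> {..<k}"
    hence "inner (gs_frame b j) (gs_frame b j) = 1" using gs_frame_orthonormal[OF ind, of j j] by simp
    thus "(\<Sum>i\<in>Basis. (inner (gs_frame b j) i)\<^sup>2) = 1"
      by (subst (asm) euclidean_inner) (simp add: power2_eq_square)
  qed
  finally have hsT: "hs_norm_sq T = real k" by simp
  have "T ` N = N" using Tx V span_superset[of N] by force
  hence "second_moment k b (\<lambda>x. x) = second_moment k b T"
    unfolding second_moment_def Nz by (intro avg_cong) (simp add: dist_sq_def Tx)
  moreover have "second_moment k b T \<le> ennreal ((isotropic_constant DIM('a))\<^sup>2 * s\<^sup>2 * hs_norm_sq T)"
    by (rule second_moment_le[OF ind s linT H[unfolded k, unfolded Nz]])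
  ultimately have le: "4 * second_moment k b (\<lambda>x. x) \<le> 4 * ennreal ((isotropic_constant DIM('a))\<^sup>2 * s\<^sup>2 * real k)"
    unfolding hsT by (intro mult_left_mono) auto
  have "ennreal ((infdist x N)\<^sup>2) \<le> 4 * second_moment k b (\<lambda>x. x)"
    unfolding Nz by (rule infdist_sq_le_second_moment[OF ind x[unfolded V]])
  also have "\<dots> \<le> 4 * ennreal ((isotropic_constant DIM('a))\<^sup>2 * s\<^sup>2 * real k)" by (rule le)
  also have "\<dots> = ennreal (4 * ((isotropic_constant DIM('a))\<^sup>2 * s\<^sup>2 * real k))"
    by (subst ennreal_mult') auto
  finally have "(infdist x N)\<^sup>2 \<le> 4 * ((isotropic_constant DIM('a))\<^sup>2 * s\<^sup>2 * real k)"
    by (subst (asm) ennreal_le_iff) auto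
  thus ?thesis unfolding k by (simp only: mult_ac)
qed

text \<open>Approximate the projection of \<open>x\<close> first, then correct inside the span of
  \<open>S\<close>, which leaves the projected error alone. The two errors are orthogonal, so
  squared radii add.\<close>

lemma cover_extension:
  assumes N: "discrete_subgroup N" and S: "S \<subseteq> N"
    and 1: "\<And>x. x \<in> span (N \<inter> span S) \<Longrightarrow> (infdist x (N \<inter> span S))\<^sup>2 \<le> \<rho>1"
    and 2: "\<And>x. x \<in> span (qproj (span S) ` N) \<Longrightarrow> (infdist x (qproj (span S) ` N))\<^sup>2 \<le> \<rho>2"
    and x: "x \<in> span N"
  shows "(infdist x N)\<^sup>2 \<le> \<rho>1 + \<rho>2"
proof -
  let ?P = "qproj (span S)"
  have lin: "linear ?P" by (rule linear_qproj) simp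
  have "?P x \<in> span (?P ` N)" using x linear_span_image[OF lin, of N] by auto
  hence le2: "(infdist (?P x) (?P ` N))\<^sup>2 \<le> \<rho>2" by (rule 2)
  obtain z' where z': "z' \<in> ?P ` N" "infdist (?P x) (?P ` N) = norm (?P x - z')"
    by (rule infdist_attained[OF discrete_qproj[OF N S]])
  then obtain z where z: "z \<in> N" "z' = ?P z" by auto
  define y where "y = x - z"
  define w where "w = y - ?P y"
  have w: "w \<in> span S" unfolding w_def by (rule qproj_diff) simp
  moreover have "S \<subseteq> N \<inter> span S" using S span_superset[of S] by blast
  ultimately have "w \<in> span (N \<inter> span S)" using span_mono by blast
  hence le1: "(infdist w (N \<inter> span S))\<^sup>2 \<le> \<rho>1" by (rule 1)
  obtain u where u: "u \<in> N \<inter> span S" "infdist w (N \<inter> span S) = norm (w - u)"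
    by (rule infdist_attained[OF discrete_Int[OF N subspace_span]])
  have zu: "z + u \<in> N" using discrete_subgroupD(5)[OF N z(1)] u by blast
  have "(infdist x N)\<^sup>2 \<le> (norm (x - (z + u)))\<^sup>2"
    using infdist_le[OF zu, of x] by (intro power_mono infdist_nonneg) (simp add: dist_norm)
  also have "x - (z + u) = ?P y + (w - u)" by (simp add: y_def w_def)
  also have "(norm \<dots>)\<^sup>2 = (norm (?P y))\<^sup>2 + (norm (w - u))\<^sup>2"
  proof (rule norm_add_Pythagorean)
    have "w - u \<in> span S" using w u by (intro span_diff) auto
    thus "real_inner_class.orthogonal (?P y) (w - u)"
      unfolding real_inner_class.orthogonal_def by (intro inner_qproj) auto
  qed
  finally have "(infdist x N)\<^sup>2 \<le> (norm (?P y))\<^sup>2 + (norm (w - u))\<^sup>2" .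
  moreover have "?P y = ?P x - z'" unfolding y_def z(2) by (rule linear_diff[OF lin])
  ultimately show ?thesis using le1 le2 unfolding u(2) z'(2) by simp
qed

text \<open>Lift \<open>S'\<close> to \<open>N\<close> and remove it together with \<open>S\<close>:
  the family of projections of \<open>N\<close> is closed under further projection.\<close>

lemma quotient_of_quotient:
  assumes S: "S \<subseteq> N" and S': "S' \<subseteq> qproj (span S) ` N"
  obtains S0 where "S0 \<subseteq> N" "qproj (span S') ` qproj (span S) ` N = qproj (span S0) ` N"
    "dim (span S0) = dim (span S') + dim (span S)"
proof -
  let ?P = "qproj (span S)"
  have lin: "linear ?P" by (rule linear_qproj) simp
  obtain S1 where S1: "S1 \<subseteq> N" "S' = ?P ` S1" using S' unfolding subset_image_iff by blast
  let ?X = "span (S \<union> S1)"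
  have WX: "span S \<subseteq> ?X" by (intro span_mono) auto
  have P0: "?P ` S \<subseteq> {0}" using qproj_eq_0[OF subspace_span] span_base by blast
  have "?P ` ?X = span (?P ` (S \<union> S1))" by (rule linear_span_image[OF lin, symmetric])
  also have "?P ` (S \<union> S1) = ?P ` S \<union> S'" by (simp add: image_Un S1(2))
  also have "span \<dots> = span S'"
  proof
    show "span (?P ` S \<union> S') \<subseteq> span S'"
      using P0 span_0[of S'] span_superset[of S'] by (intro span_minimal) auto
  qed (intro span_mono Un_upper2)
  finally have PX: "?P ` ?X = span S'" .
  have "dim (?P ` ?X) + dim (span S) = dim ?X" by (rule qproj_image_dim) (use WX in auto)
  hence "dim ?X = dim (span S') + dim (span S)" unfolding PX by simp
  moreover have "qproj (span S') ` ?P ` N = qproj ?X ` N"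
    unfolding image_image PX[symmetric] using qproj_comp[OF subspace_span subspace_span WX] by simp
  ultimately show ?thesis using that[of "S \<union> S1"] S S1(1) by blast
qed

text \<open>Multiplicativity for the lattice projected along \<open>S'\<close>. Its points in the
  image of the span of \<open>S\<close> come from lattice points in that span, because
  \<open>S'\<close> lies in it.\<close>

lemma quotient_det_multiplicative:
  assumes N: "discrete_subgroup N" and S: "S \<subseteq> N" and S': "S' \<subseteq> N \<inter> span S"
  shows "lattice_det (qproj (span S') ` N) =
    lattice_det (qproj (span S') ` (N \<inter> span S)) * lattice_det (qproj (span S) ` N)"
proof -
  let ?P = "qproj (span S')"
  have lin: "linear ?P" by (rule linear_qproj) simp
  have sub: "span S' \<subseteq> span S" using S' by (intro span_minimal) auto
  have D: "discrete_subgroup (?P ` N)" using discrete_qproj[OF N, of S'] S' by auto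
  have sp: "span (?P ` S) = ?P ` span S" by (rule linear_span_image[OF lin])
  have "lattice_det (?P ` N) = lattice_det (?P ` N \<inter> span (?P ` S)) * lattice_det (qproj (span (?P ` S)) ` ?P ` N)"
    by (rule lattice_det_multiplicative[OF D]) (use S in auto)
  also have "?P ` N \<inter> span (?P ` S) = ?P ` (N \<inter> span S)"
  proof
    show "?P ` N \<inter> span (?P ` S) \<subseteq> ?P ` (N \<inter> span S)"
    proof
      fix y assume "y \<in> ?P ` N \<inter> span (?P ` S)"
      then obtain z w where zw: "z \<in> N" "y = ?P z" "w \<in> span S" "y = ?P w" unfolding sp by auto
      have "?P (z - w) = 0" using zw by (simp add: linear_diff[OF lin])
      hence "z - w \<in> span S" using qproj_eq_0_iff[OF subspace_span] sub by blast
      hence "(z - w) + w \<in> span S" using zw(3) by (rule span_add)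
      thus "y \<in> ?P ` (N \<inter> span S)" using zw by simp
    qed
  qed (auto simp: sp)
  also have "qproj (span (?P ` S)) ` ?P ` N = qproj (span S) ` N"
    unfolding image_image sp using qproj_comp[OF subspace_span subspace_span sub] by simp
  finally show ?thesis .
qed

section \<open>General lattices\<close>

text \<open>Each of the \<open>c\<close> terms is at least \<open>1 / (m + c)\<close>. This turns
  the cost of splitting off rank \<open>c\<close> after rank \<open>m\<close> into a segment of the
  harmonic sum.\<close>

lemma sum_inverse_ge: "real c / real (m + c) \<le> (\<Sum>j\<in>{m<..m + c}. 1 / real j)"
proof -
  have "(\<Sum>j\<in>{m<..m + c}. 1 / real (m + c)) \<le> (\<Sum>j\<in>{m<..m + c}. 1 / real j)"
    by (intro sum_mono divide_left_mono) auto
  thus ?thesis by simp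
qed

text \<open>The projection split off has almost the largest normalized determinant, so the normalized
  determinants of the remaining part do not decrease when it is combined with that projection.\<close>
lemma cover_by_slopes:
  fixes N :: "'a::euclidean_space set"
  assumes "discrete_subgroup N"
    and "\<And>S. S \<subseteq> N \<Longrightarrow> dim (span S) < dim (span N) \<Longrightarrow>
      real (m + (dim (span N) - dim (span S))) *
        (lattice_det (qproj (span S) ` N) powr (1 / real (dim (span N) - dim (span S))))\<^sup>2 \<le> D"
    and "x \<in> span N" and "D \<ge> 0"
  shows "(infdist x N)\<^sup>2 \<le> 4 * (isotropic_constant DIM('a))\<^sup>2 * D * (\<Sum>j\<in>{m<..m + dim (span N)}. 1 / real j)"
  using assms
proof (induction "dim (span N)" arbitrary: N m D x rule: less_induct)
  case less
  \<comment> \<open>\<open>m\<close> is the rank already split off. A projection of rank r is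
    weighted by \<open>m + r\<close>, as if still combined with what is gone; for
    \<open>m = 0\<close> the weighted terms are the squares of those in
    \<open>mu_det\<close>.\<close>
  note N = less.prems(1) and H = less.prems(2) and D = less.prems(4)
  define k where "k = dim (span N)"
  define I where "I = (isotropic_constant DIM('a))\<^sup>2"
  have I: "I \<ge> 0" by (simp add: I_def)
  show ?case
  proof (cases "k = 0")
    case True
    hence "N \<subseteq> {0}" by (simp add: k_def)
    hence "span N \<subseteq> span {0}" by (rule span_mono)
    hence "x \<in> N" using less.prems(3) discrete_subgroupD(1)[OF N] by auto
    thus ?thesis using True D by (simp add: k_def)
  next
    case False
    define A where "A = {S. S \<subseteq> N \<and> dim (span S) < k}"
    define sl where "sl = (\<lambda>S. lattice_det (qproj (span S) ` N) powr (1 / real (k - dim (span S))))"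
    have sl: "sl S > 0" "lattice_det (qproj (span S) ` N) = sl S ^ (k - dim (span S))"
      "real (m + (k - dim (span S))) * (sl S)\<^sup>2 \<le> D" if "S \<in> A" for S
    proof -
      have pos: "lattice_det (qproj (span S) ` N) > 0"
        using that by (intro lattice_det_pos discrete_qproj N) (simp add: A_def)
      thus "sl S > 0" by (simp add: sl_def)
      have "k - dim (span S) > 0" using that by (simp add: A_def)
      thus "lattice_det (qproj (span S) ` N) = sl S ^ (k - dim (span S))"
        using pos by (simp add: sl_def powr_powr powr_realpow[symmetric])
      show "real (m + (k - dim (span S))) * (sl S)\<^sup>2 \<le> D"
        using H[of S] that by (simp add: A_def k_def sl_def)
    qed
    have ne: "{} \<in> A" using False by (simp add: A_def)
    have bdd: "bdd_above (sl ` A)"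
    proof (rule bdd_aboveI2)
      fix S assume S: "S \<in> A"
      have "1 * (sl S)\<^sup>2 \<le> real (m + (k - dim (span S))) * (sl S)\<^sup>2"
        using S by (intro mult_right_mono) (auto simp: A_def)
      hence "(sl S)\<^sup>2 \<le> D" using sl(3)[OF S] by simp
      thus "sl S \<le> sqrt D" by (rule real_le_rsqrt)
    qed
    define s0 where "s0 = Sup (sl ` A)"
    have sls0: "sl S \<le> s0" if "S \<in> A" for S unfolding s0_def using that bdd by (rule cSUP_upper)
    have s0: "s0 > 0" using sls0[OF ne] sl(1)[OF ne] by linarith
    define B where "B = 4 * I * D * (\<Sum>j\<in>{m<..m + k}. 1 / real j)"
    \<comment> \<open>No projection is known to attain \<open>s0\<close>, so one within the factor
      \<open>1 + \<eta>\<close> is split off; the power \<open>2 * k\<close> absorbs the loss in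
      both parts.\<close>
    have bound: "(infdist x N)\<^sup>2 \<le> (1 + \<eta>) ^ (2 * k) * B" if eta: "\<eta> > 0" for \<eta> :: real
    proof -
      have "s0 / (1 + \<eta>) < s0" using s0 eta by (simp add: field_simps)
      then obtain S where S: "S \<in> A" "s0 / (1 + \<eta>) < sl S"
        using less_cSUP_iff[OF _ bdd] ne unfolding s0_def by blast
      have SN: "S \<subseteq> N" and dS: "dim (span S) < k" using S(1) by (auto simp: A_def)
      define d where "d = dim (span S)"
      define c where "c = k - d"
      have cd: "k = c + d" "c > 0" using dS by (auto simp: c_def d_def)
      define s where "s = sl S"
      have s: "s > 0" using sl(1)[OF S(1)] by (simp add: s_def)
      have s0s: "s0 \<le> (1 + \<eta>) * s" using S(2) eta by (simp add: s_def field_simps)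
      have detS: "lattice_det (qproj (span S) ` N) = s ^ c"
        using sl(2)[OF S(1)] by (simp add: s_def c_def d_def)
      have Hs: "real (m + c) * s\<^sup>2 \<le> D" using sl(3)[OF S(1)] by (simp add: s_def c_def d_def)
      have one: "1 \<le> (1 + \<eta>) ^ j" for j using eta by (simp add: one_le_power)
      let ?N1 = "qproj (span S) ` N"
      have N1: "discrete_subgroup ?N1" by (rule discrete_qproj[OF N SN])
      have lin: "linear (qproj (span S))" by (rule linear_qproj) simp
      have dimN1: "dim (span ?N1) = c"
      proof -
        have "span ?N1 = qproj (span S) ` span N" by (rule linear_span_image[OF lin])
        moreover have "dim (qproj (span S) ` span N) + dim (span S) = dim (span N)"
          by (rule qproj_image_dim[OF subspace_span subspace_span span_mono[OF SN]])
        ultimately show ?thesis using cd by (simp add: d_def k_def)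
      qed
      define \<rho>2 where "\<rho>2 = 4 * I * (real c * s0\<^sup>2)"
      \<comment> \<open>Projections of \<open>?N1\<close> are projections of \<open>N\<close>, so
        their normalized determinants are at most \<open>s0\<close> and
        \<open>stable_lattice_cover\<close> applies.\<close>
      have cov2: "(infdist y ?N1)\<^sup>2 \<le> \<rho>2" if "y \<in> span ?N1" for y
        unfolding \<rho>2_def I_def dimN1[symmetric]
      proof (rule stable_lattice_cover[OF N1 s0 _ that])
        fix S' assume S': "S' \<subseteq> ?N1" "dim (span S') < dim (span ?N1)"
        obtain S0 where S0: "S0 \<subseteq> N" "qproj (span S') ` ?N1 = qproj (span S0) ` N"
          "dim (span S0) = dim (span S') + dim (span S)"
          using quotient_of_quotient[OF SN S'(1)] .
        have S0A: "S0 \<in> A" using S0 S'(2) dimN1 cd by (simp add: A_def d_def)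
        have "lattice_det (qproj (span S') ` ?N1) = sl S0 ^ (k - dim (span S0))"
          unfolding S0(2) by (rule sl(2)[OF S0A])
        also have "k - dim (span S0) = dim (span ?N1) - dim (span S')" using S0(3) dimN1 cd by (simp add: d_def)
        also have "sl S0 ^ \<dots> \<le> s0 ^ \<dots>" using sls0[OF S0A] sl(1)[OF S0A] by (intro power_mono) auto
        finally show "lattice_det (qproj (span S') ` ?N1) \<le> s0 ^ (dim (span ?N1) - dim (span S'))" .
      qed
      have rho2: "\<rho>2 \<le> 4 * I * ((1 + \<eta>) ^ (2 * k) * D) * (\<Sum>j\<in>{m<..m + c}. 1 / real j)"
      proof -
        have "s0\<^sup>2 \<le> ((1 + \<eta>) * s)\<^sup>2" using s0s s0 by (intro power_mono) auto
        also have "\<dots> = (1 + \<eta>)\<^sup>2 * s\<^sup>2" by (simp add: power_mult_distrib)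
        also have "\<dots> \<le> (1 + \<eta>) ^ (2 * k) * s\<^sup>2"
          using eta False by (intro mult_right_mono power_increasing) auto
        also have "s\<^sup>2 \<le> D / real (m + c)" using Hs cd by (simp add: field_simps)
        finally have "s0\<^sup>2 \<le> (1 + \<eta>) ^ (2 * k) * (D / real (m + c))" using eta by (simp add: mult_left_mono)
        hence "real c * s0\<^sup>2 \<le> real c * ((1 + \<eta>) ^ (2 * k) * (D / real (m + c)))" by (rule mult_left_mono) simp
        also have "\<dots> = (1 + \<eta>) ^ (2 * k) * D * (real c / real (m + c))" by simp
        also have "\<dots> \<le> (1 + \<eta>) ^ (2 * k) * D * (\<Sum>j\<in>{m<..m + c}. 1 / real j)"
          using eta D by (intro mult_left_mono sum_inverse_ge) auto
        finally have "4 * I * (real c * s0\<^sup>2) \<le> 4 * I * ((1 + \<eta>) ^ (2 * k) * D * (\<Sum>j\<in>{m<..m + c}. 1 / real j))"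
          using I by (intro mult_left_mono) auto
        thus ?thesis unfolding \<rho>2_def by (simp only: mult.assoc)
      qed
      let ?N' = "N \<inter> span S"
      have N': "discrete_subgroup ?N'" by (rule discrete_Int[OF N subspace_span])
      have spanN': "span ?N' = span S"
        using SN by (intro antisym span_minimal span_mono) (auto intro: span_base)
      have dimN': "dim (span ?N') = d" by (simp add: spanN' d_def)
      \<comment> \<open>The sublattice is treated with rank \<open>m + c\<close> already split off,
        so its harmonic segment starts where that of the projection ends.\<close>
      define \<rho>1 where "\<rho>1 = 4 * I * ((1 + \<eta>) ^ (2 * k) * D) * (\<Sum>j\<in>{m + c<..m + c + d}. 1 / real j)"
      have cov1: "(infdist y ?N')\<^sup>2 \<le> \<rho>1" if y: "y \<in> span ?N'" for y
        unfolding \<rho>1_def I_def dimN'[symmetric]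
      proof (rule less.hyps[OF _ N' _ y])
        show "dim (span ?N') < dim (span N)" using dimN' cd by (simp add: k_def)
        show "(1 + \<eta>) ^ (2 * k) * D \<ge> 0" using eta D by simp
        fix S' assume S': "S' \<subseteq> ?N'" "dim (span S') < dim (span ?N')"
        define c' where "c' = d - dim (span S')"
        have c': "c' > 0" using S'(2) dimN' by (simp add: c'_def)
        have S'A: "S' \<in> A" using S' dimN' cd by (auto simp: A_def)
        define u where "u = sl S'"
        have u: "u > 0" "u \<le> s0" using sl(1)[OF S'A] sls0[OF S'A] by (auto simp: u_def)
        have cc': "k - dim (span S') = c + c'" using S'(2) dimN' cd by (simp add: c'_def)
        define t where "t = lattice_det (qproj (span S') ` ?N') powr (1 / real c')"
        have pos: "lattice_det (qproj (span S') ` ?N') > 0"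
          by (intro lattice_det_pos discrete_qproj N' S')
        have t: "t > 0" "lattice_det (qproj (span S') ` ?N') = t ^ c'"
          using pos c' by (auto simp: t_def powr_powr powr_realpow[symmetric])
        \<comment> \<open>The projection of \<open>N\<close> along \<open>S'\<close>, with
          normalized determinant \<open>u\<close>, combines a remaining part with \<open>t\<close>
          and the split-off part with \<open>s\<close>. As \<open>u\<close> is at most
          \<open>(1 + \<eta>) * s\<close>, \<open>t\<close> exceeds \<open>u\<close> at most by a
          power of \<open>1 + \<eta>\<close>.\<close>
        have "t ^ c' * s ^ c = u ^ (c + c')"
          using quotient_det_multiplicative[OF N SN S'(1)] sl(2)[OF S'A] detS t(2) cc' by (simp add: u_def)
        also have "\<dots> = u ^ c' * u ^ c" by (simp add: power_add mult.commute)
        also have "\<dots> \<le> u ^ c' * ((1 + \<eta>) * s) ^ c" using u s0s by (intro mult_left_mono power_mono) auto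
        finally have "t ^ c' * s ^ c \<le> u ^ c' * ((1 + \<eta>) * s) ^ c" .
        hence "t ^ c' * s ^ c \<le> (u ^ c' * (1 + \<eta>) ^ c) * s ^ c" by (simp add: power_mult_distrib mult_ac)
        hence "t ^ c' \<le> u ^ c' * (1 + \<eta>) ^ c" using s by simp
        also have "\<dots> \<le> u ^ c' * (1 + \<eta>) ^ (k * c')"
        proof (intro mult_left_mono power_increasing)
          have "c * 1 \<le> k * c'" using cd c' by (intro mult_mono) auto
          thus "c \<le> k * c'" by simp
        qed (use eta u in auto)
        also have "\<dots> = (u * (1 + \<eta>) ^ k) ^ c'" by (simp add: power_mult_distrib power_mult)
        finally have "t ^ c' \<le> (u * (1 + \<eta>) ^ k) ^ c'" .
        hence "t \<le> u * (1 + \<eta>) ^ k" using c' u eta t by (subst (asm) power_mono_iff) auto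
        hence "t\<^sup>2 \<le> (u * (1 + \<eta>) ^ k)\<^sup>2" using t by (intro power_mono) auto
        also have "\<dots> = (1 + \<eta>) ^ (2 * k) * u\<^sup>2" by (simp add: power_mult_distrib power_mult[symmetric] mult.commute)
        finally have "real (m + c + c') * t\<^sup>2 \<le> real (m + c + c') * ((1 + \<eta>) ^ (2 * k) * u\<^sup>2)"
          by (intro mult_left_mono) auto
        also have "\<dots> = (1 + \<eta>) ^ (2 * k) * (real (m + (k - dim (span S'))) * u\<^sup>2)" unfolding cc' by (simp add: mult_ac add.assoc)
        also have "\<dots> \<le> (1 + \<eta>) ^ (2 * k) * D"
          using sl(3)[OF S'A] eta by (intro mult_left_mono) (auto simp: u_def)
        finally show "real (m + c + (dim (span ?N') - dim (span S'))) *
          (lattice_det (qproj (span S') ` ?N') powr (1 / real (dim (span ?N') - dim (span S'))))\<^sup>2 \<le> (1 + \<eta>) ^ (2 * k) * D"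
          unfolding dimN' c'_def[symmetric] t_def[symmetric] .
      qed
      have "(infdist x N)\<^sup>2 \<le> \<rho>1 + \<rho>2" by (rule cover_extension[OF N SN cov1 cov2 less.prems(3)])
      also have "\<dots> \<le> 4 * I * ((1 + \<eta>) ^ (2 * k) * D) * (\<Sum>j\<in>{m + c<..m + c + d}. 1 / real j)
          + 4 * I * ((1 + \<eta>) ^ (2 * k) * D) * (\<Sum>j\<in>{m<..m + c}. 1 / real j)"
        using rho2 by (simp add: \<rho>1_def)
      also have "\<dots> = 4 * I * ((1 + \<eta>) ^ (2 * k) * D) * ((\<Sum>j\<in>{m<..m + c}. 1 / real j) + (\<Sum>j\<in>{m + c<..m + c + d}. 1 / real j))"
        by (simp only: distrib_left add.commute)
      also have "(\<Sum>j\<in>{m<..m + c}. 1 / real j) + (\<Sum>j\<in>{m + c<..m + c + d}. 1 / real j) = (\<Sum>j\<in>{m<..m + k}. 1 / real j)"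
      proof -
        have "{m<..m + k} = {m<..m + c} \<union> {m + c<..m + c + d}" using cd by auto
        thus ?thesis by (simp add: sum.union_disjoint)
      qed
      finally show ?thesis by (simp add: B_def mult_ac)
    qed
    \<comment> \<open>Take \<open>\<eta> = 1 / (n + 1)\<close> and let it tend to 0.\<close>
    have "(\<lambda>n. (1 + 1 / real (Suc n)) ^ (2 * k) * B) \<longlonglongrightarrow> (1 + 0) ^ (2 * k) * B"
      using LIMSEQ_inverse_real_of_nat by (intro tendsto_intros) (simp add: inverse_eq_divide)
    hence lim: "(\<lambda>n. (1 + 1 / real (Suc n)) ^ (2 * k) * B) \<longlonglongrightarrow> B" by simp
    have "(infdist x N)\<^sup>2 \<le> B"
      by (rule tendsto_lowerbound[OF lim]) (auto intro!: always_eventually bound)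
    thus ?thesis by (simp add: B_def I_def k_def)
  qed
qed

text \<open>Each step uses \<open>ln x \<le> x - 1\<close> at
  \<open>x = n / (n + 1)\<close>.\<close>

lemma sum_inverse_le_ln: "n > 0 \<Longrightarrow> (\<Sum>j\<in>{0<..n}. 1 / real j) \<le> ln (real n) + 1"
proof (induction n)
  case (Suc n)
  have "{0<..Suc n} = insert (Suc n) {0<..n}" by auto
  hence eq: "(\<Sum>j\<in>{0<..Suc n}. 1 / real j) = 1 / real (Suc n) + (\<Sum>j\<in>{0<..n}. 1 / real j)" by simp
  show ?case
  proof (cases "n = 0")
    case False
    have "ln (real n / real (Suc n)) \<le> real n / real (Suc n) - 1" using False by (intro ln_le_minus_one) simp
    moreover have "ln (real n / real (Suc n)) = ln (real n) - ln (real (Suc n))" using False by (simp add: ln_div)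
    moreover have "real n / real (Suc n) - 1 = - (1 / real (Suc n))" by (simp add: field_simps)
    ultimately have "1 / real (Suc n) \<le> ln (real (Suc n)) - ln (real n)" by linarith
    thus ?thesis using Suc.IH False unfolding eq by simp
  qed (unfold eq, simp)
qed simp

section \<open>Lattice subspaces and the two inequalities\<close>

lemma lattice_subspace_iff:
  fixes L :: "'a::euclidean_space set"
  shows "lattice_subspace L W \<longleftrightarrow> (\<exists>S. S \<subseteq> L \<and> dim (span S) < DIM('a) \<and> W = span S)"
proof
  assume "lattice_subspace L W"
  then obtain S where "S \<subseteq> L" "independent S" "card S < DIM('a)" "W = span S" by (auto simp: lattice_subspace_def)
  thus "\<exists>S. S \<subseteq> L \<and> dim (span S) < DIM('a) \<and> W = span S"
    using dim_eq_card_independent[of S] by (intro exI[of _ S]) simp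
next
  assume "\<exists>S. S \<subseteq> L \<and> dim (span S) < DIM('a) \<and> W = span S"
  then obtain S where S: "S \<subseteq> L" "dim (span S) < DIM('a)" "W = span S" by blast
  obtain S' where S': "S' \<subseteq> S" "independent S'" "span S' = span S" using finite_spanning_subset[of S] by metis
  have "card S' = dim (span S)" using dim_eq_card_independent[OF S'(2)] S'(3) by (metis dim_span)
  thus "lattice_subspace L W" unfolding lattice_subspace_def using S S' by (intro exI[of _ S']) auto
qed

theorem theorem6p8:
  fixes L :: "(real ^ 'n) set"
  assumes "full_lattice L"
  shows "1 / sqrt (2 * pi * exp 1) * mu_det L \<le> covering_radius L \<and>
    covering_radius L \<le>
      5 * sqrt (ln (real CARD('n)) + 1) * isotropic_constant CARD('n) * mu_det L"
proof -
  let ?n = "CARD('n)"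
  obtain bs where bs: "lattice_basis bs L" "length bs = DIM(real^'n)" using assms by (auto simp: full_lattice_def)
  have L: "discrete_subgroup L" by (rule lattice_basis_discrete[OF bs(1)])
  have dimL: "dim (span L) = ?n" using lattice_basis_length[OF bs(1)] bs(2) by simp
  hence spanL: "span L = UNIV" by (intro dim_eq_full[THEN iffD1]) simp
  define b where "b = (!) bs"
  have Lz: "L = zspan ?n b" using bs unfolding lattice_basis_iff b_def by simp
  obtain R where R: "R > 0" "\<And>x. x \<in> span (b ` {..<?n}) \<Longrightarrow> \<exists>z\<in>zspan ?n b. norm (x - z) \<le> R"
    using lattice_cover_bound[of b ?n] by blast
  have "infdist x L \<le> R" for x
  proof -
    have "x \<in> span (b ` {..<?n})" using spanL unfolding Lz span_zspan by simp
    then obtain z where z: "z \<in> L" "norm (x - z) \<le> R" using R(2) unfolding Lz by blast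
    thus ?thesis using infdist_le[OF z(1), of x] by (simp add: dist_norm)
  qed
  hence bddL: "bdd_above (range (\<lambda>x. infdist x L))" by (intro bdd_aboveI2)
  define \<mu> where "\<mu> = covering_radius L"
  have mu: "infdist x L \<le> \<mu>" for x unfolding \<mu>_def covering_radius_def by (rule cSUP_upper[OF _ bddL]) simp
  have mu0: "\<mu> \<ge> 0" using mu[of 0] infdist_nonneg[of 0 L] by linarith
  define q where "q = sqrt (2 * pi * exp 1)"
  have q: "q > 0" by (simp add: q_def)
  define f where "f = (\<lambda>W :: (real^'n) set. sqrt (real (dim (orthogonal_comp W))) *
     lattice_det (orthogonal_projection (orthogonal_comp W) ` L) powr (1 / real (dim (orthogonal_comp W))))"
  have md: "mu_det L = (SUP W \<in> {W. lattice_subspace L W}. f W)" by (simp add: mu_det_def f_def)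
  have comp: "orthogonal_comp (span S) = qproj (span S) ` UNIV" for S :: "(real^'n) set"
  proof
    show "orthogonal_comp (span S) \<subseteq> qproj (span S) ` UNIV"
    proof
      fix y assume "y \<in> orthogonal_comp (span S)"
      hence "qproj (span S) y = y" by (intro qproj_unique) (auto simp: span_0)
      thus "y \<in> qproj (span S) ` UNIV" by (metis rangeI)
    qed
  qed (use qproj_mem[OF subspace_span] in auto)
  have dimc: "dim (orthogonal_comp (span S)) = ?n - dim (span S)" for S :: "(real^'n) set"
    using qproj_image_dim[of "span S" UNIV] unfolding comp by simp
  have feq: "f (span S) = sqrt (real (?n - dim (span S))) *
    lattice_det (qproj (span S) ` L) powr (1 / real (?n - dim (span S)))" for S
    unfolding f_def dimc qproj_def ..
  have fle: "f W \<le> q * \<mu>" if W: "lattice_subspace L W" for W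
  proof -
    obtain S where S: "S \<subseteq> L" "dim (span S) < ?n" "W = span S" using W unfolding lattice_subspace_iff by auto
    let ?M = "qproj (span S) ` L"
    have M: "discrete_subgroup ?M" by (rule discrete_qproj[OF L S(1)])
    have lin: "linear (qproj (span S))" by (rule linear_qproj) simp
    have spM: "span ?M = orthogonal_comp (span S)"
      unfolding comp spanL[symmetric] by (rule linear_span_image[OF lin])
    \<comment> \<open>Projection shortens distances, so every projection of \<open>L\<close>
      inherits the covering bound \<open>\<mu>\<close>.\<close>
    have cov: "infdist y ?M \<le> \<mu>" if y: "y \<in> span ?M" for y
    proof -
      obtain x where x: "y = qproj (span S) x" using y unfolding spM comp by auto
      obtain z where z: "z \<in> L" "infdist x L = norm (x - z)" by (rule infdist_attained[OF L])
      have "infdist y ?M \<le> norm (qproj (span S) (x - z))"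
        unfolding x by (rule infdist_linear_image_le[OF lin z(1)])
      also have "\<dots> \<le> norm (x - z)" by (rule norm_qproj_le) simp
      finally show ?thesis using mu[of x] z(2) by simp
    qed
    \<comment> \<open>\<open>lattice_det_root_le\<close> asks for a strictly positive radius,
      whereas only \<open>\<mu> \<ge> 0\<close> has been established; hence the slack
      \<open>e / q\<close>.\<close>
    have "f W \<le> q * \<mu> + e" if e: "e > 0" for e
    proof -
      have "f W \<le> q * (\<mu> + e / q)"
        unfolding S(3) feq q_def[symmetric] using S(2) e q mu0
        by (subst q_def, intro lattice_det_root_le M)
          (auto simp: spM dimc q_def add_nonneg_pos intro: order_trans[OF cov])
      thus ?thesis using q by (simp add: distrib_left)
    qed
    thus ?thesis by (rule field_le_epsilon)
  qed
  have ne: "{0} \<in> {W. lattice_subspace L W}" unfolding mem_Collect_eq lattice_subspace_iff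
    by (intro exI[of _ "{}"]) (simp add: span_empty)
  have "mu_det L \<le> q * \<mu>" unfolding md by (rule cSUP_least) (use ne fle in auto)
  hence lower: "1 / q * mu_det L \<le> \<mu>" using q by (simp add: field_simps)
  have bddf: "bdd_above (f ` {W. lattice_subspace L W})" using fle by (intro bdd_aboveI2) auto
  have fmd: "f W \<le> mu_det L" if "lattice_subspace L W" for W
    unfolding md using that by (intro cSUP_upper bddf) simp
  have f0: "f W \<ge> 0" for W by (simp add: f_def)
  have md0: "mu_det L \<ge> 0" using fmd[of "{0}"] f0[of "{0}"] ne by auto
  define I where "I = isotropic_constant ?n"
  define l where "l = ln (real ?n) + 1"
  have l: "l \<ge> 1" by (simp add: l_def)
  have I0: "I \<ge> 0" using isotropic_constant_nonneg[where 'a = "real^'n"] by (simp add: I_def)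
  have up: "infdist x L \<le> 5 * sqrt l * I * mu_det L" for x
  proof -
    \<comment> \<open>Nothing is split off yet, so \<open>m = 0\<close>, and \<open>D\<close> is the
      square of \<open>mu_det\<close>.\<close>
    have "(infdist x L)\<^sup>2 \<le> 4 * (isotropic_constant DIM(real^'n))\<^sup>2 * (mu_det L)\<^sup>2 * (\<Sum>j\<in>{0<..0 + dim (span L)}. 1 / real j)"
    proof (rule cover_by_slopes[OF L])
      fix S assume S: "S \<subseteq> L" "dim (span S) < dim (span L)"
      have "lattice_subspace L (span S)" unfolding lattice_subspace_iff using S dimL by auto
      hence "(f (span S))\<^sup>2 \<le> (mu_det L)\<^sup>2" using fmd f0 by (intro power_mono)
      thus "real (0 + (dim (span L) - dim (span S))) *
        (lattice_det (qproj (span S) ` L) powr (1 / real (dim (span L) - dim (span S))))\<^sup>2 \<le> (mu_det L)\<^sup>2"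
        unfolding feq dimL by (simp add: power_mult_distrib)
    qed (auto simp: spanL)
    also have "\<dots> \<le> 4 * I\<^sup>2 * (mu_det L)\<^sup>2 * l"
      unfolding dimL using sum_inverse_le_ln[of ?n] by (auto simp: I_def l_def intro!: mult_left_mono)
    also have "\<dots> = (2 * sqrt l * I * mu_det L)\<^sup>2" using l by (simp add: power_mult_distrib)
    finally have "infdist x L \<le> 2 * sqrt l * I * mu_det L"
      by (rule power2_le_imp_le) (use l I0 md0 in auto)
    \<comment> \<open>The argument yields the constant 2, relaxed here to 5.\<close>
    also have "\<dots> \<le> 5 * sqrt l * I * mu_det L" using l I0 md0 by (intro mult_right_mono) auto
    finally show ?thesis .
  qed
  have "\<mu> \<le> 5 * sqrt l * I * mu_det L" unfolding \<mu>_def covering_radius_def by (rule cSUP_least) (use up in auto)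
  thus ?thesis using lower unfolding q_def \<mu>_def l_def I_def by simp
qed

end
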